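(* Consider the setting, data, standing assumptions and notation given in the context, and let a real number $\mu$ (the $H_2$ performance level) be given. Then the following two statements are equivalent: (i) There exist controller matrices $A_c,B_c,C_c,D_c$ (of order $\tilde n$) and symmetric matrices $P\in\mathbb{R}^{2\tilde n\times2\tilde n}$, $Z\in\mathbb{R}^{p_z\times p_z}$ such that the inequalities $$\mathrm{tr}(Z)<\mu^2,\qquad\begin{pmatrix}I&\tilde B^\top\\ \tilde B&P-\tilde AP\tilde A^\top\end{pmatrix}\succ0,\qquad\begin{pmatrix}Z-\tilde D\tilde D^\top&\tilde CP\\ P\tilde C^\top&P\end{pmatrix}\succ0$$ hold for all $(\bar A_s,B_{u0},B_{w0})\in\Sigma$. (ii) The inequalities $$\mathrm{tr}(Z)<\mu^2,\qquad\Pi\succ0,\qquad\Delta\succ0$$ hold for some real scalar $\alpha$, symmetric matrices $Z\in\mathbb{R}^{p_z\times p_z}$, $\bar X,\bar Y\in\mathbb{R}^{\tilde n\times\tilde n}$, and unstructured matrices $\tilde A_c,\tilde B_c,\tilde C_c,D_c$ of compatible sizes, where $\Pi=\begin{pmatrix}\Pi_{11}&\Pi_{12}\\ \Pi_{12}^\top&\Pi_{22}\end{pmatrix}$ and $\Delta$ are the symmetric matrices with $$\Pi_{11}=\begin{pmatrix}\bar X&I&0\\ I&\bar Y&0\\ 0&0&I_{m_w}\end{pmatrix},\qquad \Pi_{12}^\top=\begin{pmatrix}\check A+\check BD_cC&\check A\bar Y+\check B\tilde C_c&\check B_1\\ \bar X\check A+\tilde B_cC&\tilde A_c&\bar X\check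 B_1\\ I&\bar Y&0\\ D_cC&\tilde C_c&0\\ 0&0&I_{m_w}\\ 0_{\tilde p\times\tilde n}&0&0\end{pmatrix},$$ $$\Pi_{22}=\begin{pmatrix}\bar Y&I&\star&\star&\star&\star\\ I&\bar X&\star&\star&\star&\star\\ \begin{pmatrix}0&-\alpha\bar H_{12}^\top\end{pmatrix}L^{-\top}&\begin{pmatrix}0&-\alpha\bar H_{12}^\top\end{pmatrix}L^{-\top}\bar X&-\alpha H_{22}&\star&\star&\star\\ \begin{pmatrix}0&-\alpha\bar H_{13}^\top\end{pmatrix}L^{-\top}&\begin{pmatrix}0&-\alpha\bar H_{13}^\top\end{pmatrix}L^{-\top}\bar X&-\alpha H_{23}^\top&-\alpha H_{33}&\star&\star\\ \begin{pmatrix}0&-\alpha\bar H_{14}^\top\end{pmatrix}L^{-\top}&\begin{pmatrix}0&-\alpha\bar H_{14}^\top\end{pmatrix}L^{-\top}\bar X&-\alpha H_{24}^\top&-\alpha H_{34}^\top&-\alpha H_{44}&\star\\ \begin{pmatrix}0&\alpha\Xi^\top\end{pmatrix}L^{-\top}&\begin{pmatrix}0&\alpha\Xi^\top\end{pmatrix}L^{-\top}\bar X&0&0&0&\alpha\Lambda^{-1}\end{pmatrix},$$ $$\Delta=\begin{pmatrix}I&D_1^\top&0&0\\ \star&Z&C_1+ED_cC&C_1\bar Y+E\tilde C_c\\ \star&\star&\bar X&I\\ \star&\star&\star&\bar Y\end{pmatrix}.$$ Furthermore, from any solution of (ii), controller matrices satisfying (i) (with some $P$ and $Z$) can be reconstructed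 as follows, where $V\in\mathbb{R}^{\tilde n\times\tilde n}$ is an arbitrary full rank matrix: $$\bar U=(I-\bar X\bar Y)V^{-\top},\quad B_c=\bar U^{-1}(\tilde B_c-\bar X\check BD_c),\quad C_c=(\tilde C_c-D_cC\bar Y)V^{-\top},$$ $$A_c=\bar U^{-1}\big(\tilde A_c-\bar X(\check A\bar Y+\check B\tilde C_c)-\bar UB_cC\bar Y\big)V^{-\top}.$$
   Context: Conventions. $\mathrm{col}(\cdot)$ stacks matrices vertically, $\star$ denotes blocks inferred from symmetry, $\succ,\succeq,\prec$ refer to definiteness of symmetric matrices. Block rows/columns of zero dimension are omitted. Plant. The discrete-time LTI system is $$y(t)+\sum_{i=1}^lA_iy(t-i)=\sum_{i=0}^lB_{ui}u(t-i)+\sum_{i=0}^lB_{wi}w(t-i)+B_{d0}d(t),$$ with $y(t)\in\mathbb{R}^p$, control input $u(t)\in\mathbb{R}^m$, performance disturbance $w(t)\in\mathbb{R}^{m_w}$, noise $d(t)\in\mathbb{R}^{m_d}$, and $B_{d0}\in\mathbb{R}^{p\times m_d}$ known of full column rank. Let $$\chi(t)=\mathrm{col}(y(t-1),\dots,y(t-l),u(t-1),\dots,u(t-l),w(t-1),\dots,w(t-l)),$$ $\bar A=(-A_1\cdots -A_l\ \ B_{u1}\cdots B_{ul}\ \ B_{w1}\cdots B_{wl})$. Then $y(t)=\bar A\chi(t)+B_{u0}u(t)+B_{w0}w(t)+B_{d0}d(t)$ and $\chi(t+1)=\hat A\chi(t)+\hat Bu(t)+\hat B_1w(t)+\hat B_dd(t)$,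 with $\hat A=\mathrm{col}(\bar A,J_A)$, $\hat B=\mathrm{col}(B_{u0},J_B)$, $\hat B_1=\mathrm{col}(B_{w0},J_{B_1})$, $\hat B_d=\mathrm{col}(B_{d0},0)$, where $$J_A=\begin{pmatrix}(I_{p(l-1)}\ 0)&0&0\\ 0_{m\times pl}&0&0\\ 0&(I_{m(l-1)}\ 0)&0\\ 0&0_{m_w\times ml}&0_{m_w\times m_wl}\\ 0&0&(I_{m_w(l-1)}\ 0)\end{pmatrix},\quad J_B=\begin{pmatrix}0_{(pl-p)\times m}\\ I_m\\ 0_{(ml-m+m_wl)\times m}\end{pmatrix},\quad J_{B_1}=\begin{pmatrix}0_{(pl-p+ml)\times m_w}\\ I_{m_w}\\ 0_{(m_wl-m_w)\times m_w}\end{pmatrix}.$$ The column blocks of $J_A$ have widths $pl,ml,m_wl$. The performance output is $z(t)=\hat C_1\chi(t)+Eu(t)+D_1w(t)\in\mathbb{R}^{p_z}$ with known $\hat C_1,E,D_1$. The output available for control is $y_c(t)=\hat C\chi(t)$, where $\hat C$ is a known matrix selecting entries of $\chi(t)$ other than entries of $w$. The matrices $\bar A,B_{u0},B_{w0}$ are unknown. Data. Known matrices $Y=(y(0)\cdots y(N-1))$, $X=(\chi(0)\cdots\chi(N-1))$, $U=(u(0)\cdots u(N-1))$, $W=(w(0)\cdots w(N-1))$, and unknown $W_d=(d(0)\cdots d(N-1))$, from one recorded trajectory, so $Y=\bar AX+B_{u0}U+B_{w0}W+B_{d0}W_d$. Let $X=X_s\Sigma_\chi X_r^\top$ be a compact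 singular value decomposition (only nonzero singular values), $X_d:=\Sigma_\chi X_r^\top$, $\tilde n:=\mathrm{rank}(X)$, so $X_s\in\mathbb{R}^{(p+m+m_w)l\times\tilde n}$ has orthonormal columns and $X_d\in\mathbb{R}^{\tilde n\times N}$ has full row rank. Put $\bar A_s:=\bar AX_s$. Consistent set. $\Phi=\begin{pmatrix}\Phi_{11}&\Phi_{12}\\ \Phi_{12}^\top&\Phi_{22}\end{pmatrix}\in\mathbb{R}^{(m_d+N)\times(m_d+N)}$ is a known symmetric matrix with $\Phi_{22}\prec0$. $\Sigma$ is the set of all triples $(\bar A_s,B_{u0},B_{w0})\in\mathbb{R}^{p\times\tilde n}\times\mathbb{R}^{p\times m}\times\mathbb{R}^{p\times m_w}$ such that $Y=\bar A_sX_d+B_{u0}U+B_{w0}W+B_{d0}W_d$ for some $W_d$ satisfying $$\begin{pmatrix}I\\ W_d^\top\end{pmatrix}^\top\Phi\begin{pmatrix}I\\ W_d^\top\end{pmatrix}\succeq0.\qquad( * )$$ Standing assumptions. (1) $\chi(t)\in\mathrm{im}(X)$ for all $t\ge0$ and any $u(t),w(t),d(t)$. (2) The first $p$ rows of $X$ are linearly independent. (3) The actual noise matrix $W_d$ satisfies $( * )$. (4) $\Sigma\ne\emptyset$ and $\mathrm{rank}(\mathrm{col}(X_d,U,W))=\tilde n+m+m_w$. Closed loop. For a triple $(\bar A_s,B_{u0},B_{w0})$ let $A=X_s^\top\mathrm{col}(\bar A_s,J_AX_s)$ (which is $X_s^\top\hat AX_s$), $B=X_s^\top\mathrm{col}(B_{u0},J_B)$,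 $B_1=X_s^\top\mathrm{col}(B_{w0},J_{B_1})$, and let $C_1=\hat C_1X_s$, $C=\hat CX_s$. The controller is $x_c(t+1)=A_cx_c(t)+B_cy_c(t)$, $u(t)=C_cx_c(t)+D_cy_c(t)$ with $x_c(t)\in\mathbb{R}^{\tilde n}$. The closed-loop matrices (from $w$ to $z$) are $$\tilde A=\begin{pmatrix}A+BD_cC&BC_c\\ B_cC&A_c\end{pmatrix},\ \tilde B=\begin{pmatrix}B_1\\ 0\end{pmatrix},\ \tilde C=\begin{pmatrix}C_1+ED_cC&EC_c\end{pmatrix},\ \tilde D=D_1.$$ Auxiliary matrices. Let $$H=(H_{ij})_{i,j=1}^4=\begin{pmatrix}B_{d0}&Y\\ 0&-X_d\\ 0&-U\\ 0&-W\end{pmatrix}\Phi\begin{pmatrix}B_{d0}&Y\\ 0&-X_d\\ 0&-U\\ 0&-W\end{pmatrix}^\top$$ be partitioned with block sizes $p,\tilde n,m,m_w$ (so $H_{ji}=H_{ij}^\top$). Define $$\begin{pmatrix}\check A_s&\check B_{u0}&\check B_{w0}\end{pmatrix}^\top=-\begin{pmatrix}H_{22}&H_{23}&H_{24}\\ H_{23}^\top&H_{33}&H_{34}\\ H_{24}^\top&H_{34}^\top&H_{44}\end{pmatrix}^{-1}\begin{pmatrix}H_{12}^\top\\ H_{13}^\top\\ H_{14}^\top\end{pmatrix}$$ (the inverted matrix is negative definite under the assumptions). Let $\Lambda\in\mathbb{R}^{\tilde p\times\tilde p}$ be a positive definite matrix, and $\Xi\in\mathbb{R}^{p\times\tilde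 p}$, obtained by an arbitrary factorization $$\begin{pmatrix}I&\check A_s&\check B_{u0}&\check B_{w0}\end{pmatrix}H\begin{pmatrix}I&\check A_s&\check B_{u0}&\check B_{w0}\end{pmatrix}^\top=\Xi\Lambda\Xi^\top.$$ Define $$\begin{pmatrix}\bar H_{12}^\top\\ \bar H_{13}^\top\\ \bar H_{14}^\top\end{pmatrix}=\begin{pmatrix}H_{12}^\top&H_{22}&H_{23}&H_{24}\\ H_{13}^\top&H_{23}^\top&H_{33}&H_{34}\\ H_{14}^\top&H_{24}^\top&H_{34}^\top&H_{44}\end{pmatrix}\begin{pmatrix}I\\ \check A_s^\top\\ \check B_{u0}^\top\\ \check B_{w0}^\top\end{pmatrix},$$ $\check A=X_s^\top\mathrm{col}(\check A_s,J_AX_s)$, $\check B=X_s^\top\mathrm{col}(\check B_{u0},J_B)$, $\check B_1=X_s^\top\mathrm{col}(\check B_{w0},J_{B_1})$. Partition $X_s=\mathrm{col}(X_{s1},X_{s2})$ with $X_{s1}\in\mathbb{R}^{p\times\tilde n}$ (full row rank by assumption (2)) and set $L=\mathrm{col}(L_1,L_2)\in\mathbb{R}^{\tilde n\times\tilde n}$, where the columns of $L_1^\top$ form an arbitrary basis of $\ker(X_{s1})$ and $L_2=(X_{s1}X_{s1}^\top)^{-1}X_{s1}$. In expressions such as $(0\ \ {-\alpha\bar H_{12}^\top})$ the zero block has $\tilde n-p$ columns. *)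

theory Defs
  imports
    Complex_Main
    "Jordan_Normal_Form.Matrix"
    "Jordan_Normal_Form.Gauss_Jordan_Elimination"
    "Jordan_Normal_Form.DL_Rank"
    "Jordan_Normal_Form.Matrix_Kernel"
begin

fun hcat :: "real mat list \<Rightarrow> real mat" where
  "hcat [] = 0\<^sub>m 0 0"
| "hcat [A] = A"
| "hcat (A # B # Ms) = four_block_mat A (hcat (B # Ms))
     (0\<^sub>m 0 (dim_col A)) (0\<^sub>m 0 (dim_col (hcat (B # Ms))))"

fun vcat :: "real mat list \<Rightarrow> real mat" where
  "vcat [] = 0\<^sub>m 0 0"
| "vcat [A] = A"
| "vcat (A # B # Ms) = A @\<^sub>r vcat (B # Ms)"

definition blocks :: "real mat list list \<Rightarrow> real mat" where
  "blocks Bs = vcat (map hcat Bs)"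

definition stack_vecs :: "real vec list \<Rightarrow> real vec" where
  "stack_vecs vs = foldr (@\<^sub>v) vs vNil"

definition subblock :: "real mat \<Rightarrow> nat \<Rightarrow> nat \<Rightarrow> nat \<Rightarrow> nat \<Rightarrow> real mat" where
  "subblock A r c nr nc = mat nr nc (\<lambda>(i, j). A $$ (r + i, c + j))"

text \<open>Unspecified if \<open>A\<close> is not invertible.\<close>

definition minv :: "real mat \<Rightarrow> real mat" where
  "minv A = the (mat_inverse A)"

definition mtrace :: "real mat \<Rightarrow> real" where
  "mtrace A = (\<Sum>i<dim_row A. A $$ (i, i))"

definition sym_mats :: "nat \<Rightarrow> real mat set" where
  "sym_mats n = {A \<in> carrier_mat n n. A\<^sup>T = A}"

definition pos_def :: "real mat \<Rightarrow> bool" where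
  "pos_def A \<longleftrightarrow> A \<in> sym_mats (dim_row A) \<and>
     (\<forall>x \<in> carrier_vec (dim_row A). x \<noteq> 0\<^sub>v (dim_row A) \<longrightarrow> 0 < x \<bullet> (A *\<^sub>v x))"

definition pos_semidef :: "real mat \<Rightarrow> bool" where
  "pos_semidef A \<longleftrightarrow> A \<in> sym_mats (dim_row A) \<and>
     (\<forall>x \<in> carrier_vec (dim_row A). 0 \<le> x \<bullet> (A *\<^sub>v x))"

definition neg_def :: "real mat \<Rightarrow> bool" where
  "neg_def A \<longleftrightarrow> pos_def (- A)"

text \<open>\<open>coeff_y i\<close>, \<open>coeff_u i\<close>, \<open>coeff_w i\<close> are $A_i$, $B_{ui}$, $B_{wi}$.
  The signals \<open>rec_y\<close>, \<open>rec_u\<close>, \<open>rec_w\<close>, \<open>rec_d\<close> are the recorded trajectory; only their values on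
  the time window $-l,\dots,N-1$ matter (the past samples enter through $\chi(0)$).
  \<open>svd_left\<close>, \<open>svd_vals\<close>, \<open>svd_right\<close> are $X_s$, $\Sigma_\chi$, $X_r$.\<close>

record plant_data =
  lag :: nat
  dim_y :: nat
  dim_u :: nat
  dim_w :: nat
  dim_d :: nat
  dim_z :: nat
  dim_yc :: nat
  coeff_y :: "nat \<Rightarrow> real mat"
  coeff_u :: "nat \<Rightarrow> real mat"
  coeff_w :: "nat \<Rightarrow> real mat"
  Bd0 :: "real mat"
  Chat1 :: "real mat"
  Emat :: "real mat"
  D1mat :: "real mat"
  Chat :: "real mat"
  samples :: nat
  rec_y :: "int \<Rightarrow> real vec"
  rec_u :: "int \<Rightarrow> real vec"
  rec_w :: "int \<Rightarrow> real vec"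
  rec_d :: "int \<Rightarrow> real vec"
  svd_left :: "real mat"
  svd_vals :: "real mat"
  svd_right :: "real mat"
  Phi :: "real mat"

definition dim_chi :: "plant_data \<Rightarrow> nat" where
  "dim_chi S = (dim_y S + dim_u S + dim_w S) * lag S"

definition signals :: "plant_data \<Rightarrow> (int \<Rightarrow> real vec) \<Rightarrow> (int \<Rightarrow> real vec) \<Rightarrow> (int \<Rightarrow> real vec)
    \<Rightarrow> (int \<Rightarrow> real vec) \<Rightarrow> bool" where
  "signals S y u w d \<longleftrightarrow> (\<forall>t. y t \<in> carrier_vec (dim_y S) \<and> u t \<in> carrier_vec (dim_u S) \<and>
     w t \<in> carrier_vec (dim_w S) \<and> d t \<in> carrier_vec (dim_d S))"

definition plant_eq :: "plant_data \<Rightarrow> (int \<Rightarrow> real vec) \<Rightarrow> (int \<Rightarrow> real vec) \<Rightarrow> (int \<Rightarrow> real vec)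
    \<Rightarrow> (int \<Rightarrow> real vec) \<Rightarrow> int \<Rightarrow> bool" where
  "plant_eq S y u w d t \<longleftrightarrow>
     y t + finsum_vec TYPE(real) (dim_y S) (\<lambda>i. coeff_y S i *\<^sub>v y (t - int i)) {1..lag S} =
     finsum_vec TYPE(real) (dim_y S) (\<lambda>i. coeff_u S i *\<^sub>v u (t - int i)) {0..lag S} +
     finsum_vec TYPE(real) (dim_y S) (\<lambda>i. coeff_w S i *\<^sub>v w (t - int i)) {0..lag S} +
     Bd0 S *\<^sub>v d t"

definition chi :: "plant_data \<Rightarrow> (int \<Rightarrow> real vec) \<Rightarrow> (int \<Rightarrow> real vec) \<Rightarrow> (int \<Rightarrow> real vec)
    \<Rightarrow> int \<Rightarrow> real vec" where
  "chi S y u w t = stack_vecs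
     (map (\<lambda>i. y (t - int i)) [1..<Suc (lag S)] @
      map (\<lambda>i. u (t - int i)) [1..<Suc (lag S)] @
      map (\<lambda>i. w (t - int i)) [1..<Suc (lag S)])"

definition rec_chi :: "plant_data \<Rightarrow> int \<Rightarrow> real vec" where
  "rec_chi S = chi S (rec_y S) (rec_u S) (rec_w S)"

definition data_mat :: "nat \<Rightarrow> nat \<Rightarrow> (int \<Rightarrow> real vec) \<Rightarrow> real mat" where
  "data_mat n N s = mat_of_cols n (map (\<lambda>k. s (int k)) [0..<N])"

definition Ydat :: "plant_data \<Rightarrow> real mat" where
  "Ydat S = data_mat (dim_y S) (samples S) (rec_y S)"

definition Xdat :: "plant_data \<Rightarrow> real mat" where
  "Xdat S = data_mat (dim_chi S) (samples S) (rec_chi S)"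

definition Udat :: "plant_data \<Rightarrow> real mat" where
  "Udat S = data_mat (dim_u S) (samples S) (rec_u S)"

definition Wdat :: "plant_data \<Rightarrow> real mat" where
  "Wdat S = data_mat (dim_w S) (samples S) (rec_w S)"

definition Wd_true :: "plant_data \<Rightarrow> real mat" where
  "Wd_true S = data_mat (dim_d S) (samples S) (rec_d S)"

definition ntil :: "plant_data \<Rightarrow> nat" where
  "ntil S = vec_space.rank (dim_chi S) (Xdat S)"

definition Xd :: "plant_data \<Rightarrow> real mat" where
  "Xd S = svd_vals S * (svd_right S)\<^sup>T"

definition compact_svd :: "nat \<Rightarrow> nat \<Rightarrow> nat \<Rightarrow> real mat \<Rightarrow> real mat \<Rightarrow> real mat \<Rightarrow> real mat \<Rightarrow> bool" where
  "compact_svd nr nc r X F D G \<longleftrightarrow>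
     F \<in> carrier_mat nr r \<and> D \<in> carrier_mat r r \<and> G \<in> carrier_mat nc r \<and>
     F\<^sup>T * F = 1\<^sub>m r \<and> G\<^sup>T * G = 1\<^sub>m r \<and>
     diagonal_mat D \<and> (\<forall>i<r. 0 < D $$ (i, i)) \<and>
     X = F * D * G\<^sup>T"

definition noise_bound :: "plant_data \<Rightarrow> real mat \<Rightarrow> bool" where
  "noise_bound S Wd \<longleftrightarrow>
     pos_semidef ((vcat [1\<^sub>m (dim_d S), Wd\<^sup>T])\<^sup>T * Phi S * vcat [1\<^sub>m (dim_d S), Wd\<^sup>T])"

definition consistent_set :: "plant_data \<Rightarrow> (real mat \<times> real mat \<times> real mat) set" where
  "consistent_set S = {(As, Bu, Bw).
     As \<in> carrier_mat (dim_y S) (ntil S) \<and>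
     Bu \<in> carrier_mat (dim_y S) (dim_u S) \<and>
     Bw \<in> carrier_mat (dim_y S) (dim_w S) \<and>
     (\<exists>Wd \<in> carrier_mat (dim_d S) (samples S). noise_bound S Wd \<and>
        Ydat S = As * Xd S + Bu * Udat S + Bw * Wdat S + Bd0 S * Wd)}"

definition well_formed :: "plant_data \<Rightarrow> bool" where
  "well_formed S \<longleftrightarrow>
     1 \<le> lag S \<and>
     (\<forall>i \<in> {1..lag S}. coeff_y S i \<in> carrier_mat (dim_y S) (dim_y S)) \<and>
     (\<forall>i \<in> {0..lag S}. coeff_u S i \<in> carrier_mat (dim_y S) (dim_u S)) \<and>
     (\<forall>i \<in> {0..lag S}. coeff_w S i \<in> carrier_mat (dim_y S) (dim_w S)) \<and>
     Bd0 S \<in> carrier_mat (dim_y S) (dim_d S) \<and>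
     vec_space.rank (dim_y S) (Bd0 S) = dim_d S \<and>
     Chat1 S \<in> carrier_mat (dim_z S) (dim_chi S) \<and>
     Emat S \<in> carrier_mat (dim_z S) (dim_u S) \<and>
     D1mat S \<in> carrier_mat (dim_z S) (dim_w S) \<and>
     Chat S \<in> carrier_mat (dim_yc S) (dim_chi S) \<and>
     (\<forall>i < dim_yc S. \<exists>j < (dim_y S + dim_u S) * lag S.
        row (Chat S) i = unit_vec (dim_chi S) j) \<and>
     signals S (rec_y S) (rec_u S) (rec_w S) (rec_d S) \<and>
     (\<forall>t \<in> {0..<int (samples S)}. plant_eq S (rec_y S) (rec_u S) (rec_w S) (rec_d S) t) \<and>
     compact_svd (dim_chi S) (samples S) (ntil S) (Xdat S)
       (svd_left S) (svd_vals S) (svd_right S) \<and>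
     Phi S \<in> sym_mats (dim_d S + samples S) \<and>
     neg_def (subblock (Phi S) (dim_d S) (dim_d S) (samples S) (samples S))"

text \<open>In the first conjunct the inputs are arbitrary but the trajectory starts from the recorded
  initial state $\chi(0)$: for arbitrary initial states the condition would just say that $X$ has
  full row rank.\<close>

definition standing_assumptions :: "plant_data \<Rightarrow> bool" where
  "standing_assumptions S \<longleftrightarrow>
     (\<forall>y u w d. signals S y u w d \<longrightarrow> (\<forall>t\<ge>0. plant_eq S y u w d t) \<longrightarrow>
        chi S y u w 0 = rec_chi S 0 \<longrightarrow>
        (\<forall>t\<ge>0. chi S y u w t \<in> vec_space.col_space (dim_chi S) (Xdat S))) \<and>
     (let R = map (row (Xdat S)) [0..<dim_y S] in
        distinct R \<and>
        module.lin_indpt class_ring (module_vec TYPE(real) (samples S)) (set R)) \<and>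
     noise_bound S (Wd_true S) \<and>
     consistent_set S \<noteq> {} \<and>
     vec_space.rank (ntil S + dim_u S + dim_w S) (vcat [Xd S, Udat S, Wdat S])
       = ntil S + dim_u S + dim_w S"

definition J_A :: "plant_data \<Rightarrow> real mat" where
  "J_A S = (let p = dim_y S; m = dim_u S; q = dim_w S; l = lag S in blocks
     [[hcat [1\<^sub>m (p*(l-1)), 0\<^sub>m (p*(l-1)) p], 0\<^sub>m (p*(l-1)) (m*l), 0\<^sub>m (p*(l-1)) (q*l)],
      [0\<^sub>m m (p*l), 0\<^sub>m m (m*l), 0\<^sub>m m (q*l)],
      [0\<^sub>m (m*(l-1)) (p*l), hcat [1\<^sub>m (m*(l-1)), 0\<^sub>m (m*(l-1)) m], 0\<^sub>m (m*(l-1)) (q*l)],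
      [0\<^sub>m q (p*l), 0\<^sub>m q (m*l), 0\<^sub>m q (q*l)],
      [0\<^sub>m (q*(l-1)) (p*l), 0\<^sub>m (q*(l-1)) (m*l), hcat [1\<^sub>m (q*(l-1)), 0\<^sub>m (q*(l-1)) q]]])"

definition J_B :: "plant_data \<Rightarrow> real mat" where
  "J_B S = (let p = dim_y S; m = dim_u S; q = dim_w S; l = lag S in
     vcat [0\<^sub>m (p*l - p) m, 1\<^sub>m m, 0\<^sub>m (m*l - m + q*l) m])"

definition J_B1 :: "plant_data \<Rightarrow> real mat" where
  "J_B1 S = (let p = dim_y S; m = dim_u S; q = dim_w S; l = lag S in
     vcat [0\<^sub>m (p*l - p + m*l) q, 1\<^sub>m q, 0\<^sub>m (q*l - q) q])"

text \<open>\<open>red_A\<close>, \<open>red_B\<close>, \<open>red_B1\<close>, \<open>red_C1\<close>, \<open>red_C\<close> are $A, B, B_1, C_1, C$: the system in the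
  coordinates of $\mathrm{im}(X)$ given by $X_s$.\<close>

definition red_A :: "plant_data \<Rightarrow> real mat \<Rightarrow> real mat" where
  "red_A S As = (svd_left S)\<^sup>T * vcat [As, J_A S * svd_left S]"

definition red_B :: "plant_data \<Rightarrow> real mat \<Rightarrow> real mat" where
  "red_B S Bu = (svd_left S)\<^sup>T * vcat [Bu, J_B S]"

definition red_B1 :: "plant_data \<Rightarrow> real mat \<Rightarrow> real mat" where
  "red_B1 S Bw = (svd_left S)\<^sup>T * vcat [Bw, J_B1 S]"

definition red_C1 :: "plant_data \<Rightarrow> real mat" where
  "red_C1 S = Chat1 S * svd_left S"

definition red_C :: "plant_data \<Rightarrow> real mat" where
  "red_C S = Chat S * svd_left S"

definition cl_A :: "plant_data \<Rightarrow> real mat \<Rightarrow> real mat \<Rightarrow> real mat \<Rightarrow> real mat \<Rightarrow> real mat \<Rightarrow> real mat \<Rightarrow> real mat"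
  where
  "cl_A S As Bu Ac Bc Cc Dc =
     blocks [[red_A S As + red_B S Bu * Dc * red_C S, red_B S Bu * Cc],
             [Bc * red_C S, Ac]]"

definition cl_B :: "plant_data \<Rightarrow> real mat \<Rightarrow> real mat" where
  "cl_B S Bw = vcat [red_B1 S Bw, 0\<^sub>m (ntil S) (dim_w S)]"

definition cl_C :: "plant_data \<Rightarrow> real mat \<Rightarrow> real mat \<Rightarrow> real mat" where
  "cl_C S Cc Dc = hcat [red_C1 S + Emat S * Dc * red_C S, Emat S * Cc]"

definition cl_D :: "plant_data \<Rightarrow> real mat" where
  "cl_D S = D1mat S"

definition H2_ineqs :: "plant_data \<Rightarrow> real \<Rightarrow> real mat \<Rightarrow> real mat \<Rightarrow> real mat
    \<Rightarrow> real mat \<Rightarrow> real mat \<Rightarrow> real mat \<Rightarrow> real mat \<Rightarrow> real mat \<Rightarrow> real mat \<Rightarrow> bool" where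
  "H2_ineqs S mu As Bu Bw Ac Bc Cc Dc P Z \<longleftrightarrow>
     (let At = cl_A S As Bu Ac Bc Cc Dc; Bt = cl_B S Bw; Ct = cl_C S Cc Dc; Dt = cl_D S in
        mtrace Z < mu\<^sup>2 \<and>
        pos_def (blocks [[1\<^sub>m (dim_w S), Bt\<^sup>T], [Bt, P - At * P * At\<^sup>T]]) \<and>
        pos_def (blocks [[Z - Dt * Dt\<^sup>T, Ct * P], [P * Ct\<^sup>T, P]]))"

definition robust_H2 :: "plant_data \<Rightarrow> real \<Rightarrow> real mat \<Rightarrow> real mat \<Rightarrow> real mat \<Rightarrow> real mat
    \<Rightarrow> real mat \<Rightarrow> real mat \<Rightarrow> bool" where
  "robust_H2 S mu Ac Bc Cc Dc P Z \<longleftrightarrow>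
     Ac \<in> carrier_mat (ntil S) (ntil S) \<and> Bc \<in> carrier_mat (ntil S) (dim_yc S) \<and>
     Cc \<in> carrier_mat (dim_u S) (ntil S) \<and> Dc \<in> carrier_mat (dim_u S) (dim_yc S) \<and>
     P \<in> sym_mats (2 * ntil S) \<and> Z \<in> sym_mats (dim_z S) \<and>
     (\<forall>(As, Bu, Bw) \<in> consistent_set S. H2_ineqs S mu As Bu Bw Ac Bc Cc Dc P Z)"

definition Hmat :: "plant_data \<Rightarrow> real mat" where
  "Hmat S = (let p = dim_y S; md = dim_d S;
       M = blocks [[Bd0 S, Ydat S],
                   [0\<^sub>m (ntil S) md, - Xd S],
                   [0\<^sub>m (dim_u S) md, - Udat S],
                   [0\<^sub>m (dim_w S) md, - Wdat S]]
     in M * Phi S * M\<^sup>T)"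

definition Hsizes :: "plant_data \<Rightarrow> nat list" where
  "Hsizes S = [dim_y S, ntil S, dim_u S, dim_w S]"

text \<open>The block indices of \<open>Hblk S i j\<close> run from 1 to 4, as in $H_{ij}$.\<close>

definition Hblk :: "plant_data \<Rightarrow> nat \<Rightarrow> nat \<Rightarrow> real mat" where
  "Hblk S i j = subblock (Hmat S)
     (sum_list (take (i - 1) (Hsizes S))) (sum_list (take (j - 1) (Hsizes S)))
     (Hsizes S ! (i - 1)) (Hsizes S ! (j - 1))"

definition check_T :: "plant_data \<Rightarrow> real mat" where
  "check_T S =
     - (minv (blocks [[Hblk S 2 2, Hblk S 2 3, Hblk S 2 4],
                      [(Hblk S 2 3)\<^sup>T, Hblk S 3 3, Hblk S 3 4],
                      [(Hblk S 2 4)\<^sup>T, (Hblk S 3 4)\<^sup>T, Hblk S 4 4]])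
        * vcat [(Hblk S 1 2)\<^sup>T, (Hblk S 1 3)\<^sup>T, (Hblk S 1 4)\<^sup>T])"

definition As_check :: "plant_data \<Rightarrow> real mat" where
  "As_check S = (subblock (check_T S) 0 0 (ntil S) (dim_y S))\<^sup>T"

definition Bu_check :: "plant_data \<Rightarrow> real mat" where
  "Bu_check S = (subblock (check_T S) (ntil S) 0 (dim_u S) (dim_y S))\<^sup>T"

definition Bw_check :: "plant_data \<Rightarrow> real mat" where
  "Bw_check S = (subblock (check_T S) (ntil S + dim_u S) 0 (dim_w S) (dim_y S))\<^sup>T"

definition Xi_Lambda_factorization :: "plant_data \<Rightarrow> nat \<Rightarrow> real mat \<Rightarrow> real mat \<Rightarrow> bool" where
  "Xi_Lambda_factorization S pt Xi Lam \<longleftrightarrow>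
     Xi \<in> carrier_mat (dim_y S) pt \<and> Lam \<in> carrier_mat pt pt \<and> pos_def Lam \<and>
     (let R = hcat [1\<^sub>m (dim_y S), As_check S, Bu_check S, Bw_check S]
      in R * Hmat S * R\<^sup>T = Xi * Lam * Xi\<^sup>T)"

definition Hbar_T :: "plant_data \<Rightarrow> real mat" where
  "Hbar_T S =
     blocks [[(Hblk S 1 2)\<^sup>T, Hblk S 2 2, Hblk S 2 3, Hblk S 2 4],
             [(Hblk S 1 3)\<^sup>T, (Hblk S 2 3)\<^sup>T, Hblk S 3 3, Hblk S 3 4],
             [(Hblk S 1 4)\<^sup>T, (Hblk S 2 4)\<^sup>T, (Hblk S 3 4)\<^sup>T, Hblk S 4 4]]
     * vcat [1\<^sub>m (dim_y S), (As_check S)\<^sup>T, (Bu_check S)\<^sup>T, (Bw_check S)\<^sup>T]"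

definition Hbar12_T :: "plant_data \<Rightarrow> real mat" where
  "Hbar12_T S = subblock (Hbar_T S) 0 0 (ntil S) (dim_y S)"

definition Hbar13_T :: "plant_data \<Rightarrow> real mat" where
  "Hbar13_T S = subblock (Hbar_T S) (ntil S) 0 (dim_u S) (dim_y S)"

definition Hbar14_T :: "plant_data \<Rightarrow> real mat" where
  "Hbar14_T S = subblock (Hbar_T S) (ntil S + dim_u S) 0 (dim_w S) (dim_y S)"

definition A_check :: "plant_data \<Rightarrow> real mat" where
  "A_check S = red_A S (As_check S)"

definition B_check :: "plant_data \<Rightarrow> real mat" where
  "B_check S = red_B S (Bu_check S)"

definition B1_check :: "plant_data \<Rightarrow> real mat" where
  "B1_check S = red_B1 S (Bw_check S)"

definition Xs1 :: "plant_data \<Rightarrow> real mat" where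
  "Xs1 S = subblock (svd_left S) 0 0 (dim_y S) (ntil S)"

definition kernel_basis_rows :: "plant_data \<Rightarrow> real mat \<Rightarrow> bool" where
  "kernel_basis_rows S L1 \<longleftrightarrow>
     L1 \<in> carrier_mat (ntil S - dim_y S) (ntil S) \<and>
     distinct (cols L1\<^sup>T) \<and>
     kernel.basis (ntil S) (Xs1 S) (set (cols L1\<^sup>T))"

definition Lmat :: "plant_data \<Rightarrow> real mat \<Rightarrow> real mat" where
  "Lmat S L1 = vcat [L1, minv (Xs1 S * (Xs1 S)\<^sup>T) * Xs1 S]"

definition Pi11 :: "plant_data \<Rightarrow> real mat \<Rightarrow> real mat \<Rightarrow> real mat" where
  "Pi11 S X Y = (let n = ntil S; q = dim_w S in blocks
     [[X, 1\<^sub>m n, 0\<^sub>m n q],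
      [1\<^sub>m n, Y, 0\<^sub>m n q],
      [0\<^sub>m q n, 0\<^sub>m q n, 1\<^sub>m q]])"

definition Pi12_T :: "plant_data \<Rightarrow> nat \<Rightarrow> real mat \<Rightarrow> real mat \<Rightarrow> real mat \<Rightarrow> real mat \<Rightarrow> real mat
    \<Rightarrow> real mat \<Rightarrow> real mat" where
  "Pi12_T S pt X Y Atc Btc Ctc Dc =
     (let n = ntil S; m = dim_u S; q = dim_w S;
          A = A_check S; B = B_check S; B1 = B1_check S; C = red_C S in blocks
     [[A + B * Dc * C, A * Y + B * Ctc, B1],
      [X * A + Btc * C, Atc, X * B1],
      [1\<^sub>m n, Y, 0\<^sub>m n q],
      [Dc * C, Ctc, 0\<^sub>m m q],
      [0\<^sub>m q n, 0\<^sub>m q n, 1\<^sub>m q],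
      [0\<^sub>m pt n, 0\<^sub>m pt n, 0\<^sub>m pt q]])"

text \<open>\<open>pad_L S L1 M\<close> is $\begin{pmatrix}0 & M\end{pmatrix}L^{-\top}$.\<close>

definition pad_L :: "plant_data \<Rightarrow> real mat \<Rightarrow> real mat \<Rightarrow> real mat" where
  "pad_L S L1 M = hcat [0\<^sub>m (dim_row M) (ntil S - dim_y S), M] * (minv (Lmat S L1))\<^sup>T"

definition Pi22 :: "plant_data \<Rightarrow> nat \<Rightarrow> real mat \<Rightarrow> real mat \<Rightarrow> real mat \<Rightarrow> real \<Rightarrow> real mat \<Rightarrow> real mat
    \<Rightarrow> real mat" where
  "Pi22 S pt Xi Lam L1 al X Y =
     (let n = ntil S; m = dim_u S; q = dim_w S;
          G2 = pad_L S L1 (- (al \<cdot>\<^sub>m Hbar12_T S));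
          G3 = pad_L S L1 (- (al \<cdot>\<^sub>m Hbar13_T S));
          G4 = pad_L S L1 (- (al \<cdot>\<^sub>m Hbar14_T S));
          G5 = pad_L S L1 (al \<cdot>\<^sub>m Xi\<^sup>T);
          h = (\<lambda>i j. - (al \<cdot>\<^sub>m Hblk S i j)) in blocks
     [[Y, 1\<^sub>m n, G2\<^sup>T, G3\<^sup>T, G4\<^sup>T, G5\<^sup>T],
      [1\<^sub>m n, X, (G2 * X)\<^sup>T, (G3 * X)\<^sup>T, (G4 * X)\<^sup>T, (G5 * X)\<^sup>T],
      [G2, G2 * X, h 2 2, h 2 3, h 2 4, 0\<^sub>m n pt],
      [G3, G3 * X, (h 2 3)\<^sup>T, h 3 3, h 3 4, 0\<^sub>m m pt],
      [G4, G4 * X, (h 2 4)\<^sup>T, (h 3 4)\<^sup>T, h 4 4, 0\<^sub>m q pt],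
      [G5, G5 * X, 0\<^sub>m pt n, 0\<^sub>m pt m, 0\<^sub>m pt q, al \<cdot>\<^sub>m minv Lam]])"

definition Pi_mat :: "plant_data \<Rightarrow> nat \<Rightarrow> real mat \<Rightarrow> real mat \<Rightarrow> real mat \<Rightarrow> real \<Rightarrow> real mat \<Rightarrow> real mat
    \<Rightarrow> real mat \<Rightarrow> real mat \<Rightarrow> real mat \<Rightarrow> real mat \<Rightarrow> real mat" where
  "Pi_mat S pt Xi Lam L1 al X Y Atc Btc Ctc Dc =
     blocks [[Pi11 S X Y, (Pi12_T S pt X Y Atc Btc Ctc Dc)\<^sup>T],
             [Pi12_T S pt X Y Atc Btc Ctc Dc, Pi22 S pt Xi Lam L1 al X Y]]"

definition Delta_mat :: "plant_data \<Rightarrow> real mat \<Rightarrow> real mat \<Rightarrow> real mat \<Rightarrow> real mat \<Rightarrow> real mat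
    \<Rightarrow> real mat" where
  "Delta_mat S Z X Y Ctc Dc =
     (let n = ntil S; q = dim_w S; D1 = D1mat S;
          F = red_C1 S + Emat S * Dc * red_C S;
          G = red_C1 S * Y + Emat S * Ctc in blocks
     [[1\<^sub>m q, D1\<^sup>T, 0\<^sub>m q n, 0\<^sub>m q n],
      [D1, Z, F, G],
      [0\<^sub>m n q, F\<^sup>T, X, 1\<^sub>m n],
      [0\<^sub>m n q, G\<^sup>T, 1\<^sub>m n, Y]])"

definition synthesis_ineqs :: "plant_data \<Rightarrow> real \<Rightarrow> nat \<Rightarrow> real mat \<Rightarrow> real mat \<Rightarrow> real mat
    \<Rightarrow> real \<Rightarrow> real mat \<Rightarrow> real mat \<Rightarrow> real mat \<Rightarrow> real mat \<Rightarrow> real mat \<Rightarrow> real mat \<Rightarrow> real mat \<Rightarrow> bool" where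
  "synthesis_ineqs S mu pt Xi Lam L1 al Z X Y Atc Btc Ctc Dc \<longleftrightarrow>
     Z \<in> sym_mats (dim_z S) \<and> X \<in> sym_mats (ntil S) \<and> Y \<in> sym_mats (ntil S) \<and>
     Atc \<in> carrier_mat (ntil S) (ntil S) \<and> Btc \<in> carrier_mat (ntil S) (dim_yc S) \<and>
     Ctc \<in> carrier_mat (dim_u S) (ntil S) \<and> Dc \<in> carrier_mat (dim_u S) (dim_yc S) \<and>
     mtrace Z < mu\<^sup>2 \<and>
     pos_def (Pi_mat S pt Xi Lam L1 al X Y Atc Btc Ctc Dc) \<and>
     pos_def (Delta_mat S Z X Y Ctc Dc)"

end

theory Submission
  imports Defs "HOL-Analysis.Function_Topology" "HOL-Library.Function_Algebras"
    "Jordan_Normal_Form.Char_Poly"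
begin

text \<open>
The theorem compares inequalities that hold for every plant consistent with the data with one linear matrix
inequality. The argument has three parts.

The consistent plants form an ellipsoid. Write $M = (\bar A_s\ B_{u0}\ B_{w0})$. Since $B_{d0}$ has full
column rank and $\Phi_{22} \prec 0$, eliminating the noise turns membership in $\Sigma$ into
$(I\ M) H (I\ M)^T \succeq 0$ (\<open>consistent_iff_qmi\<close>). The matrices $\check A_s, \check B_{u0}, \check B_{w0}$ are the centre
$\check M$ of this quadratic inequality; at the centre $\bar H = 0$, and with $\delta = M - \check M$ the inequality
becomes $\delta S \delta^T \preceq \Xi \Lambda \Xi^T$, where $S \succ 0$ is the negative of the lower right block of $H$ (\<open>qmi_eq\<close>). The
closed-loop matrices are affine in $\delta$, which enters through $X_{s1}^T$ (\<open>cl_uncertain\<close>); because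
$L X_{s1}^T = \mathrm{col}(0, I)$, this factor is what the expressions with $L^{-T}$ produce (\<open>pad_L_eq\<close>).

Robustness over an ellipsoid needs only one multiplier. For a fixed controller and a fixed $P$, a Schur complement
makes the first $H_2$ inequality the positivity of a form that depends on $\delta$ only through $w = \delta^T e$, where $e$ is
linear in the remaining variables. When $\delta$ runs over the ellipsoid, $w$ runs over all vectors with
$w^T S w \le e^T \Xi \Lambda \Xi^T e$ (\<open>admissible_perturbation\<close>). Robustness is thus an implication between two quadratic forms, and
the strict \<open>S_lemma\<close> replaces it by a single inequality with a multiplier $\alpha$
(\<open>robust_imp_lmi\<close>, \<open>lmi_imp_robust\<close>). The S-lemma rests on an elementary fact: two points whose bounds for the multiplier
contradict each other span a segment on which one form vanishes while the other is negative.

The multiplier inequality is linearized by a congruence. If $P$ and $P^{-1}$ have the first block rows $(Y\ V)$ and $(X\ U)$, then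
$P T_1 = T_2$ with $T_1 = \mathrm{col}((X\ I), (U^T\ 0))$ and $T_2 = \mathrm{col}((I\ Y), (0\ V^T))$, and transforming with $T_1$ gives
exactly $\Pi$ and $\Delta$ (\<open>pi_form_eq\<close>, \<open>delta_form_eq\<close>). From the synthesis inequalities one obtains
$P = T_2 T_1^{-1}$, as $\Delta \succ 0$ makes $I - XY$ and hence $U$ invertible (\<open>lyapunov_construction\<close>, \<open>reconstruction\<close>). In the other
direction $V$ must be invertible; a small multiple of the identity added to the off-diagonal block of $P$ achieves this
and keeps the finitely many strict inequalities in force (\<open>regular_shift\<close>, \<open>robust_imp_synthesis\<close>).

Positive definiteness is handled as positivity of quadratic forms in the block variables throughout, so Schur
complements are completions of squares and congruences are substitutions.
\<close>

section \<open>Matrices acting on sequences\<close>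

text \<open>The forms in this theory have up to nine block variables. A vector is therefore represented by a
sequence \<open>nat \<Rightarrow> real\<close> of which a matrix reads only as many entries as it has columns: addition of
vectors then needs no dimension bookkeeping, and passing to the next block is a shift of the index.\<close>

definition mv :: "real mat \<Rightarrow> (nat \<Rightarrow> real) \<Rightarrow> (nat \<Rightarrow> real)" where
  "mv A x = (\<lambda>i. if i < dim_row A then \<Sum>j<dim_col A. A $$ (i, j) * x j else 0)"

definition bf :: "real mat \<Rightarrow> (nat \<Rightarrow> real) \<Rightarrow> (nat \<Rightarrow> real) \<Rightarrow> real" where
  "bf A x y = (\<Sum>i<dim_row A. \<Sum>j<dim_col A. x i * A $$ (i, j) * y j)"

definition smul :: "real \<Rightarrow> (nat \<Rightarrow> real) \<Rightarrow> (nat \<Rightarrow> real)" where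
  "smul c x = (\<lambda>i. c * x i)"

definition nz :: "nat \<Rightarrow> (nat \<Rightarrow> real) \<Rightarrow> bool" where
  "nz n x \<longleftrightarrow> (\<exists>i<n. x i \<noteq> 0)"

definition sh :: "nat \<Rightarrow> (nat \<Rightarrow> real) \<Rightarrow> (nat \<Rightarrow> real)" where
  "sh k x = (\<lambda>i. x (k + i))"

definition cat :: "nat \<Rightarrow> (nat \<Rightarrow> real) \<Rightarrow> (nat \<Rightarrow> real) \<Rightarrow> (nat \<Rightarrow> real)" where
  "cat n x y = (\<lambda>i. if i < n then x i else y (i - n))"

lemma bf_eq_dot: "bf A x y = (\<Sum>i<dim_row A. x i * mv A y i)"
  by (simp add: bf_def mv_def sum_distrib_left mult.assoc)

lemma mv_add: "mv A (x + y) = mv A x + mv A y"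
  by (auto simp: mv_def fun_eq_iff algebra_simps sum.distrib)

lemma mv_minus: "mv A (- x) = - mv A x"
  by (auto simp: mv_def fun_eq_iff sum_negf)

lemma mv_zero [simp]: "mv A 0 = 0"
  by (auto simp: mv_def fun_eq_iff)

lemma bf_add_left: "bf A (x + y) z = bf A x z + bf A y z"
  by (simp add: bf_def algebra_simps sum.distrib)

lemma bf_add_right: "bf A z (x + y) = bf A z x + bf A z y"
  by (simp add: bf_def algebra_simps sum.distrib)

lemma bf_minus_left: "bf A (- x) y = - bf A x y"
  by (simp add: bf_def sum_negf)

lemma bf_minus_right: "bf A x (- y) = - bf A x y"
  by (simp add: bf_def sum_negf)

lemma bf_smul_left: "bf A (smul c x) y = c * bf A x y"
  by (simp add: bf_def smul_def sum_distrib_left mult.assoc)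

lemma bf_smul_right: "bf A x (smul c y) = c * bf A x y"
  by (auto simp: bf_def smul_def sum_distrib_left intro!: sum.cong)

lemma bf_zero [simp]: "bf A 0 y = 0" "bf A x 0 = 0"
  by (simp_all add: bf_def)

lemma bf_transpose: "bf A\<^sup>T x y = bf A y x"
proof -
  have "bf A\<^sup>T x y = (\<Sum>i<dim_col A. \<Sum>j<dim_row A. x i * A $$ (j, i) * y j)"
    by (simp add: bf_def)
  also have "\<dots> = bf A y x"
    unfolding bf_def by (subst sum.swap) (simp add: ac_simps)
  finally show ?thesis .
qed

lemma bf_cong: "(\<And>i. i < dim_row A \<Longrightarrow> x i = x' i) \<Longrightarrow> (\<And>i. i < dim_col A \<Longrightarrow> y i = y' i) \<Longrightarrow>
    bf A x y = bf A x' y'"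
  by (auto simp: bf_def intro!: sum.cong)

lemma mv_cong: "(\<And>i. i < dim_col A \<Longrightarrow> y i = y' i) \<Longrightarrow> mv A y = mv A y'"
  by (auto simp: mv_def fun_eq_iff intro!: sum.cong)

lemma mv_mult:
  assumes "dim_col A = dim_row B"
  shows "mv (A * B) x = mv A (mv B x)"
proof
  fix i
  show "mv (A * B) x i = mv A (mv B x) i"
  proof (cases "i < dim_row A")
    case True
    have "mv (A * B) x i = (\<Sum>j<dim_col B. \<Sum>k<dim_row B. A $$ (i, k) * B $$ (k, j) * x j)"
      using True assms
      by (auto simp: mv_def scalar_prod_def sum_distrib_right lessThan_atLeast0 intro!: sum.cong)
    also have "\<dots> = (\<Sum>k<dim_row B. \<Sum>j<dim_col B. A $$ (i, k) * B $$ (k, j) * x j)"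
      by (rule sum.swap)
    also have "\<dots> = mv A (mv B x) i"
      using True assms by (auto simp: mv_def sum_distrib_left mult.assoc intro!: sum.cong)
    finally show ?thesis .
  qed (simp add: mv_def)
qed

lemma bf_mult: "dim_col A = dim_row B \<Longrightarrow> bf (A * B) x y = bf A x (mv B y)"
  by (simp add: bf_eq_dot mv_mult)

lemma bf_plus: "dim_row A = dim_row B \<Longrightarrow> dim_col A = dim_col B \<Longrightarrow> bf (A + B) x y = bf A x y + bf B x y"
  by (simp add: bf_def algebra_simps sum.distrib)

lemma bf_diff: "dim_row A = dim_row B \<Longrightarrow> dim_col A = dim_col B \<Longrightarrow> bf (A - B) x y = bf A x y - bf B x y"
  by (simp add: bf_def algebra_simps sum_subtractf)

lemma mv_plus: "dim_row A = dim_row B \<Longrightarrow> dim_col A = dim_col B \<Longrightarrow> mv (A + B) x = mv A x + mv B x"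
  by (auto simp: mv_def fun_eq_iff algebra_simps sum.distrib)

lemma mv_diff: "dim_row A = dim_row B \<Longrightarrow> dim_col A = dim_col B \<Longrightarrow> mv (A - B) x = mv A x - mv B x"
  by (auto simp: mv_def fun_eq_iff algebra_simps sum_subtractf)

lemma bf_uminus: "bf (- A) x y = - bf A x y"
  by (simp add: bf_def sum_negf)

lemma mv_uminus: "mv (- A) x = - mv A x"
  by (auto simp: mv_def fun_eq_iff sum_negf)

lemma bf_smult: "bf (c \<cdot>\<^sub>m A) x y = c * bf A x y"
  by (auto simp: bf_def sum_distrib_left intro!: sum.cong)

lemma mv_smult: "mv (c \<cdot>\<^sub>m A) x = smul c (mv A x)"
  by (auto simp: mv_def smul_def fun_eq_iff sum_distrib_left intro!: sum.cong)

lemma bf_zero_mat [simp]: "bf (0\<^sub>m r c) x y = 0"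
  by (simp add: bf_def)

lemma mv_zero_mat [simp]: "mv (0\<^sub>m r c) x = 0"
  by (auto simp: mv_def fun_eq_iff)

lemma delta_mult:
  "(if b then 1 else 0) * c = (if b then c else (0 :: real))"
  "c * (if b then 1 else 0) = (if b then c else (0 :: real))"
  by simp_all

lemma mv_one: "i < n \<Longrightarrow> mv (1\<^sub>m n) x i = x i"
  by (simp add: mv_def delta_mult)

lemma bf_mv_left: "bf A (mv B x) y = bf B\<^sup>T x (mv A y)" if "dim_row A = dim_row B"
proof -
  have "bf A (mv B x) y = (\<Sum>i<dim_row B. mv A y i * mv B x i)"
    using that by (simp add: bf_eq_dot mult.commute)
  also have "\<dots> = bf B (mv A y) x"
    by (simp add: bf_eq_dot)
  finally show ?thesis by (simp add: bf_transpose)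
qed

lemma bf_one_mv: "dim_row B = n \<Longrightarrow> bf (1\<^sub>m n) x (mv B y) = bf B x y"
  by (simp add: bf_eq_dot mv_one)

lemma bf_one: "bf (1\<^sub>m n) x y = (\<Sum>i<n. x i * y i)"
  by (simp add: bf_eq_dot mv_one)

lemma bf_one_commute: "bf (1\<^sub>m n) x y = bf (1\<^sub>m n) y x"
  by (simp add: bf_one mult.commute)

lemma mv_mv_one [simp]: "dim_col A \<le> n \<Longrightarrow> mv A (mv (1\<^sub>m n) x) = mv A x"
  by (rule mv_cong) (simp add: mv_one)

lemma bf_mv_one [simp]: "dim_col A \<le> n \<Longrightarrow> bf A x (mv (1\<^sub>m n) y) = bf A x y"
  "dim_row A \<le> n \<Longrightarrow> bf A (mv (1\<^sub>m n) x) y = bf A x y"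
  by (auto intro!: bf_cong simp: mv_one)

lemma bf_one_nonneg: "0 \<le> bf (1\<^sub>m n) x x"
  by (simp add: bf_one sum_nonneg)

lemma bf_one_pos_iff: "0 < bf (1\<^sub>m n) x x \<longleftrightarrow> nz n x"
proof -
  have "bf (1\<^sub>m n) x x = 0 \<longleftrightarrow> \<not> nz n x"
    unfolding bf_one nz_def by (subst sum_nonneg_eq_0_iff) auto
  then show ?thesis using bf_one_nonneg[of n x] by linarith
qed

lemma not_nz_bf [simp]: "\<not> nz (dim_row A) x \<Longrightarrow> bf A x y = 0" "\<not> nz (dim_col A) y \<Longrightarrow> bf A x y = 0"
  by (auto simp: bf_def nz_def)

lemma not_nz_mv: "\<not> nz (dim_col A) x \<Longrightarrow> mv A x = 0"
  by (auto simp: mv_def nz_def fun_eq_iff)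

lemma mv_eqI: "dim_row A = dim_row B \<Longrightarrow> dim_col A = dim_col B \<Longrightarrow> (\<And>x. mv A x = mv B x) \<Longrightarrow> A = B"
proof (rule eq_matI)
  fix i j
  assume d: "dim_row A = dim_row B" "dim_col A = dim_col B" and *: "\<And>x. mv A x = mv B x"
    and ij: "i < dim_row B" "j < dim_col B"
  have "mv M (\<lambda>k. if k = j then 1 else 0) i = M $$ (i, j)" if "i < dim_row M" "j < dim_col M" for M
    using that by (simp add: mv_def delta_mult)
  from this[of A] this[of B] * d ij show "A $$ (i, j) = B $$ (i, j)" by simp
qed

lemma bf_eqI: "dim_row A = dim_row B \<Longrightarrow> dim_col A = dim_col B \<Longrightarrow> (\<And>x y. bf A x y = bf B x y) \<Longrightarrow> A = B"
proof (rule eq_matI)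
  fix i j
  assume d: "dim_row A = dim_row B" "dim_col A = dim_col B" and *: "\<And>x y. bf A x y = bf B x y"
    and ij: "i < dim_row B" "j < dim_col B"
  have "bf M (\<lambda>k. if k = i then 1 else 0) (\<lambda>k. if k = j then 1 else 0) = M $$ (i, j)"
    if "i < dim_row M" "j < dim_col M" for M
    using that by (simp add: bf_def delta_mult)
  from this[of A] this[of B] * d ij show "A $$ (i, j) = B $$ (i, j)" by simp
qed

lemma sym_iff_bf: "dim_row A = dim_col A \<Longrightarrow> A\<^sup>T = A \<longleftrightarrow> (\<forall>x y. bf A x y = bf A y x)"
proof
  assume "A\<^sup>T = A"
  then show "\<forall>x y. bf A x y = bf A y x" using bf_transpose[of A] by simp
next
  assume "dim_row A = dim_col A" "\<forall>x y. bf A x y = bf A y x"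
  then show "A\<^sup>T = A" by (intro bf_eqI) (auto simp: bf_transpose)
qed

lemma scalar_prod_bf:
  "A \<in> carrier_mat n m \<Longrightarrow> x \<in> carrier_vec n \<Longrightarrow> y \<in> carrier_vec m \<Longrightarrow>
    x \<bullet> (A *\<^sub>v y) = bf A (\<lambda>i. x $ i) (\<lambda>i. y $ i)"
  by (auto simp: bf_def scalar_prod_def lessThan_atLeast0 sum_distrib_left mult.assoc intro!: sum.cong)

lemma bf_vec:
  assumes "A \<in> carrier_mat n m"
  shows "bf A x y = vec n x \<bullet> (A *\<^sub>v vec m y)"
  using assms by (subst scalar_prod_bf) (auto intro!: bf_cong)

lemma nz_vec': "nz n x \<longleftrightarrow> vec n x \<noteq> 0\<^sub>v n"
  by (auto simp: nz_def vec_eq_iff)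

lemma pos_def_iff:
  assumes "A \<in> carrier_mat n n"
  shows "pos_def A \<longleftrightarrow> A\<^sup>T = A \<and> (\<forall>x. nz n x \<longrightarrow> 0 < bf A x x)"
proof -
  have "(\<forall>x\<in>carrier_vec n. x \<noteq> 0\<^sub>v n \<longrightarrow> 0 < x \<bullet> (A *\<^sub>v x)) \<longleftrightarrow> (\<forall>x. nz n x \<longrightarrow> 0 < bf A x x)"
    unfolding bf_vec[OF assms] nz_vec' by (metis vec_carrier vec_of_dim_0 dim_vec eq_vecI index_vec carrier_vecD)
  then show ?thesis using assms by (auto simp: pos_def_def sym_mats_def)
qed

lemma pos_semidef_iff:
  assumes "A \<in> carrier_mat n n"
  shows "pos_semidef A \<longleftrightarrow> A\<^sup>T = A \<and> (\<forall>x. 0 \<le> bf A x x)"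
proof -
  have "(\<forall>x\<in>carrier_vec n. 0 \<le> x \<bullet> (A *\<^sub>v x)) \<longleftrightarrow> (\<forall>x. 0 \<le> bf A x x)"
    unfolding bf_vec[OF assms] by (metis vec_carrier dim_vec eq_vecI index_vec carrier_vecD)
  then show ?thesis using assms by (auto simp: pos_semidef_def sym_mats_def)
qed

section \<open>Block matrices\<close>

lemma sh_cat [simp]: "sh n (cat n x y) = y"
  by (auto simp: sh_def cat_def fun_eq_iff)

lemma mv_cat [simp]: "dim_col A \<le> n \<Longrightarrow> mv A (cat n x y) = mv A x"
  by (rule mv_cong) (simp add: cat_def)

lemma bf_cat_left [simp]: "dim_row A \<le> n \<Longrightarrow> bf A (cat n x y) z = bf A x z"
  by (rule bf_cong) (simp_all add: cat_def)

lemma bf_cat_right [simp]: "dim_col A \<le> n \<Longrightarrow> bf A z (cat n x y) = bf A z x"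
  by (rule bf_cong) (simp_all add: cat_def)

lemma nz_cat [simp]: "nz n (cat n x y) = nz n x"
  by (auto simp: nz_def cat_def)

lemma nz_plus: "nz (m + n) x \<longleftrightarrow> nz m x \<or> nz n (sh m x)"
proof -
  have "i < m + n \<Longrightarrow> x i \<noteq> 0 \<Longrightarrow> \<not> i < m \<Longrightarrow> \<exists>j<n. x (m + j) \<noteq> 0" for i
    by (rule exI[of _ "i - m"]) auto
  moreover have "i < m \<Longrightarrow> i < m + n" "i < n \<Longrightarrow> m + i < m + n" for i by simp_all
  ultimately show ?thesis unfolding nz_def sh_def by blast
qed

lemma dim_row_hcat [simp]:
  "dim_row (hcat []) = 0" "dim_row (hcat (A # Ms)) = dim_row A"
  by (simp, cases Ms, auto)

lemma dim_col_hcat [simp]: "dim_col (hcat Ms) = sum_list (map dim_col Ms)"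
  by (induction Ms rule: hcat.induct) auto

lemma dim_col_vcat [simp]:
  "dim_col (vcat []) = 0" "dim_col (vcat (A # Ms)) = dim_col A"
  by (simp, cases Ms, auto simp: append_rows_def)

lemma dim_row_vcat [simp]: "dim_row (vcat Ms) = sum_list (map dim_row Ms)"
  by (induction Ms rule: vcat.induct) (auto simp: append_rows_def)

lemma sum_lessThan_add: "(\<Sum>i<m + n. f i) = (\<Sum>i<m. f i) + (\<Sum>i<n. f (m + i))" for f :: "nat \<Rightarrow> real"
  by (induction n) auto

lemma mv_hcat [simp]:
  "mv (hcat []) x = 0"
  "mv (hcat [A]) x = mv A x"
  "dim_row A = dim_row B \<Longrightarrow> mv (hcat (A # B # Ms)) x = mv A x + mv (hcat (B # Ms)) (sh (dim_col A) x)"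
  by (auto simp: mv_def sh_def fun_eq_iff sum_lessThan_add)

lemma bf_hcat [simp]:
  "bf (hcat []) x y = 0"
  "bf (hcat [A]) x y = bf A x y"
  "dim_row A = dim_row B \<Longrightarrow>
    bf (hcat (A # B # Ms)) x y = bf A x y + bf (hcat (B # Ms)) x (sh (dim_col A) y)"
proof -
  assume d: "dim_row A = dim_row B"
  show "bf (hcat (A # B # Ms)) x y = bf A x y + bf (hcat (B # Ms)) x (sh (dim_col A) y)"
    unfolding bf_eq_dot mv_hcat(3)[OF d] dim_row_hcat using d by (simp add: algebra_simps sum.distrib)
qed simp_all

lemma mv_vcat [simp]:
  "mv (vcat []) x = 0"
  "mv (vcat [A]) x = mv A x"
  "dim_col A = dim_col B \<Longrightarrow>
    mv (vcat (A # B # Ms)) x = cat (dim_row A) (mv A x) (mv (vcat (B # Ms)) x)"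
  by (auto simp: mv_def cat_def fun_eq_iff append_rows_def)

lemma bf_vcat [simp]:
  "bf (vcat []) x y = 0"
  "bf (vcat [A]) x y = bf A x y"
  "dim_col A = dim_col B \<Longrightarrow>
    bf (vcat (A # B # Ms)) x y = bf A x y + bf (vcat (B # Ms)) (sh (dim_row A) x) y"
proof -
  assume "dim_col A = dim_col B"
  then show "bf (vcat (A # B # Ms)) x y = bf A x y + bf (vcat (B # Ms)) (sh (dim_row A) x) y"
    unfolding bf_eq_dot mv_vcat(3)[OF \<open>dim_col A = dim_col B\<close>] dim_row_vcat list.map sum_list.Cons
      sum_lessThan_add by (simp add: sh_def cat_def)
qed simp_all

section \<open>The strict S-lemma\<close>

definition unit_sphere :: "nat \<Rightarrow> (nat \<Rightarrow> real) set" where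
  "unit_sphere N = {z. (\<forall>i\<ge>N. z i = 0) \<and> bf (1\<^sub>m N) z z = 1}"

lemma continuous_on_bf [continuous_intros]: "continuous_on A (\<lambda>z. bf Q z z)"
proof -
  have "continuous_on A (\<lambda>z :: nat \<Rightarrow> real. z i)" for i
    by (rule continuous_on_subset[OF continuous_on_product_coordinates]) simp
  then show ?thesis unfolding bf_def by (intro continuous_intros)
qed

text \<open>The sphere is a closed subset of a product of intervals, so compactness is Tychonoff's theorem in the
product topology of \<open>nat \<Rightarrow> real\<close>.\<close>

lemma compact_unit_sphere: "compact (unit_sphere N)"
proof -
  define K where "K = PiE (UNIV :: nat set) (\<lambda>i. if i < N then {-1..1 :: real} else {0})"
  have "compactin (product_topology (\<lambda>i. euclidean) UNIV) K"
    unfolding K_def by (subst compactin_PiE) auto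
  then have K: "compact K"
    by (simp add: euclidean_product_topology)
  have "closed {z. bf (1\<^sub>m N) z z = 1}"
    by (intro closed_Collect_eq continuous_on_bf continuous_on_const)
  moreover have "unit_sphere N = K \<inter> {z. bf (1\<^sub>m N) z z = 1}"
  proof -
    have "z i \<in> {-1..1}" if "(\<Sum>i<N. z i * z i) = 1" "i < N" for z :: "nat \<Rightarrow> real" and i
    proof -
      have "z i * z i \<le> (\<Sum>i<N. z i * z i)"
        by (rule member_le_sum) (use that in auto)
      then have "(z i)\<^sup>2 \<le> 1" using that by (simp add: power2_eq_square)
      then show ?thesis using abs_square_le_1[of "z i"] by (simp add: abs_le_iff minus_le_iff)
    qed
    then have "z i \<in> (if i < N then {-1..1} else {0})" if "z \<in> unit_sphere N" for z i
      using that unfolding unit_sphere_def bf_one by (cases "i < N") auto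
    then have "z \<in> K" if "z \<in> unit_sphere N" for z
      using that unfolding K_def by blast
    moreover have "z i = 0" if "z \<in> K" "N \<le> i" for z i
    proof -
      have "z i \<in> (if i < N then {-1..1} else {0})"
        using that(1) unfolding K_def by (rule PiE_mem) simp
      then show ?thesis using that(2) by simp
    qed
    ultimately show ?thesis unfolding unit_sphere_def by blast
  qed
  ultimately show ?thesis using K by (simp add: compact_Int_closed)
qed

lemma scale_to_unit_sphere:
  assumes "nz N z"
  obtains y r where "y \<in> unit_sphere N" "0 < r" "bf (1\<^sub>m N) z z = r"
    "\<And>Q. Q \<in> carrier_mat N N \<Longrightarrow> bf Q z z = r * bf Q y y"
proof -
  define r where "r = bf (1\<^sub>m N) z z"
  have r: "0 < r" using assms bf_one_pos_iff r_def by blast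
  define y where "y = (\<lambda>i. if i < N then z i / sqrt r else 0)"
  have Q: "bf Q z z = r * bf Q y y" if "Q \<in> carrier_mat N N" for Q
  proof -
    have "bf Q y y = bf Q (smul (1 / sqrt r) z) (smul (1 / sqrt r) z)"
      using that by (intro bf_cong) (auto simp: y_def smul_def)
    also have "\<dots> = (1 / sqrt r * (1 / sqrt r)) * bf Q z z"
      by (simp add: bf_smul_left bf_smul_right)
    also have "\<dots> = bf Q z z / r" using r by simp
    finally show ?thesis using r by simp
  qed
  from Q[of "1\<^sub>m N"] r have "bf (1\<^sub>m N) y y = 1" by (simp add: r_def)
  then have "y \<in> unit_sphere N" by (simp add: unit_sphere_def y_def)
  with r Q show ?thesis using that r_def by blast
qed

lemma bf_not_nz: "Q \<in> carrier_mat N N \<Longrightarrow> \<not> nz N z \<Longrightarrow> bf Q z z = 0"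
  by auto

lemma bf_bounded:
  assumes "Q \<in> carrier_mat N N"
  obtains c where "0 \<le> c" "\<And>z. \<bar>bf Q z z\<bar> \<le> c * bf (1\<^sub>m N) z z"
proof -
  have "\<exists>c. \<forall>y\<in>unit_sphere N. \<bar>bf Q y y\<bar> \<le> c"
  proof (cases "unit_sphere N = {}")
    case False
    have "continuous_on (unit_sphere N) (\<lambda>z. \<bar>bf Q z z\<bar>)"
      by (intro continuous_on_rabs continuous_on_bf)
    then show ?thesis
      using continuous_attains_sup[OF compact_unit_sphere False] by blast
  qed simp
  then obtain c where c: "\<And>y. y \<in> unit_sphere N \<Longrightarrow> \<bar>bf Q y y\<bar> \<le> c" by blast
  have "\<bar>bf Q z z\<bar> \<le> max 0 c * bf (1\<^sub>m N) z z" for z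
  proof (cases "nz N z")
    case True
    then obtain y r where yr: "y \<in> unit_sphere N" "0 < r" "bf (1\<^sub>m N) z z = r" "bf Q z z = r * bf Q y y"
      using scale_to_unit_sphere assms by metis
    have "r * \<bar>bf Q y y\<bar> \<le> r * max 0 c"
      using c[OF yr(1)] yr(2) by (intro mult_left_mono) auto
    then show ?thesis using yr by (simp add: abs_mult mult.commute)
  qed (use assms bf_not_nz in auto)
  then show ?thesis using that by (metis max.cobounded1)
qed

text \<open>Strict implications between quadratic forms leave room on both sides: on the unit sphere the larger of
$q_0$ and $-q_1$ is positive, hence bounded away from zero by compactness. This is the only place
where strictness has to be made quantitative; the S-lemma itself then only needs weak inequalities.\<close>

lemma uniform_gap:
  assumes Q: "Q0 \<in> carrier_mat N N" "Q1 \<in> carrier_mat N N"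
    and pos: "\<And>z. nz N z \<Longrightarrow> 0 \<le> bf Q1 z z \<Longrightarrow> 0 < bf Q0 z z"
  obtains e where "0 < e"
    "\<And>z. - e * bf (1\<^sub>m N) z z \<le> bf Q1 z z \<Longrightarrow> e * bf (1\<^sub>m N) z z \<le> bf Q0 z z"
proof (cases "unit_sphere N = {}")
  case True
  then have "\<not> nz N z" for z using scale_to_unit_sphere by blast
  then have "bf Q0 z z = 0" "bf (1\<^sub>m N) z z = 0" for z using Q bf_not_nz by auto
  then show ?thesis using that[of 1] by simp
next
  case False
  let ?h = "\<lambda>z. max (bf Q0 z z) (- bf Q1 z z)"
  have "continuous_on (unit_sphere N) ?h"
    by (intro continuous_on_max continuous_on_minus continuous_on_bf)
  then obtain y0 where y0: "y0 \<in> unit_sphere N" "\<And>y. y \<in> unit_sphere N \<Longrightarrow> ?h y0 \<le> ?h y"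
    using continuous_attains_inf[OF compact_unit_sphere False] by blast
  have "nz N y0" using y0(1) bf_one_pos_iff[of N y0] by (auto simp: unit_sphere_def)
  then have h: "0 < ?h y0" using pos[of y0] by linarith
  \<comment> \<open>Half the minimum, so that \<open>q\<^sub>1 \<ge> - e\<close> excludes that the maximum is attained by \<open>- q\<^sub>1\<close>.\<close>
  define e where "e = ?h y0 / 2"
  have e: "0 < e" using h by (simp add: e_def)
  show ?thesis
  proof (rule that[OF e])
    fix z assume *: "- e * bf (1\<^sub>m N) z z \<le> bf Q1 z z"
    show "e * bf (1\<^sub>m N) z z \<le> bf Q0 z z"
    proof (cases "nz N z")
      case True
      then obtain y r where yr: "y \<in> unit_sphere N" "0 < r" "bf (1\<^sub>m N) z z = r"
        "bf Q0 z z = r * bf Q0 y y" "bf Q1 z z = r * bf Q1 y y"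
        using scale_to_unit_sphere Q by metis
      from * yr have "r * (- e) \<le> r * bf Q1 y y" by (simp add: mult.commute)
      then have "- e \<le> bf Q1 y y" using yr(2) mult_le_cancel_left_pos by blast
      moreover have "2 * e \<le> ?h y" using y0(2)[OF yr(1)] by (simp add: e_def)
      ultimately have "e \<le> bf Q0 y y" using e by linarith
      then show ?thesis using yr by (simp add: mult.commute)
    qed (use Q bf_not_nz in auto)
  qed
qed

text \<open>Positive definiteness is an open condition.\<close>

lemma pos_form_perturb:
  assumes Q: "Q0 \<in> carrier_mat N N" "Q1 \<in> carrier_mat N N"
    and pos: "\<And>z. nz N z \<Longrightarrow> 0 < bf Q0 z z"
  obtains t where "0 < t" "\<And>s z. 0 \<le> s \<Longrightarrow> s \<le> t \<Longrightarrow> nz N z \<Longrightarrow> 0 < bf Q0 z z + s * bf Q1 z z"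
proof -
  obtain e where e: "0 < e"
    "\<And>z. - e * bf (1\<^sub>m N) z z \<le> bf (0\<^sub>m N N) z z \<Longrightarrow> e * bf (1\<^sub>m N) z z \<le> bf Q0 z z"
    using uniform_gap[OF Q(1) zero_carrier_mat pos] by blast
  obtain c where c: "0 \<le> c" "\<And>z. \<bar>bf Q1 z z\<bar> \<le> c * bf (1\<^sub>m N) z z"
    using bf_bounded[OF Q(2)] by blast
  define t where "t = e / (2 * (c + 1))"
  have t: "0 < t" using e c by (simp add: t_def)
  have "t * c < t * (2 * (c + 1))" using t c by (intro mult_strict_left_mono) auto
  also have "\<dots> = e" using c by (simp add: t_def)
  finally have tc: "t * c < e" .
  show ?thesis
  proof (rule that[OF t])
    fix s z assume s: "0 \<le> s" "s \<le> t" and z: "nz N z"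
    let ?d = "bf (1\<^sub>m N) z z"
    have d: "0 < ?d" using z bf_one_pos_iff by blast
    have "e * ?d \<le> bf Q0 z z" using e d by simp
    moreover have "s * \<bar>bf Q1 z z\<bar> \<le> t * (c * ?d)"
      using s c(2)[of z] t by (intro mult_mono) auto
    moreover have "t * (c * ?d) < e * ?d" using tc d by simp
    moreover have "- (s * \<bar>bf Q1 z z\<bar>) \<le> s * bf Q1 z z" using s(1)
      by (metis abs_ge_minus_self abs_mult abs_of_nonneg minus_le_iff)
    ultimately show "0 < bf Q0 z z + s * bf Q1 z z" by linarith
  qed
qed

text \<open>The geometric core of the S-lemma. Replacing $z_2$ by $-z_2$ changes neither $H$ nor $Q$ at $z_2$, so the cross
term of $H$ may be taken nonpositive; then $H$ is negative on the whole segment from $z_1$ to $z_2$, and $Q$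
changes sign along it.\<close>

lemma common_zero_on_segment:
  assumes H: "\<And>x y. bf H x y = bf H y x"
    and "bf H z1 z1 < 0" "bf H z2 z2 < 0" "0 < bf Q z1 z1" "bf Q z2 z2 < 0"
  obtains z where "bf Q z z = 0" "bf H z z < 0"
proof -
  define s where "s = (if bf H z1 z2 \<le> 0 then 1 else - 1 :: real)"
  define w where "w = smul s z2"
  have w: "bf A w w = bf A z2 z2" for A
    by (simp add: w_def bf_smul_left bf_smul_right s_def)
  have cross: "bf H z1 w \<le> 0" by (simp add: w_def bf_smul_right s_def)
  let ?z = "\<lambda>t. smul (1 - t) z1 + smul t w"
  have expand: "bf A (?z t) (?z t) =
      (1 - t)\<^sup>2 * bf A z1 z1 + t * (1 - t) * (bf A z1 w + bf A w z1) + t\<^sup>2 * bf A w w" for A t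
    by (simp add: bf_add_left bf_add_right bf_smul_left bf_smul_right power2_eq_square algebra_simps)
  have ends: "bf Q (?z 0) (?z 0) = bf Q z1 z1" "bf Q (?z 1) (?z 1) = bf Q z2 z2"
    unfolding expand w by simp_all
  have "\<exists>t\<ge>0. t \<le> 1 \<and> - bf Q (?z t) (?z t) = 0"
  proof (rule IVT')
    show "continuous_on {0..1} (\<lambda>t. - bf Q (?z t) (?z t))"
      unfolding expand by (intro continuous_intros)
  qed (unfold ends, use assms in simp_all)
  then obtain t where t: "0 \<le> t" "t \<le> 1" "bf Q (?z t) (?z t) = 0" by auto
  have "(1 - t)\<^sup>2 * bf H z1 z1 + t\<^sup>2 * bf H w w < 0"
  proof (cases "t = 0")
    case False
    have "t\<^sup>2 * bf H w w < 0" using False assms w by (simp add: mult_pos_neg)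
    moreover have "(1 - t)\<^sup>2 * bf H z1 z1 \<le> 0" using assms by (simp add: mult_nonneg_nonpos)
    ultimately show ?thesis by linarith
  qed (use assms in simp)
  moreover have "t * (1 - t) * (bf H z1 w + bf H w z1) \<le> 0"
    using t cross H[of w z1] by (intro mult_nonneg_nonpos) auto
  ultimately have "bf H (?z t) (?z t) < 0" unfolding expand by linarith
  with t show ?thesis using that by blast
qed

text \<open>The multiplier must satisfy $q_0(z_2)/q_1(z_2) \le \alpha \le q_0(z_1)/q_1(z_1)$ whenever $q_1(z_2) < 0 < q_1(z_1)$.
If two such bounds were in the wrong order, a number strictly between them would give a form $q_0 - a q_1$ that is negative at
both points, and \<open>common_zero_on_segment\<close> would produce a point where $q_1 = 0$ but $q_0 < 0$. Hence the
supremum of the lower bounds works. The forms are first shifted by \<open>uniform_gap\<close>, which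
gives back a strict inequality at the end, and a small increase makes the multiplier positive.\<close>

lemma S_lemma:
  assumes Q: "Q0 \<in> carrier_mat N N" "Q1 \<in> carrier_mat N N"
    and sym: "\<And>x y. bf Q0 x y = bf Q0 y x" "\<And>x y. bf Q1 x y = bf Q1 y x"
    and pos: "\<And>z. nz N z \<Longrightarrow> 0 \<le> bf Q1 z z \<Longrightarrow> 0 < bf Q0 z z"
  obtains al where "0 < al" "\<And>z. nz N z \<Longrightarrow> 0 < bf Q0 z z - al * bf Q1 z z"
proof -
  obtain e where e: "0 < e"
    "\<And>z. - e * bf (1\<^sub>m N) z z \<le> bf Q1 z z \<Longrightarrow> e * bf (1\<^sub>m N) z z \<le> bf Q0 z z"
    using uniform_gap[OF Q pos] by metis
  define q0 where "q0 = (\<lambda>z. bf Q0 z z - e * bf (1\<^sub>m N) z z)"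
  define q1 where "q1 = (\<lambda>z. bf Q1 z z + e * bf (1\<^sub>m N) z z)"
  have q: "0 \<le> q1 z \<Longrightarrow> 0 \<le> q0 z" for z
    using e(2)[of z] by (simp add: q0_def q1_def)
  have separated: "q0 z2 / q1 z2 \<le> q0 z1 / q1 z1" if z: "0 < q1 z1" "q1 z2 < 0" for z1 z2
  proof (rule ccontr)
    assume "\<not> ?thesis"
    then obtain a where a: "q0 z1 / q1 z1 < a" "a < q0 z2 / q1 z2"
      using dense not_le by metis
    define H where "H = Q0 - e \<cdot>\<^sub>m 1\<^sub>m N - a \<cdot>\<^sub>m (Q1 + e \<cdot>\<^sub>m 1\<^sub>m N)"
    have bfH: "bf H x y = bf Q0 x y - e * bf (1\<^sub>m N) x y - a * (bf Q1 x y + e * bf (1\<^sub>m N) x y)" for x y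
      using Q by (simp add: H_def bf_plus bf_diff bf_smult)
    then have H: "bf H x x = q0 x - a * q1 x" for x
      by (simp add: q0_def q1_def)
    have bfG: "bf (Q1 + e \<cdot>\<^sub>m 1\<^sub>m N) x x = q1 x" for x
      using Q by (simp add: q1_def bf_plus bf_smult)
    have "bf H z1 z1 < 0" "bf H z2 z2 < 0"
      using a z by (simp_all add: H divide_simps mult.commute)
    then obtain z where "q1 z = 0" "bf H z z < 0"
      using common_zero_on_segment[of H z1 z2 "Q1 + e \<cdot>\<^sub>m 1\<^sub>m N"] z bfG sym bf_one_commute bfH
      by (metis (no_types, lifting))
    then show False using q[of z] by (simp add: H)
  qed
  have main: "\<exists>a\<ge>0. \<forall>z. nz N z \<longrightarrow> 0 < bf Q0 z z - a * bf Q1 z z"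
  proof (cases "\<exists>z. 0 < q1 z")
    case True
    then obtain z1 where z1: "0 < q1 z1" by blast
    \<comment> \<open>Zero is included so that the set is nonempty and its supremum is nonnegative.\<close>
    define R where "R = insert 0 {q0 z / q1 z |z. q1 z < 0}"
    define a where "a = Sup R"
    have bdd: "bdd_above R"
      using separated[OF z1] q[of z1] z1
      unfolding bdd_above_def R_def by (intro exI[of _ "q0 z1 / q1 z1"]) auto
    have a0: "0 \<le> a" unfolding a_def by (rule cSup_upper[OF _ bdd]) (simp add: R_def)
    have "0 \<le> q0 z - a * q1 z" for z
    proof (cases "q1 z" "0 :: real" rule: linorder_cases)
      case less
      then have "q0 z / q1 z \<le> a" unfolding a_def by (intro cSup_upper bdd) (auto simp: R_def)
      then show ?thesis using less by (simp add: divide_simps)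
    next
      case equal
      then show ?thesis using q by simp
    next
      case greater
      then have "a \<le> q0 z / q1 z" unfolding a_def
        using separated q[of z] by (intro cSup_least) (auto simp: R_def)
      then show ?thesis using greater by (simp add: divide_simps mult.commute)
    qed
    moreover have "bf Q0 z z - a * bf Q1 z z = (q0 z - a * q1 z) + (1 + a) * (e * bf (1\<^sub>m N) z z)" for z
      by (simp add: q0_def q1_def algebra_simps)
    moreover have "0 < (1 + a) * (e * bf (1\<^sub>m N) z z)" if "nz N z" for z
      using that a0 e(1) bf_one_pos_iff[of N z] by simp
    ultimately have "0 < bf Q0 z z - a * bf Q1 z z" if "nz N z" for z
      using that by (metis add_nonneg_pos)
    with a0 show ?thesis by blast
  next
    case False
    obtain c where c: "0 \<le> c" "\<And>z. \<bar>bf Q0 z z\<bar> \<le> c * bf (1\<^sub>m N) z z"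
      using bf_bounded[OF Q(1)] by blast
    \<comment> \<open>Here \<open>q\<^sub>1\<close> is uniformly negative, and a large multiplier outweighs \<open>q\<^sub>0\<close>.\<close>
    define a where "a = (c + 1) / e"
    have a: "0 \<le> a" "a * e = c + 1" using c e by (auto simp: a_def)
    have "0 < bf Q0 z z - a * bf Q1 z z" if "nz N z" for z
    proof -
      have "q1 z \<le> 0" using False not_less by blast
      then have "bf Q1 z z \<le> - (e * bf (1\<^sub>m N) z z)" by (simp add: q1_def)
      from mult_left_mono[OF this a(1)]
      have "a * bf Q1 z z \<le> - ((c + 1) * bf (1\<^sub>m N) z z)"
        using a(2) by (simp add: mult.assoc[symmetric])
      then show ?thesis using c(2)[of z] bf_one_pos_iff[of N z] that
        by (simp add: algebra_simps abs_le_iff)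
    qed
    with a show ?thesis by blast
  qed
  then obtain a where a: "0 \<le> a" "\<And>z. nz N z \<Longrightarrow> 0 < bf Q0 z z - a * bf Q1 z z" by blast
  have eq: "bf (Q0 - a \<cdot>\<^sub>m Q1) z z = bf Q0 z z - a * bf Q1 z z" for z
    using Q by (simp add: bf_diff bf_smult)
  have carrier: "Q0 - a \<cdot>\<^sub>m Q1 \<in> carrier_mat N N" "- Q1 \<in> carrier_mat N N" using Q by auto
  obtain t where t: "0 < t" "\<And>s z. 0 \<le> s \<Longrightarrow> s \<le> t \<Longrightarrow> nz N z \<Longrightarrow>
      0 < bf (Q0 - a \<cdot>\<^sub>m Q1) z z + s * bf (- Q1) z z"
    using pos_form_perturb[OF carrier] a(2) unfolding eq by blast
  show ?thesis
  proof (rule that[of "a + t"])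
    show "0 < bf Q0 z z - (a + t) * bf Q1 z z" if "nz N z" for z
      using t(2)[of t z] t(1) that by (simp add: eq bf_uminus algebra_simps)
  qed (use a t in simp)
qed

section \<open>Affine uncertainty in an ellipsoid\<close>

text \<open>Block matrices are from here on evaluated through \<open>mv_hcat\<close>, \<open>bf_hcat\<close> and their row versions; the recursion
equations would unfold them to \<open>four_block_mat\<close> before these apply.\<close>

declare hcat.simps [simp del] vcat.simps [simp del]

lemma bf_mv_transpose_left: "dim_row A = dim_col F \<Longrightarrow> bf A (mv F\<^sup>T c) y = bf F c (mv A y)"
  by (simp add: bf_mv_left)

lemma bf_sym: "P\<^sup>T = P \<Longrightarrow> bf P x y = bf P y x"
  using bf_transpose[of P] by metis

lemma bf_congruence:
  "dim_col A = dim_row P \<Longrightarrow> dim_row P = dim_col P \<Longrightarrow>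
    bf (A * P * A\<^sup>T) x y = bf P (mv A\<^sup>T x) (mv A\<^sup>T y)"
  by (simp add: bf_mult bf_mv_transpose_left)

lemma bf_chain:
  "dim_col F = dim_row D \<Longrightarrow> dim_col D = dim_row G \<Longrightarrow>
    bf (F * D * G) c y = bf G (mv D\<^sup>T (mv F\<^sup>T c)) y"
  by (simp add: bf_mult bf_mv_transpose_left)

lemma psd_Cauchy_Schwarz:
  assumes "R\<^sup>T = R" "\<And>x. 0 \<le> bf R x x" "0 < bf R e e"
  shows "(bf R x e)\<^sup>2 / bf R e e \<le> bf R x x"
proof -
  let ?r = "bf R e e" and ?s = "bf R x e"
  have "bf R (smul ?r x + smul (- ?s) e) (smul ?r x + smul (- ?s) e) = ?r * (?r * bf R x x - ?s\<^sup>2)"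
    using bf_sym[OF assms(1), of e x]
    by (simp add: bf_add_left bf_add_right bf_smul_left bf_smul_right power2_eq_square algebra_simps)
  then have "0 \<le> ?r * (?r * bf R x x - ?s\<^sup>2)" using assms(2) by metis
  then show ?thesis using assms(3) by (simp add: zero_le_mult_iff divide_simps mult.commute)
qed

text \<open>When $D$ runs over the ellipsoid $D S D^T \preceq R$, the vector $D^T e$ reaches every $w$ with
$w^T S w \le e^T R e$. The witness $D = R e w^T / (e^T R e)$ has rank one, and the Cauchy-Schwarz inequality for $R$
puts it into the ellipsoid.\<close>

lemma admissible_perturbation:
  assumes R: "R \<in> carrier_mat p p" "R\<^sup>T = R" "\<And>x. 0 \<le> bf R x x"
    and S: "Sg \<in> carrier_mat k k" "\<And>w. nz k w \<Longrightarrow> 0 < bf Sg w w"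
    and le: "bf Sg w w \<le> bf R e e"
  obtains D where "D \<in> carrier_mat p k" "\<And>x. bf (D * Sg * D\<^sup>T) x x \<le> bf R x x"
    "\<And>i. i < k \<Longrightarrow> mv D\<^sup>T e i = w i"
proof (cases "nz k w")
  case False
  then show ?thesis using that[of "0\<^sub>m p k"] R(3) S(1)
    by (auto simp: bf_congruence mv_def nz_def)
next
  case True
  define r where "r = bf R e e"
  have r: "0 < r" using S(2)[OF True] le by (simp add: r_def)
  define D where "D = mat p k (\<lambda>(i, j). mv R e i * w j / r)"
  have mvD: "mv D\<^sup>T y i = bf R y e / r * w i" if "i < k" for y i
  proof -
    have "mv D\<^sup>T y i = (\<Sum>j<p. y j * mv R e j * (w i / r))"
      using that by (auto simp: mv_def D_def intro!: sum.cong)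
    also have "\<dots> = bf R y e * (w i / r)"
      using R(1) by (simp add: bf_eq_dot sum_distrib_right sum_divide_distrib)
    finally show ?thesis by simp
  qed
  have D: "D \<in> carrier_mat p k" by (simp add: D_def)
  show ?thesis
  proof (rule that[OF D])
    show "mv D\<^sup>T e i = w i" if "i < k" for i
      using mvD[OF that] r by (simp add: r_def)
    fix x
    have "bf (D * Sg * D\<^sup>T) x x = bf Sg (mv D\<^sup>T x) (mv D\<^sup>T x)"
      using D S(1) by (intro bf_congruence) auto
    also have "\<dots> = bf Sg (smul (bf R x e / r) w) (smul (bf R x e / r) w)"
      using S(1) mvD by (intro bf_cong) (auto simp: smul_def)
    also have "\<dots> = (bf R x e / r)\<^sup>2 * bf Sg w w"
      by (simp add: bf_smul_left bf_smul_right power2_eq_square)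
    also have "\<dots> \<le> (bf R x e / r)\<^sup>2 * r"
      using le by (intro mult_left_mono) (auto simp: r_def)
    also have "\<dots> = (bf R x e)\<^sup>2 / r" using r by (simp add: power2_eq_square)
    also have "\<dots> \<le> bf R x x"
      using psd_Cauchy_Schwarz[OF R(2,3)] r unfolding r_def by blast
    finally show "bf (D * Sg * D\<^sup>T) x x \<le> bf R x x" .
  qed
qed

text \<open>State matrix $A_0 + F D G_1$ and input matrix $B_0 + F D G_2$ with an uncertain $D$ in the ellipsoid
$D S D^T \preceq R$.\<close>

locale uncertain_system =
  fixes nx q p k :: nat and A0 B0 F G1 G2 R Sg :: "real mat"
  assumes carriers [simp]: "A0 \<in> carrier_mat nx nx" "B0 \<in> carrier_mat nx q" "F \<in> carrier_mat nx p"
      "G1 \<in> carrier_mat k nx" "G2 \<in> carrier_mat k q" "R \<in> carrier_mat p p" "Sg \<in> carrier_mat k k"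
    and R_sym: "R\<^sup>T = R" and R_psd: "\<And>x. 0 \<le> bf R x x"
    and Sg_sym: "Sg\<^sup>T = Sg" and Sg_pd: "\<And>w. nz k w \<Longrightarrow> 0 < bf Sg w w"
begin

lemma dims [simp]:
  "dim_row A0 = nx" "dim_col A0 = nx" "dim_row B0 = nx" "dim_col B0 = q" "dim_row F = nx" "dim_col F = p"
  "dim_row G1 = k" "dim_col G1 = nx" "dim_row G2 = k" "dim_col G2 = q" "dim_row R = p" "dim_col R = p"
  "dim_row Sg = k" "dim_col Sg = k"
  using carriers by blast+

definition admissible :: "real mat \<Rightarrow> bool" where
  "admissible D \<longleftrightarrow> D \<in> carrier_mat p k \<and> (\<forall>x. bf (D * Sg * D\<^sup>T) x x \<le> bf R x x)"

text \<open>The quadratic form of the symmetric matrix with blocks $I$, $B$ and $P - A P A^T$ that bounds the closed-loop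
controllability Gramian.\<close>

definition gram_form where
  "gram_form A B P b c = bf (1\<^sub>m q) b b + 2 * bf B c b + bf P c c - bf P (mv A\<^sup>T c) (mv A\<^sup>T c)"

definition robust :: "real mat \<Rightarrow> bool" where
  "robust P \<longleftrightarrow> (\<forall>D. admissible D \<longrightarrow>
     (\<forall>b c. nz q b \<or> nz nx c \<longrightarrow> 0 < gram_form (A0 + F * D * G1) (B0 + F * D * G2) P b c))"

text \<open>The value $w = D^T F^T c$ makes this the Schur lift of the Gramian form of the uncertain system; letting $w$ vary
freely separates the uncertainty from the nominal data.\<close>

definition nominal_form where
  "nominal_form P a b c w = bf P a a + bf (1\<^sub>m q) b b + bf P c c + 2 * bf A0 c (mv P a) + 2 * bf B0 c b
     + 2 * bf G1 w (mv P a) + 2 * bf G2 w b"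

definition lmi_form where
  "lmi_form al P a b c w = nominal_form P a b c w - al * (bf R (mv F\<^sup>T c) (mv F\<^sup>T c) - bf Sg w w)"

definition lmi :: "real \<Rightarrow> real mat \<Rightarrow> bool" where
  "lmi al P \<longleftrightarrow> (\<forall>a b c w. nz nx a \<or> nz q b \<or> nz nx c \<or> nz k w \<longrightarrow> 0 < lmi_form al P a b c w)"

text \<open>Completion of the square in \<open>a\<close>: the Schur complement with respect to the block $P$, without forming
$P^{-1}$.\<close>

lemma nominal_form_uncertain:
  assumes P: "P \<in> carrier_mat nx nx" "P\<^sup>T = P" and D: "D \<in> carrier_mat p k"
  shows "nominal_form P a b c (mv D\<^sup>T (mv F\<^sup>T c)) =
    bf P (a + mv (A0 + F * D * G1)\<^sup>T c) (a + mv (A0 + F * D * G1)\<^sup>T c)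
      + gram_form (A0 + F * D * G1) (B0 + F * D * G2) P b c"
proof -
  let ?A = "A0 + F * D * G1"
  let ?w = "mv D\<^sup>T (mv F\<^sup>T c)"
  note [simp] = carrier_matD[OF P(1)] carrier_matD[OF D]
  have "bf ?A c y = bf A0 c y + bf G1 ?w y" for y
    by (simp add: bf_plus bf_chain)
  moreover have "bf P (mv ?A\<^sup>T c) a = bf ?A c (mv P a)"
    by (simp add: bf_mv_transpose_left)
  moreover have "bf (B0 + F * D * G2) c b = bf B0 c b + bf G2 ?w b"
    by (simp add: bf_plus bf_chain)
  ultimately show ?thesis
    using bf_sym[OF P(2), of a "mv ?A\<^sup>T c"]
    by (simp add: nominal_form_def gram_form_def bf_add_left bf_add_right)
qed

definition Q0 :: "real mat \<Rightarrow> real mat" where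
  "Q0 P = blocks [[P, 0\<^sub>m nx q, (A0 * P)\<^sup>T, (G1 * P)\<^sup>T],
                  [0\<^sub>m q nx, 1\<^sub>m q, B0\<^sup>T, G2\<^sup>T],
                  [A0 * P, B0, P, 0\<^sub>m nx k],
                  [G1 * P, G2, 0\<^sub>m k nx, 0\<^sub>m k k]]"

definition Q1 :: "real mat" where
  "Q1 = blocks [[0\<^sub>m nx nx, 0\<^sub>m nx q, 0\<^sub>m nx nx, 0\<^sub>m nx k],
                [0\<^sub>m q nx, 0\<^sub>m q q, 0\<^sub>m q nx, 0\<^sub>m q k],
                [0\<^sub>m nx nx, 0\<^sub>m nx q, F * R * F\<^sup>T, 0\<^sub>m nx k],
                [0\<^sub>m k nx, 0\<^sub>m k q, 0\<^sub>m k nx, - Sg]]"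

abbreviation "Ndim \<equiv> nx + (q + (nx + k))"

lemma Q_carrier: "P \<in> carrier_mat nx nx \<Longrightarrow> Q0 P \<in> carrier_mat Ndim Ndim" "Q1 \<in> carrier_mat Ndim Ndim"
  by (intro carrier_matI; simp add: Q0_def Q1_def blocks_def)+

lemma bf_Q1: "bf Q1 x y =
   (let c = sh q (sh nx x); c' = sh q (sh nx y) in
     bf R (mv F\<^sup>T c) (mv F\<^sup>T c') - bf Sg (sh nx c) (sh nx c'))"
  by (simp add: Q1_def blocks_def Let_def bf_congruence bf_uminus)

lemma bf_Q0:
  assumes P: "P \<in> carrier_mat nx nx"
  shows "bf (Q0 P) a a' = (let b = sh nx a; c = sh q b; w = sh nx c; b' = sh nx a'; c' = sh q b'; w' = sh nx c' in
     bf P a a' + bf (1\<^sub>m q) b b' + bf P c c'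
     + bf A0 c (mv P a') + bf A0 c' (mv P a) + bf B0 c b' + bf B0 c' b
     + bf G1 w (mv P a') + bf G1 w' (mv P a) + bf G2 w b' + bf G2 w' b)"
  using carrier_matD[OF P]
  by (simp add: Q0_def blocks_def Let_def bf_mult bf_transpose algebra_simps)

lemma bf_Q:
  assumes P: "P \<in> carrier_mat nx nx"
  shows "bf (Q0 P) z z = nominal_form P z (sh nx z) (sh q (sh nx z)) (sh nx (sh q (sh nx z)))"
  by (simp add: bf_Q0[OF P] nominal_form_def Let_def)

lemma nz_Ndim: "nz Ndim z \<longleftrightarrow> nz nx z \<or> nz q (sh nx z) \<or> nz nx (sh q (sh nx z)) \<or> nz k (sh nx (sh q (sh nx z)))"
  by (simp add: nz_plus)

text \<open>A robust inequality over an ellipsoid has a single multiplier. By \<open>admissible_perturbation\<close> and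
\<open>nominal_form_uncertain\<close>, robustness says that the nominal form is positive wherever
$(F^T c)^T R (F^T c) - w^T S w$ is nonnegative, and the S-lemma applies.\<close>

lemma robust_imp_lmi:
  assumes P: "P \<in> carrier_mat nx nx" "P\<^sup>T = P" and P_pd: "\<And>a. nz nx a \<Longrightarrow> 0 < bf P a a"
    and rob: "robust P"
  obtains al where "0 < al" "lmi al P"
proof -
  have pos: "0 < bf (Q0 P) z z" if z: "nz Ndim z" and Q: "0 \<le> bf Q1 z z" for z
  proof -
    define a b c w where abcw: "a = z" "b = sh nx a" "c = sh q b" "w = sh nx c"
    have "bf Sg w w \<le> bf R (mv F\<^sup>T c) (mv F\<^sup>T c)"
      using Q by (simp add: bf_Q1 Let_def abcw)
    then obtain D where D: "D \<in> carrier_mat p k" "\<And>x. bf (D * Sg * D\<^sup>T) x x \<le> bf R x x"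
        "\<And>i. i < k \<Longrightarrow> mv D\<^sup>T (mv F\<^sup>T c) i = w i"
      using admissible_perturbation[OF carriers(6) R_sym R_psd carriers(7) Sg_pd] by blast
    let ?A = "A0 + F * D * G1" and ?B = "B0 + F * D * G2"
    have "bf G w y = bf G (mv D\<^sup>T (mv F\<^sup>T c)) y" if "dim_row G = k" for G y
      by (rule bf_cong) (simp_all add: that D(3))
    then have "nominal_form P a b c w = nominal_form P a b c (mv D\<^sup>T (mv F\<^sup>T c))"
      by (simp add: nominal_form_def)
    also have "\<dots> = bf P (a + mv ?A\<^sup>T c) (a + mv ?A\<^sup>T c) + gram_form ?A ?B P b c"
      by (rule nominal_form_uncertain[OF P D(1)])
    finally have eq: "bf (Q0 P) z z = \<dots>" by (simp add: bf_Q P abcw)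
    have gram: "0 < gram_form ?A ?B P b c" if "nz q b \<or> nz nx c"
      using rob D that unfolding robust_def admissible_def by blast
    have P_psd: "0 \<le> bf P y y" for y
      using P_pd[of y] not_nz_bf(1)[of P y y] carrier_matD[OF P(1)] by (cases "nz nx y") auto
    show ?thesis
    proof (cases "nz q b \<or> nz nx c")
      case True
      then show ?thesis using gram P_psd[of "a + mv ?A\<^sup>T c"] eq by linarith
    next
      case False
      then have e: "mv F\<^sup>T c = 0" by (intro not_nz_mv) simp
      have "\<not> nz k w"
        using Sg_pd[of w] D(3) e by (auto simp: nz_def)
      with z False have a: "nz nx a" by (simp add: nz_Ndim abcw)
      have "mv ?A\<^sup>T c = 0" using False by (intro not_nz_mv) (simp add: carrier_matD[OF D(1)])
      moreover from this have "gram_form ?A ?B P b c = 0"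
        using False carrier_matD[OF P(1)] carrier_matD[OF D(1)] by (simp add: gram_form_def)
      ultimately show ?thesis using P_pd[OF a] eq by simp
    qed
  qed
  have sym: "bf (Q0 P) x y = bf (Q0 P) y x" "bf Q1 x y = bf Q1 y x" for x y
    by (simp_all add: bf_Q0[OF P(1)] bf_Q1 Let_def bf_sym[OF R_sym] bf_sym[OF Sg_sym] bf_sym[OF P(2)] bf_one_commute)
  obtain al where al: "0 < al" "\<And>z. nz Ndim z \<Longrightarrow> 0 < bf (Q0 P) z z - al * bf Q1 z z"
    using S_lemma[OF Q_carrier(1)[OF P(1)] Q_carrier(2) sym pos] by blast
  have "lmi al P" unfolding lmi_def
  proof (intro allI impI)
    fix a b c w assume nz: "nz nx a \<or> nz q b \<or> nz nx c \<or> nz k w"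
    let ?z = "cat nx a (cat q b (cat nx c w))"
    have "nz Ndim ?z" using nz by (simp add: nz_Ndim)
    from al(2)[OF this] show "0 < lmi_form al P a b c w"
      using carrier_matD[OF P(1)]
      by (simp add: bf_Q[OF P(1)] bf_Q1 Let_def lmi_form_def nominal_form_def)
  qed
  with al(1) show ?thesis using that by blast
qed

text \<open>The converse evaluates the multiplier inequality at $w = D^T F^T c$ and at the minimizing $a = -A^T c$. The sign of the
multiplier is not prescribed: a negative one contradicts the inequality at a vector supported on \<open>w\<close>, unless
there is no such vector, and then \<open>p \<le> k\<close> leaves no uncertainty at all.\<close>

lemma lmi_imp_robust:
  assumes P: "P \<in> carrier_mat nx nx" "P\<^sup>T = P" and lmi: "lmi al P" and pk: "p \<le> k"
  shows "robust P"
  unfolding robust_def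
proof (intro allI impI)
  fix D b c assume D: "admissible D" and nz: "nz q b \<or> nz nx c"
  have Dc: "D \<in> carrier_mat p k" using D by (simp add: admissible_def)
  let ?A = "A0 + F * D * G1" and ?B = "B0 + F * D * G2"
  define e where "e = mv F\<^sup>T c"
  define w where "w = mv D\<^sup>T e"
  have "bf (D * Sg * D\<^sup>T) e e = bf Sg w w" 
    unfolding w_def using Dc by (intro bf_congruence) auto
  then have w: "bf Sg w w \<le> bf R e e" using D by (metis admissible_def)
  have "0 \<le> al * (bf R e e - bf Sg w w)"
  proof (cases "0 \<le> al")
    case False
    have "\<not> nz k u" for u
    proof
      assume u: "nz k u"
      then have "0 < lmi_form al P 0 0 0 u" using lmi unfolding lmi_def by blast
      then have "0 < al * bf Sg u u" by (simp add: lmi_form_def nominal_form_def)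
      then show False using False Sg_pd[OF u] by (simp add: zero_less_mult_iff)
    qed
    from this[of "\<lambda>_. 1"] have "k = 0" by (auto simp: nz_def)
    with pk have "p = 0" "k = 0" by auto
    then show ?thesis by (simp add: bf_def)
  qed (use w in simp)
  moreover have "0 < lmi_form al P (- mv ?A\<^sup>T c) b c w"
    using lmi nz unfolding lmi_def by blast
  moreover have "nominal_form P (- mv ?A\<^sup>T c) b c w = gram_form ?A ?B P b c"
    using nominal_form_uncertain[OF P Dc, of "- mv ?A\<^sup>T c" b c] by (simp add: w_def e_def)
  ultimately show "0 < gram_form ?A ?B P b c" unfolding lmi_form_def e_def by linarith
qed

text \<open>The form is affine in $P$, so that openness of positivity applies to the perturbation $P + s M$.\<close>

lemma lmi_perturb:
  assumes P: "P \<in> carrier_mat nx nx" "M \<in> carrier_mat nx nx" and lmi: "lmi al P"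
  obtains t where "0 < t" "\<And>s. 0 \<le> s \<Longrightarrow> s \<le> t \<Longrightarrow> lmi al (P + s \<cdot>\<^sub>m M)"
proof -
  note [simp] = carrier_matD[OF P(1)] carrier_matD[OF P(2)]
  define T where "T = Q0 P - al \<cdot>\<^sub>m Q1"
  define T' where "T' = Q0 M - Q0 (0\<^sub>m nx nx)"
  have T: "T \<in> carrier_mat Ndim Ndim" "T' \<in> carrier_mat Ndim Ndim"
    unfolding T_def T'_def
    by (rule minus_carrier_mat smult_carrier_mat Q_carrier(2) Q_carrier(1)[OF zero_carrier_mat])+
  have bfT: "bf T z z + s * bf T' z z =
     lmi_form al (P + s \<cdot>\<^sub>m M) z (sh nx z) (sh q (sh nx z)) (sh nx (sh q (sh nx z)))" for s z
  proof -
    define b c w where "b = sh nx z" "c = sh q b" "w = sh nx c"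
    note z = this[symmetric]
    have T: "bf T z z = bf (Q0 P) z z - al * bf Q1 z z" "bf T' z z = bf (Q0 M) z z - bf (Q0 (0\<^sub>m nx nx)) z z"
      using carrier_matD[OF Q_carrier(2)] carrier_matD[OF Q_carrier(1)[OF P(1)]]
        carrier_matD[OF Q_carrier(1)[OF P(2)]] carrier_matD[OF Q_carrier(1)[OF zero_carrier_mat]]
      by (simp_all only: T_def T'_def bf_diff bf_smult index_smult_mat)
    have Q1: "bf Q1 z z = bf R (mv F\<^sup>T c) (mv F\<^sup>T c) - bf Sg w w"
      unfolding bf_Q1 Let_def z ..
    have N: "nominal_form (P + s \<cdot>\<^sub>m M) z b c w =
        nominal_form P z b c w + s * (nominal_form M z b c w - nominal_form (0\<^sub>m nx nx) z b c w)"
      by (simp add: nominal_form_def bf_plus mv_plus mv_smult bf_smult bf_add_right bf_smul_right)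
         (simp add: algebra_simps)
    show ?thesis
      unfolding T Q1 bf_Q[OF P(1)] bf_Q[OF P(2)] bf_Q[OF zero_carrier_mat] z lmi_form_def N
      by (simp add: algebra_simps)
  qed
  have "P + 0 \<cdot>\<^sub>m M = P"
    using P by (intro mv_eqI) (simp_all add: mv_plus mv_smult smul_def fun_eq_iff)
  have pos: "0 < bf T z z" if "nz Ndim z" for z
  proof -
    have "0 < lmi_form al P z (sh nx z) (sh q (sh nx z)) (sh nx (sh q (sh nx z)))"
      using lmi[unfolded lmi_def, rule_format] that[unfolded nz_Ndim] .
    then show ?thesis using bfT[of z 0] \<open>P + 0 \<cdot>\<^sub>m M = P\<close> by simp
  qed
  obtain t where t: "0 < t" "\<And>s z. 0 \<le> s \<Longrightarrow> s \<le> t \<Longrightarrow> nz Ndim z \<Longrightarrow> 0 < bf T z z + s * bf T' z z"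
    using pos_form_perturb[OF T pos] by blast
  show ?thesis
  proof (rule that[OF t(1)])
    fix s assume s: "0 \<le> s" "s \<le> t"
    show "lmi al (P + s \<cdot>\<^sub>m M)" unfolding lmi_def
    proof (intro allI impI)
      fix a b c w assume nz: "nz nx a \<or> nz q b \<or> nz nx c \<or> nz k w"
      let ?z = "cat nx a (cat q b (cat nx c w))"
      have "nz Ndim ?z" using nz by (simp add: nz_Ndim)
      from t(2)[OF s this] show "0 < lmi_form al (P + s \<cdot>\<^sub>m M) a b c w"
        unfolding bfT by (simp add: lmi_form_def nominal_form_def)
    qed
  qed
qed

end

section \<open>The linearizing change of variables\<close>

lemma sh_cat_le [simp]: "n \<le> k \<Longrightarrow> sh n (cat k x y) = cat (k - n) (sh n x) y"
  by (auto simp: sh_def cat_def fun_eq_iff algebra_simps)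

lemma bf_one_cat: "bf (1\<^sub>m (n + n')) (cat n x1 x2) (cat n y1 y2) = bf (1\<^sub>m n) x1 y1 + bf (1\<^sub>m n') x2 y2"
  by (simp add: bf_one sum_lessThan_add) (simp add: cat_def)

text \<open>The change of variables that linearizes output-feedback synthesis. $P$ maps the columns of
$T_1 = \mathrm{col}((X\ I), (U^T\ 0))$ to those of $T_2 = \mathrm{col}((I\ Y), (0\ V^T))$, so products of $P$ with
the closed-loop matrices become affine in $X$, $Y$ and the transformed controller parameters.
\<open>H\<close> is the negative definite block of the data matrix, \<open>J\<close> the input channel of the uncertainty.\<close>

locale feedback =
  fixes n m q p pt r :: nat
    and A B B1 C J H Xi Lam Li :: "real mat"
    and X Y U Ui V P Ac Bc Cc Dc Atc Btc Ctc :: "real mat"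
  assumes plant_carrier: "A \<in> carrier_mat n n" "B \<in> carrier_mat n m" "B1 \<in> carrier_mat n q"
      "C \<in> carrier_mat r n" "J \<in> carrier_mat p n" "H \<in> carrier_mat (n + (m + q)) (n + (m + q))"
      "Xi \<in> carrier_mat p pt" "Lam \<in> carrier_mat pt pt" "Li \<in> carrier_mat pt pt"
    and var_carrier: "X \<in> carrier_mat n n" "Y \<in> carrier_mat n n" "U \<in> carrier_mat n n"
      "Ui \<in> carrier_mat n n" "V \<in> carrier_mat n n" "P \<in> carrier_mat (n + n) (n + n)"
      "Ac \<in> carrier_mat n n" "Bc \<in> carrier_mat n r" "Cc \<in> carrier_mat m n" "Dc \<in> carrier_mat m r"
      "Atc \<in> carrier_mat n n" "Btc \<in> carrier_mat n r" "Ctc \<in> carrier_mat m n"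
    and H_sym: "H\<^sup>T = H" and H_neg: "\<And>w. nz (n + (m + q)) w \<Longrightarrow> bf H w w < 0"
    and Lam_sym: "Lam\<^sup>T = Lam" and Lam_psd: "\<And>x. 0 \<le> bf Lam x x"
    and Lam_inv: "Li * Lam = 1\<^sub>m pt" and Li_sym: "Li\<^sup>T = Li" and Li_pd: "\<And>x. nz pt x \<Longrightarrow> 0 < bf Li x x"
    and X_sym: "X\<^sup>T = X" and Y_sym: "Y\<^sup>T = Y" and P_sym: "P\<^sup>T = P"
    and UV: "U * V\<^sup>T = 1\<^sub>m n - X * Y"
    and U_inv: "U\<^sup>T * Ui = 1\<^sub>m n" "Ui * U\<^sup>T = 1\<^sub>m n"
    and P_transform: "P * blocks [[X, 1\<^sub>m n], [U\<^sup>T, 0\<^sub>m n n]] = blocks [[1\<^sub>m n, Y], [0\<^sub>m n n, V\<^sup>T]]"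
    and Btc: "Btc = X * B * Dc + U * Bc" and Ctc: "Ctc = Dc * C * Y + Cc * V\<^sup>T"
    and Atc: "Atc = X * (A * Y + B * Ctc) + U * Bc * C * Y + U * Ac * V\<^sup>T"
begin

lemma fdims [simp]:
  "dim_row A = n" "dim_col A = n" "dim_row B = n" "dim_col B = m" "dim_row B1 = n" "dim_col B1 = q"
  "dim_row C = r" "dim_col C = n" "dim_row J = p" "dim_col J = n"
  "dim_row H = n + (m + q)" "dim_col H = n + (m + q)" "dim_row Xi = p" "dim_col Xi = pt"
  "dim_row Lam = pt" "dim_col Lam = pt" "dim_row Li = pt" "dim_col Li = pt"
  "dim_row X = n" "dim_col X = n" "dim_row Y = n" "dim_col Y = n" "dim_row U = n" "dim_col U = n"
  "dim_row Ui = n" "dim_col Ui = n" "dim_row V = n" "dim_col V = n" "dim_row P = n + n" "dim_col P = n + n"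
  "dim_row Ac = n" "dim_col Ac = n" "dim_row Bc = n" "dim_col Bc = r" "dim_row Cc = m" "dim_col Cc = n"
  "dim_row Dc = m" "dim_col Dc = r" "dim_row Atc = n" "dim_col Atc = n" "dim_row Btc = n" "dim_col Btc = r"
  "dim_row Ctc = m" "dim_col Ctc = n"
  using plant_carrier var_carrier by blast+

abbreviation "A_nom \<equiv> blocks [[A + B * Dc * C, B * Cc], [Bc * C, Ac]]"
abbreviation "B_nom \<equiv> vcat [B1, 0\<^sub>m n q]"
abbreviation "F_unc \<equiv> vcat [J\<^sup>T, 0\<^sub>m n p]"
abbreviation "G1_unc \<equiv> blocks [[1\<^sub>m n, 0\<^sub>m n n], [Dc * C, Cc], [0\<^sub>m q n, 0\<^sub>m q n]]"
abbreviation "G2_unc \<equiv> vcat [0\<^sub>m n q, 0\<^sub>m m q, 1\<^sub>m q]"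
abbreviation "R_unc \<equiv> Xi * Lam * Xi\<^sup>T"
abbreviation "T1 \<equiv> blocks [[X, 1\<^sub>m n], [U\<^sup>T, 0\<^sub>m n n]]"
abbreviation "T2 \<equiv> blocks [[1\<^sub>m n, Y], [0\<^sub>m n n, V\<^sup>T]]"

sublocale uncertain_system "n + n" q p "n + (m + q)" A_nom B_nom F_unc G1_unc G2_unc R_unc "- H"
proof
  show "A_nom \<in> carrier_mat (n + n) (n + n)" "B_nom \<in> carrier_mat (n + n) q"
    "F_unc \<in> carrier_mat (n + n) p" "G1_unc \<in> carrier_mat (n + (m + q)) (n + n)"
    "G2_unc \<in> carrier_mat (n + (m + q)) q" "R_unc \<in> carrier_mat p p"
    "- H \<in> carrier_mat (n + (m + q)) (n + (m + q))"
    by (intro carrier_matI; simp add: blocks_def)+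
  have R: "bf R_unc x y = bf Lam (mv Xi\<^sup>T x) (mv Xi\<^sup>T y)" for x y
    by (rule bf_congruence) simp_all
  show "R_unc\<^sup>T = R_unc" by (subst sym_iff_bf) (simp_all add: R bf_sym[OF Lam_sym])
  show "0 \<le> bf R_unc x x" for x by (simp add: R Lam_psd)
  show "(- H)\<^sup>T = - H" using H_sym by (subst sym_iff_bf) (simp_all add: bf_uminus bf_sym)
  show "0 < bf (- H) w w" if "nz (n + (m + q)) w" for w using H_neg[OF that] by (simp add: bf_uminus)
qed

lemma mv_T1: "mv T1 (cat n s1 s2) = cat n (mv X s1 + mv (1\<^sub>m n) s2) (mv U\<^sup>T s1)"
  by (simp add: blocks_def)

lemma mv_T2: "mv T2 (cat n s1 s2) = cat n (mv (1\<^sub>m n) s1 + mv Y s2) (mv V\<^sup>T s2)"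
  by (simp add: blocks_def)

lemma mv_P_T1: "mv P (mv T1 s) = mv T2 s"
proof -
  have "mv P (mv T1 s) = mv (P * T1) s" by (rule mv_mult[symmetric]) (simp add: blocks_def)
  then show ?thesis by (simp add: P_transform)
qed

lemma UV_form: "bf U x (mv V\<^sup>T y) = bf (1\<^sub>m n) x y - bf X x (mv Y y)"
proof -
  have "bf U x (mv V\<^sup>T y) = bf (U * V\<^sup>T) x y" by (simp add: bf_mult)
  then show ?thesis by (simp add: UV bf_diff bf_mult)
qed

lemma P_form_T1:
  "bf P (mv T1 (cat n s1 s2)) (mv T1 (cat n t1 t2)) =
    bf X s1 t1 + bf (1\<^sub>m n) s1 t2 + bf (1\<^sub>m n) s2 t1 + bf Y s2 t2"
proof -
  have P: "bf P x (mv T1 y) = bf (1\<^sub>m (n + n)) x (mv T2 y)" for x y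
    unfolding mv_P_T1[symmetric] by (rule bf_one_mv[symmetric]) simp
  show ?thesis
    unfolding P unfolding mv_T1 mv_T2 bf_one_cat
    by (simp add: bf_add_left bf_add_right bf_mv_left X_sym UV_form bf_one_mv)
qed

lemma F_unc_T: "mv F_unc\<^sup>T (cat n c1 c2) = mv J c1"
proof -
  have "F_unc\<^sup>T = hcat [J, 0\<^sub>m p n]"
    by (rule bf_eqI) (simp_all add: bf_transpose)
  then show ?thesis by simp
qed

text \<open>The form of $\Pi$ with $\bar H = 0$ and the padded blocks $(0\ M) L^{-T}$ written as $M J$; \<open>w\<close> collects the three block rows that
belong to $-\alpha H$.\<close>

definition pi_form where
  "pi_form al x1 x2 b y1 y2 w v =
     bf X x1 x1 + 2 * bf (1\<^sub>m n) x1 x2 + bf Y x2 x2 + bf (1\<^sub>m q) b b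
     + 2 * (bf (A + B * Dc * C) y1 x1 + bf (A * Y + B * Ctc) y1 x2 + bf B1 y1 b
        + bf (X * A + Btc * C) y2 x1 + bf Atc y2 x2 + bf (X * B1) y2 b
        + bf (1\<^sub>m n) w x1 + bf Y w x2 + bf (Dc * C) (sh n w) x1 + bf Ctc (sh n w) x2
        + bf (1\<^sub>m q) (sh m (sh n w)) b)
     + bf Y y1 y1 + 2 * bf (1\<^sub>m n) y1 y2 + bf X y2 y2
     + 2 * al * (bf (Xi\<^sup>T * J) v y1 + bf (Xi\<^sup>T * J * X) v y2)
     - al * bf H w w + al * bf Li v v"

lemma A_nom_form:
  "bf A_nom (mv T1 (cat n y2 y1)) (mv T2 (cat n x1 x2)) =
    bf (A + B * Dc * C) y1 x1 + bf (A * Y + B * Ctc) y1 x2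
      + bf (X * A + Btc * C) y2 x1 + bf Atc y2 x2"
  unfolding mv_T1 mv_T2 
  by (simp add: blocks_def) (simp add: bf_add_left bf_add_right bf_mult bf_plus mv_mult mv_plus mv_add
      bf_mv_left X_sym Atc Btc Ctc bf_one_mv algebra_simps)

lemma G1_nom_form:
  "bf G1_unc w (mv T2 (cat n x1 x2)) =
    bf (1\<^sub>m n) w x1 + bf Y w x2 + bf (Dc * C) (sh n w) x1 + bf Ctc (sh n w) x2"
  unfolding mv_T1 mv_T2 
  by (simp add: blocks_def) (simp add: bf_add_left bf_add_right bf_mult bf_plus mv_mult mv_plus mv_add
      bf_mv_left Ctc bf_one_mv algebra_simps)

text \<open>The congruence with $\mathrm{diag}(T_1, I, T_1, I)$ turns the multiplier inequality into $\Pi$; the last block row of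
$\Pi$ is the Schur lift of $\alpha J^T \Xi \Lambda \Xi^T J$, which keeps $\alpha$ linear. The variables \<open>y2\<close>, \<open>y1\<close> enter
$T_1$ in exchanged order because $\Pi_{22}$ starts with $Y$.\<close>

lemma pi_form_eq:
  defines "e y1 y2 \<equiv> mv J (y1 + mv X y2)"
  shows "pi_form al x1 x2 b y1 y2 w v =
    lmi_form al P (mv T1 (cat n x1 x2)) b (mv T1 (cat n y2 y1)) w
      + al * bf Li (v + mv Lam (mv Xi\<^sup>T (e y1 y2))) (v + mv Lam (mv Xi\<^sup>T (e y1 y2)))"
proof -
  let ?e = "e y1 y2"
  let ?g = "mv Xi\<^sup>T ?e"
  have F: "mv F_unc\<^sup>T (mv T1 (cat n y2 y1)) = ?e"
    unfolding mv_T1 F_unc_T by (simp add: e_def mv_add add.commute)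
  have R: "bf R_unc ?e ?e = bf Lam ?g ?g"
    by (rule bf_congruence) simp_all
  have LiLam: "bf Li x (mv Lam ?g) = bf Xi\<^sup>T x ?e" for x
  proof -
    have "bf Li x (mv Lam ?g) = bf (Li * Lam) x ?g" by (simp add: bf_mult)
    then show ?thesis by (simp add: Lam_inv bf_one_mv)
  qed
  have "bf Xi\<^sup>T (mv Lam ?g) ?e = bf Lam ?g ?g"
    by (simp add: bf_mv_left Lam_sym)
  then have v: "bf Li (v + mv Lam ?g) (v + mv Lam ?g) = bf Li v v + 2 * bf Xi\<^sup>T v ?e + bf Lam ?g ?g"
    by (simp add: bf_add_left bf_add_right LiLam bf_sym[OF Li_sym, of "mv Lam ?g" v])
  have G5: "bf (Xi\<^sup>T * J) v y1 + bf (Xi\<^sup>T * J * X) v y2 = bf Xi\<^sup>T v ?e"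
    by (simp add: e_def bf_mult mv_add bf_add_right)
  have B: "bf B_nom (mv T1 (cat n y2 y1)) b = bf B1 y1 b + bf (X * B1) y2 b"
    unfolding mv_T1 by (simp add: bf_add_left bf_mv_left bf_mult X_sym bf_one_mv)
  have G2: "bf G2_unc w b = bf (1\<^sub>m q) (sh m (sh n w)) b"
    by simp
  show ?thesis
    unfolding pi_form_def lmi_form_def nominal_form_def mv_P_T1 A_nom_form G1_nom_form P_form_T1 F R v B G2
    by (simp add: bf_uminus bf_one_commute[of n x2] bf_one_commute[of n y2] G5[symmetric] algebra_simps)
qed

lemma T1_zero: "\<not> nz n s1 \<Longrightarrow> \<not> nz n s2 \<Longrightarrow> mv T1 (cat n s1 s2) = 0"
  by (intro not_nz_mv) (simp add: blocks_def nz_plus)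

text \<open>Invertibility of $T_1$ rests on that of $U$ alone.\<close>

lemma T1_inj: "nz (n + n) (mv T1 (cat n s1 s2))" if "nz n s1 \<or> nz n s2"
proof (rule ccontr)
  assume not: "\<not> ?thesis"
  then have "\<not> nz n (mv U\<^sup>T s1)" "\<not> nz n (mv X s1 + mv (1\<^sub>m n) s2)"
    by (simp_all add: mv_T1 nz_plus)
  note * = this
  have "mv Ui (mv U\<^sup>T s1) = mv (1\<^sub>m n) s1" by (simp add: U_inv(2)[symmetric] mv_mult)
  moreover have "mv Ui (mv U\<^sup>T s1) = 0" using *(1) by (intro not_nz_mv) simp
  ultimately have s1: "\<not> nz n s1" using mv_one[of _ n s1] by (auto simp: nz_def)
  then have "mv X s1 = 0" by (intro not_nz_mv) simp
  then have "\<not> nz n s2" using *(2) mv_one[of _ n s2] by (auto simp: nz_def)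
  with s1 that show False by simp
qed

lemma T1_surj:
  obtains s1 s2 where "\<And>i. i < n + n \<Longrightarrow> mv T1 (cat n s1 s2) i = a i"
proof (rule that[of "mv Ui (sh n a)" "a - mv X (mv Ui (sh n a))"])
  fix i assume i: "i < n + n"
  let ?s1 = "mv Ui (sh n a)"
  have U: "mv U\<^sup>T ?s1 = mv (1\<^sub>m n) (sh n a)" by (simp add: U_inv(1)[symmetric] mv_mult)
  show "mv T1 (cat n ?s1 (a - mv X ?s1)) i = a i"
    using i unfolding mv_T1 U by (auto simp: cat_def mv_one sh_def)
qed

lemma lmi_form_cong:
  "(\<And>i. i < n + n \<Longrightarrow> a i = a' i) \<Longrightarrow> (\<And>i. i < n + n \<Longrightarrow> c i = c' i) \<Longrightarrow>
    lmi_form al P a b c w = lmi_form al P a' b c' w"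
  unfolding lmi_form_def nominal_form_def
proof -
  assume a: "\<And>i. i < n + n \<Longrightarrow> a i = a' i" and c: "\<And>i. i < n + n \<Longrightarrow> c i = c' i"
  have "mv P a = mv P a'" "bf P a a = bf P a' a'" using a by (auto intro: mv_cong bf_cong)
  moreover have "bf P c c = bf P c' c'" "\<And>y. bf A_nom c y = bf A_nom c' y" "\<And>y. bf B_nom c y = bf B_nom c' y"
    "mv F_unc\<^sup>T c = mv F_unc\<^sup>T c'"
    by (rule mv_cong bf_cong; simp add: c)+
  ultimately show "bf P a a + bf (1\<^sub>m q) b b + bf P c c + 2 * bf A_nom c (mv P a) + 2 * bf B_nom c b
      + 2 * bf G1_unc w (mv P a) + 2 * bf G2_unc w b
      - al * (bf R_unc (mv F_unc\<^sup>T c) (mv F_unc\<^sup>T c) - bf (- H) w w) =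
    bf P a' a' + bf (1\<^sub>m q) b b + bf P c' c' + 2 * bf A_nom c' (mv P a') + 2 * bf B_nom c' b
      + 2 * bf G1_unc w (mv P a') + 2 * bf G2_unc w b
      - al * (bf R_unc (mv F_unc\<^sup>T c') (mv F_unc\<^sup>T c') - bf (- H) w w)"
    by simp
qed

definition pi_pos :: "real \<Rightarrow> bool" where
  "pi_pos al \<longleftrightarrow> (\<forall>x1 x2 b y1 y2 w v.
     nz n x1 \<or> nz n x2 \<or> nz q b \<or> nz n y1 \<or> nz n y2 \<or> nz (n + (m + q)) w \<or> nz pt v \<longrightarrow>
     0 < pi_form al x1 x2 b y1 y2 w v)"

lemma pi_pos_imp_lmi: "pi_pos al \<Longrightarrow> lmi al P"
  unfolding lmi_def
proof (intro allI impI)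
  fix a b c w
  assume pi: "pi_pos al" and nz: "nz (n + n) a \<or> nz q b \<or> nz (n + n) c \<or> nz (n + (m + q)) w"
  obtain x1 x2 where x: "\<And>i. i < n + n \<Longrightarrow> mv T1 (cat n x1 x2) i = a i" using T1_surj by blast
  obtain y2 y1 where y: "\<And>i. i < n + n \<Longrightarrow> mv T1 (cat n y2 y1) i = c i" using T1_surj by blast
  have zero: "\<not> nz (n + n) (mv T1 (cat n s1 s2))" if "\<not> nz n s1" "\<not> nz n s2" for s1 s2
    using T1_zero[OF that] by (simp add: nz_def)
  have "nz (n + n) a \<longleftrightarrow> nz (n + n) (mv T1 (cat n x1 x2))" "nz (n + n) c \<longleftrightarrow> nz (n + n) (mv T1 (cat n y2 y1))"
    using x y by (auto simp: nz_def)
  with nz zero have nz': "nz n x1 \<or> nz n x2 \<or> nz q b \<or> nz n y1 \<or> nz n y2 \<or> nz (n + (m + q)) w"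
    by blast
  \<comment> \<open>The minimizer over the last block: it removes the completed square in \<open>pi_form_eq\<close>.\<close>
  let ?v = "- mv Lam (mv Xi\<^sup>T (mv J (y1 + mv X y2)))"
  have "0 < pi_form al x1 x2 b y1 y2 w ?v"
    using pi nz' unfolding pi_pos_def by blast
  then have "0 < lmi_form al P (mv T1 (cat n x1 x2)) b (mv T1 (cat n y2 y1)) w"
    unfolding pi_form_eq by simp
  then show "0 < lmi_form al P a b c w"
    using lmi_form_cong[OF x y] by simp
qed

lemma lmi_imp_pi_pos:
  assumes "0 < al" "lmi al P"
  shows "pi_pos al"
  unfolding pi_pos_def
proof (intro allI impI)
  fix x1 x2 b y1 y2 w v
  assume nz: "nz n x1 \<or> nz n x2 \<or> nz q b \<or> nz n y1 \<or> nz n y2 \<or> nz (n + (m + q)) w \<or> nz pt v"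
  let ?g = "mv Lam (mv Xi\<^sup>T (mv J (y1 + mv X y2)))"
  let ?l = "lmi_form al P (mv T1 (cat n x1 x2)) b (mv T1 (cat n y2 y1)) w"
  let ?t = "bf Li (v + ?g) (v + ?g)"
  have t: "0 \<le> ?t" 
    using Li_pd[of "v + ?g"] not_nz_bf(1)[of Li "v + ?g" "v + ?g"] by (cases "nz pt (v + ?g)") auto
  show "0 < pi_form al x1 x2 b y1 y2 w v"
  proof (cases "nz n x1 \<or> nz n x2 \<or> nz q b \<or> nz n y1 \<or> nz n y2 \<or> nz (n + (m + q)) w")
    case True
    then have "0 < ?l" using assms(2) T1_inj unfolding lmi_def by blast
    then show ?thesis unfolding pi_form_eq using t assms(1)
      by (simp add: add_pos_nonneg)
  next
    case False
    then have "mv T1 (cat n x1 x2) = 0" "mv T1 (cat n y2 y1) = 0"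
      using T1_zero by blast+
    moreover have "mv J (y1 + mv X y2) = 0"
      using False by (auto intro!: not_nz_mv simp: mv_add not_nz_mv)
    moreover have "bf H w w = 0" "bf (1\<^sub>m q) b b = 0" using False by auto
    moreover have "bf G2_unc w b = 0" using False by (intro not_nz_bf) simp
    ultimately have "pi_form al x1 x2 b y1 y2 w v = al * bf Li v v"
      unfolding pi_form_eq by (simp add: lmi_form_def nominal_form_def bf_uminus)
    moreover have "nz pt v" using nz False by blast
    ultimately show ?thesis using assms(1) Li_pd by simp
  qed
qed

definition output_form where
  "output_form D1 Z Ccl z a = bf (Z - D1 * D1\<^sup>T) z z + 2 * bf Ccl z (mv P a) + bf P a a"

definition delta_form where
  "delta_form C1 E D1 Z b z x1 x2 =
     bf (1\<^sub>m q) b b + 2 * bf D1 z b + bf Z z z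
     + 2 * bf (C1 + E * Dc * C) z x1 + 2 * bf (C1 * Y + E * Ctc) z x2
     + bf X x1 x1 + 2 * bf (1\<^sub>m n) x1 x2 + bf Y x2 x2"

context
  fixes s :: nat and C1 E D1 Z Ccl :: "real mat"
  assumes oc: "C1 \<in> carrier_mat s n" "E \<in> carrier_mat s m" "D1 \<in> carrier_mat s q" "Z \<in> carrier_mat s s"
    and Ccl: "Ccl = hcat [C1 + E * Dc * C, E * Cc]"
begin

lemma odims [simp]:
  "dim_row C1 = s" "dim_col C1 = n" "dim_row E = s" "dim_col E = m" "dim_row D1 = s" "dim_col D1 = q"
  "dim_row Z = s" "dim_col Z = s"
  using oc by blast+

text \<open>$\Delta$ is the second closed-loop inequality, lifted by a Schur complement in $D_1$ and transformed by $T_1$.\<close>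

lemma delta_form_eq:
  "delta_form C1 E D1 Z b z x1 x2 =
    bf (1\<^sub>m q) (b + mv D1\<^sup>T z) (b + mv D1\<^sup>T z) + output_form D1 Z Ccl z (mv T1 (cat n x1 x2))"
proof -
  have "bf (Z - D1 * D1\<^sup>T) z z = bf Z z z - bf D1 z (mv D1\<^sup>T z)"
    by (simp add: bf_diff bf_mult)
  moreover have "bf (1\<^sub>m q) (b + mv D1\<^sup>T z) (b + mv D1\<^sup>T z) =
      bf (1\<^sub>m q) b b + 2 * bf D1 z b + bf D1 z (mv D1\<^sup>T z)"
    by (simp add: bf_add_left bf_add_right bf_mv_left bf_one_mv bf_transpose)
  moreover have "bf Ccl z (mv T2 (cat n x1 x2)) =
      bf (C1 + E * Dc * C) z x1 + bf (C1 * Y + E * Ctc) z x2"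
    unfolding mv_T2 Ccl
    by (simp add: bf_add_right bf_mult bf_plus mv_add Ctc mv_mult mv_plus)
  ultimately show ?thesis
    unfolding delta_form_def output_form_def mv_P_T1 P_form_T1
    by (simp add: bf_one_commute[of n x2])
qed

lemma delta_pos_iff:
  "(\<forall>b z x1 x2. nz q b \<or> nz s z \<or> nz n x1 \<or> nz n x2 \<longrightarrow> 0 < delta_form C1 E D1 Z b z x1 x2) \<longleftrightarrow>
   (\<forall>z a. nz s z \<or> nz (n + n) a \<longrightarrow> 0 < output_form D1 Z Ccl z a)" (is "?L \<longleftrightarrow> ?R")
proof
  assume L: ?L
  show ?R
  proof (intro allI impI)
    fix z a assume nz: "nz s z \<or> nz (n + n) a"
    obtain x1 x2 where x: "\<And>i. i < n + n \<Longrightarrow> mv T1 (cat n x1 x2) i = a i" using T1_surj by blast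
    have "nz (n + n) a \<longleftrightarrow> nz (n + n) (mv T1 (cat n x1 x2))" using x by (auto simp: nz_def)
    moreover have "\<not> nz (n + n) (0 :: nat \<Rightarrow> real)" by (simp add: nz_def)
    ultimately have "nz s z \<or> nz n x1 \<or> nz n x2" using nz T1_zero by metis
    then have "0 < delta_form C1 E D1 Z (- mv D1\<^sup>T z) z x1 x2" using L by blast
    then have "0 < output_form D1 Z Ccl z (mv T1 (cat n x1 x2))" unfolding delta_form_eq by simp
    moreover have "mv P (mv T1 (cat n x1 x2)) = mv P a"
      "bf P (mv T1 (cat n x1 x2)) (mv T1 (cat n x1 x2)) = bf P a a"
      by (rule mv_cong bf_cong; simp only: fdims x)+
    ultimately show "0 < output_form D1 Z Ccl z a" unfolding output_form_def by simp
  qed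
next
  assume R: ?R
  show ?L
  proof (intro allI impI)
    fix b z x1 x2 assume nz: "nz q b \<or> nz s z \<or> nz n x1 \<or> nz n x2"
    show "0 < delta_form C1 E D1 Z b z x1 x2"
    proof (cases "nz s z \<or> nz n x1 \<or> nz n x2")
      case True
      then have "0 < output_form D1 Z Ccl z (mv T1 (cat n x1 x2))" using R T1_inj by blast
      then show ?thesis unfolding delta_form_eq using bf_one_nonneg[of q "b + mv D1\<^sup>T z"] by linarith
    next
      case False
      then have "mv T1 (cat n x1 x2) = 0" using T1_zero by blast
      moreover have "mv D1\<^sup>T z = 0" using False by (intro not_nz_mv) simp
      moreover have "bf (Z - D1 * D1\<^sup>T) z z = 0" using False by (intro not_nz_bf) simp
      ultimately have "delta_form C1 E D1 Z b z x1 x2 = bf (1\<^sub>m q) b b"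
        unfolding delta_form_eq output_form_def by simp
      with nz False show ?thesis by (simp add: bf_one_pos_iff)
    qed
  qed
qed

end

end

section \<open>Rank, inverses and kernels\<close>

lemma vec_mv: "A \<in> carrier_mat nr nc \<Longrightarrow> A *\<^sub>v vec nc x = vec nr (mv A x)"
  by (rule eq_vecI) (auto simp: mv_def scalar_prod_def lessThan_atLeast0)

lemma inj_iff_vec:
  assumes "A \<in> carrier_mat nr nc"
  shows "(\<forall>x. nz nc x \<longrightarrow> nz nr (mv A x)) \<longleftrightarrow>
    \<not> (\<exists>v. v \<in> carrier_vec nc \<and> v \<noteq> 0\<^sub>v nc \<and> A *\<^sub>v v = 0\<^sub>v nr)"
proof -
  have "(\<exists>v. v \<in> carrier_vec nc \<and> v \<noteq> 0\<^sub>v nc \<and> A *\<^sub>v v = 0\<^sub>v nr) \<longleftrightarrow>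
      (\<exists>x. vec nc x \<noteq> 0\<^sub>v nc \<and> A *\<^sub>v vec nc x = 0\<^sub>v nr)"
  proof
    assume "\<exists>v. v \<in> carrier_vec nc \<and> v \<noteq> 0\<^sub>v nc \<and> A *\<^sub>v v = 0\<^sub>v nr"
    then obtain v where v: "v \<in> carrier_vec nc" "v \<noteq> 0\<^sub>v nc" "A *\<^sub>v v = 0\<^sub>v nr" by blast
    have "vec nc (\<lambda>i. v $ i) = v" using v(1) by (intro eq_vecI) auto
    with v show "\<exists>x. vec nc x \<noteq> 0\<^sub>v nc \<and> A *\<^sub>v vec nc x = 0\<^sub>v nr" by metis
  qed (use vec_carrier in blast)
  moreover have "vec k x = 0\<^sub>v k \<longleftrightarrow> \<not> nz k x" for k and x :: "nat \<Rightarrow> real"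
    by (simp add: nz_vec')
  ultimately show ?thesis by (simp add: vec_mv[OF assms])
qed

lemma det_nz_iff_inj:
  assumes "A \<in> carrier_mat n n"
  shows "det A \<noteq> 0 \<longleftrightarrow> (\<forall>x. nz n x \<longrightarrow> nz n (mv A x))"
  using det_0_iff_vec_prod_zero_field[OF assms] inj_iff_vec[OF assms] by blast

text \<open>\<open>minv\<close> is specified only for invertible matrices; injectivity is the form in which invertibility is available
below.\<close>

lemma minv_inverse:
  assumes A: "A \<in> carrier_mat n n" and inj: "\<And>x. nz n x \<Longrightarrow> nz n (mv A x)"
  shows "minv A \<in> carrier_mat n n" "A * minv A = 1\<^sub>m n" "minv A * A = 1\<^sub>m n"
proof -
  have "det A \<noteq> 0" using det_nz_iff_inj[OF A] inj by blast
  then have "A \<in> Units (ring_mat TYPE(real) n ())" by (rule det_non_zero_imp_unit[OF A])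
  then obtain B where "mat_inverse A = Some B" using mat_inverse(1)[OF A] by fastforce
  with mat_inverse(2)[OF A this]
  show "minv A \<in> carrier_mat n n" "A * minv A = 1\<^sub>m n" "minv A * A = 1\<^sub>m n"
    by (simp_all add: minv_def)
qed

lemma left_inverse_inj:
  assumes "B * A = 1\<^sub>m n" "A \<in> carrier_mat n n" "B \<in> carrier_mat n n" "nz n x"
  shows "nz n (mv A x)"
proof (rule ccontr)
  assume "\<not> ?thesis"
  then have "mv B (mv A x) = 0" using assms by (intro not_nz_mv) auto
  then have "mv (1\<^sub>m n) x = 0" using assms by (simp add: mv_mult[symmetric])
  then show False using assms(4) mv_one[of _ n x] by (auto simp: nz_def)
qed

lemma pd_inj:
  assumes "A \<in> carrier_mat n n" "0 < bf A x x"
  shows "nz n (mv A x)"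
proof (rule ccontr)
  assume "\<not> ?thesis"
  then have "bf A x x = 0" using assms(1) unfolding bf_eq_dot by (intro sum.neutral) (auto simp: nz_def)
  with assms(2) show False by simp
qed

lemma minv_pos_def:
  assumes A: "A \<in> carrier_mat n n" "A\<^sup>T = A" and pd: "\<And>x. nz n x \<Longrightarrow> 0 < bf A x x"
  shows "(minv A)\<^sup>T = minv A" "nz n x \<Longrightarrow> 0 < bf (minv A) x x"
proof -
  note inv = minv_inverse[OF A(1) pd_inj[OF A(1) pd]]
  note [simp] = carrier_matD[OF A(1)] carrier_matD[OF inv(1)]
  have form: "bf (minv A) x y = bf A (mv (minv A) x) (mv (minv A) y)" for x y
  proof -
    have "bf (minv A) x y = bf (minv A) (mv (A * minv A) x) y"
      by (simp add: inv(2))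
    then show ?thesis by (simp add: mv_mult bf_mv_left A(2))
  qed
  show "(minv A)\<^sup>T = minv A"
    by (subst sym_iff_bf) (simp_all add: form bf_sym[OF A(2)])
  show "0 < bf (minv A) x x" if "nz n x"
    unfolding form by (intro pd left_inverse_inj[OF inv(2)] inv(1) A(1) that)
qed

text \<open>Padding an injective matrix with zero rows to a square one would make it invertible, although its last row vanishes.\<close>

lemma inj_imp_le:
  assumes A: "A \<in> carrier_mat nr nc" and inj: "\<And>x. nz nc x \<Longrightarrow> nz nr (mv A x)"
  shows "nc \<le> nr"
proof (rule ccontr)
  assume lt: "\<not> nc \<le> nr"
  let ?B = "vcat [A, 0\<^sub>m (nc - nr) nc]"
  note [simp] = carrier_matD[OF A]
  have B: "?B \<in> carrier_mat nc nc" using lt by (intro carrier_matI) auto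
  have mvB: "mv ?B x = cat nr (mv A x) 0" for x by simp
  have "nz nc (mv ?B x)" if "nz nc x" for x
  proof -
    have "nz nr (cat nr (mv A x) 0)" using inj[OF that] by simp
    then show ?thesis unfolding mvB nz_def using lt by force
  qed
  note inv = minv_inverse[OF B this]
  let ?e = "\<lambda>_. 1 :: real"
  have "mv ?B (mv (minv ?B) ?e) = mv (1\<^sub>m nc) ?e"
    using inv B by (metis carrier_matD mv_mult)
  then have "mv ?B (mv (minv ?B) ?e) (nc - 1) = 1" using lt by (simp add: mv_one del: mv_vcat)
  moreover have "mv ?B y (nc - 1) = 0" for y unfolding mvB using lt by (simp add: cat_def)
  ultimately show False by simp
qed

lemma maximal_indpt_cols:
  assumes "A \<in> carrier_mat nr nc"
  obtains T where "T \<subseteq> set (cols A)" "module.lin_indpt class_ring (module_vec TYPE(real) nr) T"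
    "card T = vec_space.rank nr A"
proof -
  interpret vec_space "TYPE(real)" nr .
  obtain T where T: "maximal T (\<lambda>T. T \<subseteq> set (cols A) \<and> lin_indpt T)"
    using maximal_exists[of "(\<lambda>T. T \<subseteq> set (cols A) \<and> lin_indpt T)" "card (set (cols A))" "{}"]
    by (meson List.finite_set card_mono empty_iff empty_subsetI finite_lin_indpt2 rev_finite_subset)
  then show ?thesis using rank_card_indpt[OF assms T] that by (auto simp: maximal_def)
qed

lemma indpt_cols_inj:
  assumes A: "A \<in> carrier_mat nr nc" and "distinct (cols A)"
    and "module.lin_indpt class_ring (module_vec TYPE(real) nr) (set (cols A))"
    and "nz nc x"
  shows "nz nr (mv A x)"
proof -
  interpret vec_space "TYPE(real)" nr .
  show ?thesis using inj_iff_vec[OF A] lin_depI[OF A] assms(2-4) by blast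
qed

lemma full_col_rank_inj:
  assumes A: "A \<in> carrier_mat nr nc" and "vec_space.rank nr A = nc" and x: "nz nc x"
  shows "nz nr (mv A x)"
proof -
  obtain T where T: "T \<subseteq> set (cols A)" "module.lin_indpt class_ring (module_vec TYPE(real) nr) T"
    "card T = nc" using maximal_indpt_cols[OF A] assms(2) by metis
  have len: "length (cols A) = nc" using A by simp
  then have "T = set (cols A)"
    using T card_length[of "cols A"] by (intro card_seteq) auto
  moreover from this have "distinct (cols A)" using T len by (intro card_distinct) simp
  ultimately show ?thesis using indpt_cols_inj[OF A _ _ x] T by blast
qed

lemma full_rank_det:
  "A \<in> carrier_mat n n \<Longrightarrow> vec_space.rank n A = n \<longleftrightarrow> det (A :: real mat) \<noteq> 0"
  using vec_space.det_rank_iff by blast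

lemma transpose_inj:
  "A \<in> carrier_mat n n \<Longrightarrow> (\<And>x. nz n x \<Longrightarrow> nz n (mv A x)) \<Longrightarrow> nz n x \<Longrightarrow> nz n (mv A\<^sup>T x)"
  using det_nz_iff_inj[of A n] det_nz_iff_inj[of "A\<^sup>T" n] det_transpose[of A n] by auto

text \<open>Enough independent columns form an invertible square submatrix, whose transpose is injective.\<close>

lemma full_row_rank_inj:
  assumes A: "A \<in> carrier_mat nr nc" and "vec_space.rank nr A = nr" and x: "nz nr x"
  shows "nz nc (mv A\<^sup>T x)"
proof -
  obtain T where T: "T \<subseteq> set (cols A)" "module.lin_indpt class_ring (module_vec TYPE(real) nr) T"
    "card T = nr" using maximal_indpt_cols[OF A] assms(2) by metis
  have "finite T" using T(1) finite_subset by blast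
  then obtain ts where ts: "set ts = T" "distinct ts" using finite_distinct_list by blast
  have len: "length ts = nr" using ts T(3) distinct_card by fastforce
  have dim: "set ts \<subseteq> carrier_vec nr" using ts T(1) cols_dim[of A] A by auto
  define B where "B = mat_of_cols nr ts"
  have B: "B \<in> carrier_mat nr nr" by (simp add: B_def len[symmetric])
  have cols: "cols B = ts" unfolding B_def by (rule cols_mat_of_cols[OF dim])
  have "nz nr (mv B y)" if "nz nr y" for y
    using indpt_cols_inj[OF B _ _ that] cols ts T by simp
  then have "nz nr (mv B\<^sup>T x)" using transpose_inj[OF B _ x] by blast
  then obtain i where i: "i < nr" "mv B\<^sup>T x i \<noteq> 0" by (auto simp: nz_def)
  have "ts ! i \<in> set (cols A)" using i len ts T(1) nth_mem by blast
  then obtain j where j: "j < nc" "ts ! i = col A j"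
    using A by (auto simp: in_set_conv_nth)
  have "mv B\<^sup>T x i = mv A\<^sup>T x j"
    using i j A len by (auto simp: mv_def B_def mat_of_cols_index)
  with i j show ?thesis by (auto simp: nz_def)
qed

text \<open>A kernel vector orthogonal to a spanning set of the kernel is orthogonal to itself.\<close>

lemma kernel_basis_orthogonal:
  assumes A: "A \<in> carrier_mat nr nc" and basis: "kernel.basis nc A Bs"
    and x: "mv A x = 0" and orth: "\<And>v. v \<in> Bs \<Longrightarrow> v \<bullet> vec nc x = 0"
  shows "\<not> nz nc x"
proof -
  interpret kernel nr nc A by (unfold_locales) (rule A)
  have S: "Bs \<subseteq> mat_kernel A" "span Bs = mat_kernel A"
    using basis unfolding Ker.basis_def by auto
  have Bc: "Bs \<subseteq> carrier_vec nc" using S(1) mat_kernel_carrier[OF A] by blast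
  have "A *\<^sub>v vec nc x = 0\<^sub>v nr" unfolding vec_mv[OF A] x by (auto simp: zero_vec_def)
  then have "vec nc x \<in> mat_kernel A" by (intro mat_kernelI[OF A]) auto
  then have "vec nc x \<in> NC.span Bs" using S span_same by simp
  then obtain a U where U: "finite U" "U \<subseteq> Bs" "vec nc x = NC.lincomb a U"
    unfolding NC.span_def by auto
  have "NC.lincomb a U \<bullet> vec nc x = (\<Sum>u\<in>U. a u * (u \<bullet> vec nc x))"
  proof -
    have UC: "U \<subseteq> carrier_vec nc" using U(2) Bc by blast
    have "NC.lincomb a U \<bullet> vec nc x = (\<Sum>i<nc. \<Sum>u\<in>U. a u * u $ i * x i)"
      using NC.lincomb_index[OF _ UC]
      by (simp add: scalar_prod_def lessThan_atLeast0 sum_distrib_right)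
    also have "\<dots> = (\<Sum>u\<in>U. \<Sum>i<nc. a u * u $ i * x i)" by (rule sum.swap)
    also have "\<dots> = (\<Sum>u\<in>U. a u * (u \<bullet> vec nc x))"
      by (auto simp: scalar_prod_def lessThan_atLeast0 sum_distrib_left mult.assoc intro!: sum.cong)
    finally show ?thesis .
  qed
  also have "\<dots> = 0" using orth U(2) by (intro sum.neutral) auto
  finally have "(\<Sum>i<nc. x i * x i) = 0"
    using U(3)[symmetric] by (simp add: scalar_prod_def lessThan_atLeast0)
  then show ?thesis using bf_one_pos_iff[of nc x] by (simp add: bf_one)
qed

section \<open>The data matrix and the consistent set\<close>

lemma dim_subblock [simp]: "dim_row (subblock A r c nr nc) = nr" "dim_col (subblock A r c nr nc) = nc"
  by (simp_all add: subblock_def)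

lemma bf_subblock: "bf (subblock A r c nr nc) x y = (\<Sum>i<nr. \<Sum>j<nc. x i * A $$ (r + i, c + j) * y j)"
  by (simp add: bf_def subblock_def)

lemma mv_subblock_rows:
  "dim_col A = nc \<Longrightarrow> i < nr \<Longrightarrow> r + nr \<le> dim_row A \<Longrightarrow> mv (subblock A r 0 nr nc) x i = mv A x (r + i)"
  by (simp add: mv_def subblock_def)

lemma bf_row_split:
  "dim_row A = r1 + r2 \<Longrightarrow> dim_col A = nc \<Longrightarrow>
    bf A x y = bf (subblock A 0 0 r1 nc) x y + bf (subblock A r1 0 r2 nc) (sh r1 x) y"
  by (simp add: bf_def subblock_def sum_lessThan_add sh_def)

locale data_driven =
  fixes S :: plant_data and pt :: nat and Xi Lam L1 :: "real mat"
  assumes wf: "well_formed S" and sa: "standing_assumptions S"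
    and fac: "Xi_Lambda_factorization S pt Xi Lam" and kb: "kernel_basis_rows S L1"
begin

abbreviation "n \<equiv> ntil S"
abbreviation "p \<equiv> dim_y S"
abbreviation "m \<equiv> dim_u S"
abbreviation "q \<equiv> dim_w S"
abbreviation "md \<equiv> dim_d S"
abbreviation "N \<equiv> samples S"
abbreviation "Dall \<equiv> vcat [Xd S, Udat S, Wdat S]"

lemma plant_carriers:
  "Bd0 S \<in> carrier_mat p md" "Chat1 S \<in> carrier_mat (dim_z S) (dim_chi S)"
  "Emat S \<in> carrier_mat (dim_z S) m" "D1mat S \<in> carrier_mat (dim_z S) q"
  "Chat S \<in> carrier_mat (dim_yc S) (dim_chi S)"
  "svd_left S \<in> carrier_mat (dim_chi S) n" "svd_vals S \<in> carrier_mat n n" "svd_right S \<in> carrier_mat N n"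
  "Phi S \<in> carrier_mat (md + N) (md + N)" "Xd S \<in> carrier_mat n N"
  "Ydat S \<in> carrier_mat p N" "Udat S \<in> carrier_mat m N" "Wdat S \<in> carrier_mat q N"
  "Xdat S \<in> carrier_mat (dim_chi S) N"
  "Xi \<in> carrier_mat p pt" "Lam \<in> carrier_mat pt pt" "L1 \<in> carrier_mat (n - p) n"
proof -
  have svd: "compact_svd (dim_chi S) N n (Xdat S) (svd_left S) (svd_vals S) (svd_right S)"
    and Phi: "Phi S \<in> sym_mats (md + N)"
    using wf unfolding well_formed_def by blast+
  show "Bd0 S \<in> carrier_mat p md" "Chat1 S \<in> carrier_mat (dim_z S) (dim_chi S)"
    "Emat S \<in> carrier_mat (dim_z S) m" "D1mat S \<in> carrier_mat (dim_z S) q"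
    "Chat S \<in> carrier_mat (dim_yc S) (dim_chi S)"
    using wf unfolding well_formed_def by blast+
  show sv: "svd_left S \<in> carrier_mat (dim_chi S) n" "svd_vals S \<in> carrier_mat n n" "svd_right S \<in> carrier_mat N n"
    using svd unfolding compact_svd_def by blast+
  show "Phi S \<in> carrier_mat (md + N) (md + N)" using Phi unfolding sym_mats_def by blast
  show "Xd S \<in> carrier_mat n N" unfolding Xd_def using sv by (intro mult_carrier_mat) auto
  show "Ydat S \<in> carrier_mat p N" "Udat S \<in> carrier_mat m N" "Wdat S \<in> carrier_mat q N"
    "Xdat S \<in> carrier_mat (dim_chi S) N"
    unfolding Ydat_def Udat_def Wdat_def Xdat_def data_mat_def by (intro carrier_matI; simp)+
  show "Xi \<in> carrier_mat p pt" "Lam \<in> carrier_mat pt pt"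
    using fac unfolding Xi_Lambda_factorization_def by blast+
  show "L1 \<in> carrier_mat (n - p) n" using kb unfolding kernel_basis_rows_def by blast
qed

lemma pdims [simp]:
  "dim_row (Bd0 S) = p" "dim_col (Bd0 S) = md"
  "dim_row (Chat1 S) = dim_z S" "dim_col (Chat1 S) = dim_chi S"
  "dim_row (Emat S) = dim_z S" "dim_col (Emat S) = m"
  "dim_row (D1mat S) = dim_z S" "dim_col (D1mat S) = q"
  "dim_row (Chat S) = dim_yc S" "dim_col (Chat S) = dim_chi S"
  "dim_row (svd_left S) = dim_chi S" "dim_col (svd_left S) = n"
  "dim_row (svd_vals S) = n" "dim_col (svd_vals S) = n"
  "dim_row (svd_right S) = N" "dim_col (svd_right S) = n"
  "dim_row (Phi S) = md + N" "dim_col (Phi S) = md + N"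
  "dim_row (Xd S) = n" "dim_col (Xd S) = N"
  "dim_row (Ydat S) = p" "dim_col (Ydat S) = N"
  "dim_row (Udat S) = m" "dim_col (Udat S) = N"
  "dim_row (Wdat S) = q" "dim_col (Wdat S) = N"
  "dim_row (Xdat S) = dim_chi S" "dim_col (Xdat S) = N"
  "dim_row Xi = p" "dim_col Xi = pt" "dim_row Lam = pt" "dim_col Lam = pt"
  "dim_row L1 = n - p" "dim_col L1 = n"
  using plant_carriers by blast+

lemma Phi_sym: "(Phi S)\<^sup>T = Phi S"
  using wf by (simp add: well_formed_def sym_mats_def)

lemma Phi22_neg:
  assumes "nz N y"
  shows "bf (Phi S) (cat md 0 y) (cat md 0 y) < 0"
proof -
  let ?P = "subblock (Phi S) md md N N"
  have "pos_def (- ?P)" using wf by (simp add: well_formed_def neg_def_def)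
  moreover have "- ?P \<in> carrier_mat N N" by (intro carrier_matI) simp_all
  ultimately have "0 < bf (- ?P) y y" using assms pos_def_iff by blast
  moreover have "bf (Phi S) (cat md 0 y) (cat md 0 y) = bf ?P y y"
    by (simp add: bf_def subblock_def sum_lessThan_add) (simp add: cat_def)
  ultimately show ?thesis by (simp add: bf_uminus)
qed

lemma Dall_inj: "nz (n + (m + q)) w \<Longrightarrow> nz N (mv Dall\<^sup>T w)"
proof (rule full_row_rank_inj)
  show "Dall \<in> carrier_mat (n + (m + q)) N" by (intro carrier_matI) simp_all
  show "vec_space.rank (n + (m + q)) Dall = n + (m + q)"
    using sa by (simp add: standing_assumptions_def add.assoc)
qed

lemma Bd0_inj: "nz md x \<Longrightarrow> nz p (mv (Bd0 S) x)"
  using full_col_rank_inj[OF plant_carriers(1)] wf by (simp add: well_formed_def)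

abbreviation "Mdat \<equiv> blocks [[Bd0 S, Ydat S], [0\<^sub>m n md, - Xd S], [0\<^sub>m m md, - Udat S], [0\<^sub>m q md, - Wdat S]]"

text \<open>$H = \mathcal M \Phi \mathcal M^T$, so values of $H$ are values of $\Phi$ at the residuals of the data equation.\<close>

lemma mv_Mdat_T:
  "mv Mdat\<^sup>T x = cat md (mv (Bd0 S)\<^sup>T x) (mv (Ydat S)\<^sup>T x - mv Dall\<^sup>T (sh p x))"
proof -
  have "Mdat\<^sup>T = blocks [[(Bd0 S)\<^sup>T, 0\<^sub>m md (n + (m + q))], [(Ydat S)\<^sup>T, - Dall\<^sup>T]]"
    by (rule bf_eqI) (simp_all add: bf_transpose bf_uminus blocks_def)
  then show ?thesis by (simp add: blocks_def mv_uminus)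
qed

lemma dim_Hmat [simp]: "dim_row (Hmat S) = p + (n + (m + q))" "dim_col (Hmat S) = p + (n + (m + q))"
  by (simp_all add: Hmat_def blocks_def Let_def)

lemma bf_Hmat: "bf (Hmat S) x y = bf (Phi S) (mv Mdat\<^sup>T x) (mv Mdat\<^sup>T y)"
  unfolding Hmat_def Let_def by (rule bf_congruence) (simp_all add: blocks_def)

lemma Hmat_sym: "bf (Hmat S) x y = bf (Hmat S) y x"
  unfolding bf_Hmat by (rule bf_sym[OF Phi_sym])

lemma Hmat_index_sym: "i < p + (n + (m + q)) \<Longrightarrow> j < p + (n + (m + q)) \<Longrightarrow> Hmat S $$ (i, j) = Hmat S $$ (j, i)"
  using sym_iff_bf[of "Hmat S"] Hmat_sym by (metis dim_Hmat index_transpose_mat(1))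

lemma Hblk_eq:
  "Hblk S 1 1 = subblock (Hmat S) 0 0 p p"
  "Hblk S 1 2 = subblock (Hmat S) 0 p p n"
  "Hblk S 1 3 = subblock (Hmat S) 0 (p + n) p m"
  "Hblk S 1 4 = subblock (Hmat S) 0 (p + (n + m)) p q"
  "Hblk S 2 2 = subblock (Hmat S) p p n n"
  "Hblk S 2 3 = subblock (Hmat S) p (p + n) n m"
  "Hblk S 2 4 = subblock (Hmat S) p (p + (n + m)) n q"
  "Hblk S 3 3 = subblock (Hmat S) (p + n) (p + n) m m"
  "Hblk S 3 4 = subblock (Hmat S) (p + n) (p + (n + m)) m q"
  "Hblk S 4 4 = subblock (Hmat S) (p + (n + m)) (p + (n + m)) q q"
  by (simp_all add: Hblk_def Hsizes_def numeral_eq_Suc)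

lemma dim_Hblk [simp]:
  "dim_row (Hblk S (Suc 0) 2) = p" "dim_col (Hblk S (Suc 0) 2) = n"
  "dim_row (Hblk S (Suc 0) 3) = p" "dim_col (Hblk S (Suc 0) 3) = m"
  "dim_row (Hblk S (Suc 0) 4) = p" "dim_col (Hblk S (Suc 0) 4) = q"
  "dim_row (Hblk S 2 2) = n" "dim_col (Hblk S 2 2) = n"
  "dim_row (Hblk S 2 3) = n" "dim_col (Hblk S 2 3) = m"
  "dim_row (Hblk S 2 4) = n" "dim_col (Hblk S 2 4) = q"
  "dim_row (Hblk S 3 3) = m" "dim_col (Hblk S 3 3) = m"
  "dim_row (Hblk S 3 4) = m" "dim_col (Hblk S 3 4) = q"
  "dim_row (Hblk S 4 4) = q" "dim_col (Hblk S 4 4) = q"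
  using Hblk_eq by simp_all

abbreviation "K \<equiv> blocks [[Hblk S 2 2, Hblk S 2 3, Hblk S 2 4],
                      [(Hblk S 2 3)\<^sup>T, Hblk S 3 3, Hblk S 3 4],
                      [(Hblk S 2 4)\<^sup>T, (Hblk S 3 4)\<^sup>T, Hblk S 4 4]]"

abbreviation "N12 \<equiv> vcat [(Hblk S 1 2)\<^sup>T, (Hblk S 1 3)\<^sup>T, (Hblk S 1 4)\<^sup>T]"

lemma dim_K [simp]: "dim_row K = n + (m + q)" "dim_col K = n + (m + q)" "dim_row N12 = n + (m + q)" "dim_col N12 = p"
  by (simp_all add: blocks_def)

lemma K_carrier: "K \<in> carrier_mat (n + (m + q)) (n + (m + q))"
  by (intro carrier_matI dim_K)

text \<open>The blocks with indices $2,3,4$ act as the single matrix \<open>K\<close>, whose inverse defines the centre of the consistent set.\<close>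

lemma Hmat_split:
  "bf (Hmat S) x y = bf (Hblk S 1 1) x y + bf N12 (sh p x) y + bf N12 (sh p y) x + bf K (sh p x) (sh p y)"
proof -
  have T: "bf (subblock (Hmat S) r c nr nc)\<^sup>T u v = bf (subblock (Hmat S) c r nc nr) u v"
    if "r + nr \<le> p + (n + (m + q))" "c + nc \<le> p + (n + (m + q))" for r c nr nc u v
  proof -
    have "(subblock (Hmat S) r c nr nc)\<^sup>T = subblock (Hmat S) c r nc nr"
      using that by (intro eq_matI) (auto simp: subblock_def Hmat_index_sym)
    then show ?thesis by simp
  qed
  have T': "bf N12 (sh p y) x = bf (hcat [Hblk S 1 2, Hblk S 1 3, Hblk S 1 4]) x (sh p y)"
    by (simp add: bf_transpose)
  show ?thesis
    unfolding T' 
    by (simp add: blocks_def Hblk_eq[unfolded One_nat_def] T bf_def[of "Hmat S"] sum_lessThan_add sum.distrib)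
       (simp add: bf_subblock sh_def add.assoc)
qed

end

lemma cat_mv_one [simp]: "cat k (mv (1\<^sub>m k) x) y = cat k x y"
  by (auto simp: cat_def fun_eq_iff mv_one)

lemma mv_one_mv [simp]: "dim_row A = k \<Longrightarrow> mv (1\<^sub>m k) (mv A x) = mv A x"
  using mv_mult[of "1\<^sub>m k" A x] by (simp add: left_mult_one_mat')

lemma mv_eq_0I: "dim_row A = k \<Longrightarrow> \<not> nz k (mv A x) \<Longrightarrow> mv A x = 0"
  by (auto simp: nz_def mv_def fun_eq_iff)

context data_driven
begin

lemma Hmat_cat:
  "bf (Hmat S) (cat p x w) (cat p x' w') =
    bf (Hblk S 1 1) x x' + bf N12 w x' + bf N12 w' x + bf K w w'"
  unfolding Hmat_split sh_cat using Hblk_eq(1) dim_K by simp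

lemma K_form: "bf K w w' = bf (Hmat S) (cat p 0 w) (cat p 0 w')"
  unfolding Hmat_cat by simp

lemma K_sym: "K\<^sup>T = K"
  by (subst sym_iff_bf) (simp_all only: dim_K K_form, metis Hmat_sym)

text \<open>$K$ is the congruence of $\Phi_{22}$ by the data matrix $\mathrm{col}(X_d,U,W)$, which has full row rank.\<close>

lemma K_neg:
  assumes "nz (n + (m + q)) w"
  shows "bf K w w < 0"
proof -
  have "mv Mdat\<^sup>T (cat p 0 w) = cat md 0 (- mv Dall\<^sup>T w)"
    unfolding mv_Mdat_T by simp
  moreover have "nz N (- mv Dall\<^sup>T w)" using Dall_inj[OF assms] by (simp add: nz_def)
  ultimately show ?thesis unfolding K_form bf_Hmat using Phi22_neg by simp
qed

lemma K_inj: "nz (n + (m + q)) w \<Longrightarrow> nz (n + (m + q)) (mv K w)"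
  using pd_inj[of "- K" "n + (m + q)" w] K_neg[of w] K_carrier
  by (simp add: bf_uminus mv_uminus nz_def)

lemma K_inv:
  "minv K \<in> carrier_mat (n + (m + q)) (n + (m + q))" "K * minv K = 1\<^sub>m (n + (m + q))"
  using minv_inverse[OF K_carrier] K_inj by blast+

lemma dim_minv_K [simp]: "dim_row (minv K) = n + (m + q)" "dim_col (minv K) = n + (m + q)"
  using K_inv(1) by blast+

lemma check_T_carrier: "check_T S \<in> carrier_mat (n + (m + q)) p"
  unfolding check_T_def using dim_K by (intro carrier_matI) (simp_all only: index_uminus_mat index_mult_mat dim_minv_K)

lemma dim_check_T [simp]: "dim_row (check_T S) = n + (m + q)" "dim_col (check_T S) = p"
  using check_T_carrier by auto

lemma dim_checks [simp]:
  "dim_row (As_check S) = p" "dim_col (As_check S) = n" "dim_row (Bu_check S) = p" "dim_col (Bu_check S) = m"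
  "dim_row (Bw_check S) = p" "dim_col (Bw_check S) = q"
  by (simp_all add: As_check_def Bu_check_def Bw_check_def)

lemma K_check_T: "mv K (mv (check_T S) x) = - mv N12 x"
proof -
  have "mv (check_T S) x = - mv (minv K) (mv N12 x)"
    unfolding check_T_def by (simp only: mv_uminus mv_mult dim_K dim_minv_K)
  then have "mv K (mv (check_T S) x) = - mv (K * minv K) (mv N12 x)"
    by (simp only: mv_minus mv_mult dim_K dim_minv_K)
  also have "\<dots> = - mv N12 x"
    unfolding K_inv(2) using dim_K(3) by (simp only: mv_one_mv)
  finally show ?thesis .
qed

abbreviation "Mcheck \<equiv> hcat [As_check S, Bu_check S, Bw_check S]"

lemma bf_Mcheck: "bf Mcheck x w = bf (check_T S) w x"
proof -
  have "bf (check_T S) w x = bf (subblock (check_T S) 0 0 n p) w x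
      + bf (subblock (check_T S) n 0 m p) (sh n w) x
      + bf (subblock (check_T S) (n + m) 0 q p) (sh m (sh n w)) x"
    by (simp add: bf_def subblock_def sum_lessThan_add sh_def add.assoc)
  then show ?thesis
    by (simp add: As_check_def Bu_check_def Bw_check_def bf_transpose)
qed

lemma Mcheck_T: "Mcheck\<^sup>T = check_T S"
  by (rule bf_eqI) (simp_all add: bf_transpose bf_Mcheck del: bf_hcat)

abbreviation "Rmat \<equiv> Xi * Lam * Xi\<^sup>T"

lemma Rmat_form:
  "bf Rmat x x' = bf (Hmat S) (cat p x (mv (check_T S) x)) (cat p x' (mv (check_T S) x'))"
proof -
  let ?R = "hcat [1\<^sub>m p, As_check S, Bu_check S, Bw_check S]"
  have R: "?R * Hmat S * ?R\<^sup>T = Rmat"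
    using fac by (simp add: Xi_Lambda_factorization_def Let_def)
  have "?R\<^sup>T = vcat [1\<^sub>m p, check_T S]"
    using bf_Mcheck by (intro bf_eqI) (simp_all add: bf_transpose bf_one_commute)
  then have "mv ?R\<^sup>T y = cat p y (mv (check_T S) y)" for y by simp
  then show ?thesis unfolding R[symmetric] by (subst bf_congruence) simp_all
qed

lemma Lam_facts: "Lam\<^sup>T = Lam" "nz pt x \<Longrightarrow> 0 < bf Lam x x"
  using fac pos_def_iff[OF plant_carriers(16)] by (simp_all add: Xi_Lambda_factorization_def)

text \<open>The form of $(I\ M) H (I\ M)^T$.\<close>

definition qmi where
  "qmi M x = bf (Hmat S) (cat p x (mv M\<^sup>T x)) (cat p x (mv M\<^sup>T x))"

text \<open>Completion of the square around the centre, where the cross term vanishes by \<open>K_check_T\<close>: the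
quadratic matrix inequality describes an ellipsoid.\<close>

lemma qmi_eq:
  assumes M: "M \<in> carrier_mat p (n + (m + q))"
  shows "qmi M x = bf Rmat x x - bf ((M - Mcheck) * (- K) * (M - Mcheck)\<^sup>T) x x"
proof -
  note [simp] = carrier_matD[OF M]
  define c where "c = mv (check_T S) x"
  define d where "d = mv (M - Mcheck)\<^sup>T x"
  have "(M - Mcheck)\<^sup>T = M\<^sup>T - check_T S"
    unfolding Mcheck_T[symmetric] by (rule bf_eqI) (simp_all add: bf_transpose bf_diff)
  then have w: "mv M\<^sup>T x = c + d" unfolding d_def c_def by (simp add: mv_diff)
  have cross: "bf K d c = - bf N12 d x"
    unfolding c_def bf_eq_dot K_check_T dim_K by (simp add: sum_negf)
  have "bf K c d = bf K d c" by (rule bf_sym[OF K_sym])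
  then have "qmi M x = bf Rmat x x + bf K d d"
    unfolding qmi_def w Rmat_form Hmat_cat c_def[symmetric] bf_add_left bf_add_right using cross by linarith
  moreover have "bf ((M - Mcheck) * (- K) * (M - Mcheck)\<^sup>T) x x = bf (- K) d d"
    unfolding d_def using dim_K by (intro bf_congruence) simp_all
  ultimately show ?thesis by (simp only: bf_uminus)
qed

lemma noise_bound_iff:
  assumes Wd: "Wd \<in> carrier_mat md N"
  shows "noise_bound S Wd \<longleftrightarrow> (\<forall>x. 0 \<le> bf (Phi S) (cat md x (mv Wd\<^sup>T x)) (cat md x (mv Wd\<^sup>T x)))"
proof -
  note [simp] = carrier_matD[OF Wd]
  let ?V = "vcat [1\<^sub>m md, Wd\<^sup>T]"
  have form: "bf (?V\<^sup>T * Phi S * ?V) x y = bf (Phi S) (cat md x (mv Wd\<^sup>T x)) (cat md y (mv Wd\<^sup>T y))" for x y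
    using bf_congruence[of "?V\<^sup>T" "Phi S" x y] by simp
  have c: "?V\<^sup>T * Phi S * ?V \<in> carrier_mat md md" by (intro carrier_matI) simp_all
  moreover have "(?V\<^sup>T * Phi S * ?V)\<^sup>T = ?V\<^sup>T * Phi S * ?V"
    by (subst sym_iff_bf) (simp_all add: form bf_sym[OF Phi_sym])
  ultimately show ?thesis unfolding noise_bound_def pos_semidef_iff[OF c] form by blast
qed

lemma Bd0_left_inverse:
  obtains Gi where "Gi \<in> carrier_mat md md" "Gi\<^sup>T = Gi" "\<And>x. mv (Bd0 S)\<^sup>T (mv (Bd0 S) (mv Gi x)) = mv (1\<^sub>m md) x"
proof -
  let ?G = "(Bd0 S)\<^sup>T * Bd0 S"
  have G: "?G \<in> carrier_mat md md" by (intro carrier_matI) simp_all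
  have form: "bf ?G x y = bf (1\<^sub>m p) (mv (Bd0 S) x) (mv (Bd0 S) y)" for x y
    by (simp add: bf_mult bf_mv_left bf_one_mv)
  have sym: "?G\<^sup>T = ?G" by (subst sym_iff_bf) (simp_all add: form bf_one_commute)
  have pd: "0 < bf ?G x x" if "nz md x" for x
    unfolding form bf_one_pos_iff using Bd0_inj[OF that] .
  have inv: "minv ?G \<in> carrier_mat md md" "?G * minv ?G = 1\<^sub>m md"
    using minv_inverse[OF G] pd_inj[OF G pd] by blast+
  have "mv (Bd0 S)\<^sup>T (mv (Bd0 S) (mv (minv ?G) x)) = mv (1\<^sub>m md) x" for x
    unfolding inv(2)[symmetric] using carrier_matD[OF inv(1)] by (simp add: mv_mult)
  then show ?thesis using that inv(1) minv_pos_def(1)[OF G sym pd] by blast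
qed

text \<open>If $F = Y - M\,\mathrm{col}(X_d,U,W)$ is the residual, the matrix inequality reads
$(B_{d0}\ F) \Phi (B_{d0}\ F)^T \succeq 0$. On $\ker B_{d0}^T$ it is governed by $\Phi_{22} \prec 0$ and forces $F^T v = 0$, hence
$F = B_{d0} W_d$ for some $W_d$; since $B_{d0}^T$ is onto, the noise bound for $W_d$ follows.\<close>

lemma consistent_iff_qmi:
  assumes c: "As \<in> carrier_mat p n" "Bu \<in> carrier_mat p m" "Bw \<in> carrier_mat p q"
  shows "(As, Bu, Bw) \<in> consistent_set S \<longleftrightarrow> (\<forall>x. 0 \<le> qmi (hcat [As, Bu, Bw]) x)"
proof -
  note [simp] = carrier_matD[OF c(1)] carrier_matD[OF c(2)] carrier_matD[OF c(3)]
  let ?M = "hcat [As, Bu, Bw]"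
  define Fm where "Fm = Ydat S - (As * Xd S + Bu * Udat S + Bw * Wdat S)"
  have Fd [simp]: "dim_row Fm = p" "dim_col Fm = N" by (simp_all add: Fm_def)
  have MT: "?M\<^sup>T = vcat [As\<^sup>T, Bu\<^sup>T, Bw\<^sup>T]"
    by (rule bf_eqI) (simp_all add: bf_transpose)
  have "bf Dall (mv ?M\<^sup>T x) y = bf As x (mv (Xd S) y) + bf Bu x (mv (Udat S) y) + bf Bw x (mv (Wdat S) y)" for x y
    unfolding MT by (simp add: bf_mv_transpose_left)
  then have "Fm\<^sup>T = (Ydat S)\<^sup>T - Dall\<^sup>T * ?M\<^sup>T"
    by (intro bf_eqI) (simp_all add: bf_transpose Fm_def bf_diff bf_plus bf_mult bf_mv_left del: bf_vcat bf_hcat)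
  then have FmT: "mv Fm\<^sup>T x = mv (Ydat S)\<^sup>T x - mv Dall\<^sup>T (mv ?M\<^sup>T x)" for x
    by (simp add: mv_diff mv_mult)
  have qmi: "qmi ?M x = bf (Phi S) (cat md (mv (Bd0 S)\<^sup>T x) (mv Fm\<^sup>T x)) (cat md (mv (Bd0 S)\<^sup>T x) (mv Fm\<^sup>T x))" for x
    unfolding qmi_def bf_Hmat mv_Mdat_T FmT by simp
  show ?thesis
  proof
    assume "(As, Bu, Bw) \<in> consistent_set S"
    then obtain Wd where Wd: "Wd \<in> carrier_mat md N" "noise_bound S Wd"
      and Y: "Ydat S = As * Xd S + Bu * Udat S + Bw * Wdat S + Bd0 S * Wd"
      unfolding consistent_set_def by blast
    note [simp] = carrier_matD[OF Wd(1)]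
    have "Fm\<^sup>T = Wd\<^sup>T * (Bd0 S)\<^sup>T"
      unfolding Fm_def Y by (intro bf_eqI) (simp_all add: bf_transpose bf_diff bf_plus bf_mult bf_mv_left)
    then have "mv Fm\<^sup>T x = mv Wd\<^sup>T (mv (Bd0 S)\<^sup>T x)" for x by (simp add: mv_mult)
    then show "\<forall>x. 0 \<le> qmi ?M x" unfolding qmi using Wd noise_bound_iff by metis
  next
    assume pos: "\<forall>x. 0 \<le> qmi ?M x"
    obtain Gi where Gi: "Gi \<in> carrier_mat md md" "Gi\<^sup>T = Gi"
      "\<And>x. mv (Bd0 S)\<^sup>T (mv (Bd0 S) (mv Gi x)) = mv (1\<^sub>m md) x"
      using Bd0_left_inverse by blast
    note [simp] = carrier_matD[OF Gi(1)]
    \<comment> \<open>The least-squares solution of \<open>Bd0 S * Wd = Fm\<close>, with \<open>Gi\<close> the inverse of \<open>(Bd0 S)\<^sup>T * Bd0 S\<close>.\<close>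
    define Wd where "Wd = Gi * (Bd0 S)\<^sup>T * Fm"
    have Wd: "Wd \<in> carrier_mat md N" by (intro carrier_matI) (simp_all add: Wd_def)
    note [simp] = carrier_matD[OF Wd]
    have F0: "mv Fm\<^sup>T v = 0" if "mv (Bd0 S)\<^sup>T v = 0" for v
    proof (rule ccontr)
      assume "mv Fm\<^sup>T v \<noteq> 0"
      then have "nz N (mv Fm\<^sup>T v)" using mv_eq_0I[of "Fm\<^sup>T" N v] by auto
      from Phi22_neg[OF this] have "qmi ?M v < 0" unfolding qmi that .
      then show False using pos by (metis not_le)
    qed
    have FT: "mv Fm\<^sup>T v = mv Fm\<^sup>T (mv (Bd0 S) (mv Gi (mv (Bd0 S)\<^sup>T v)))" for v
    proof -
      let ?u = "mv (Bd0 S) (mv Gi (mv (Bd0 S)\<^sup>T v))"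
      have "mv (Bd0 S)\<^sup>T (v + - ?u) = 0" unfolding mv_add mv_minus Gi(3) by simp
      then have "mv Fm\<^sup>T (v + - ?u) = 0" by (rule F0)
      then show ?thesis unfolding mv_add mv_minus by simp
    qed
    have Fm: "Fm = Bd0 S * Wd"
    proof (rule bf_eqI)
      fix x y
      have "bf Fm x y = bf Fm\<^sup>T y x" by (simp add: bf_transpose)
      also have "\<dots> = bf Fm\<^sup>T y (mv (Bd0 S) (mv Gi (mv (Bd0 S)\<^sup>T x)))"
        unfolding bf_eq_dot by (subst FT) simp
      also have "\<dots> = bf Fm (mv (Bd0 S) (mv Gi (mv (Bd0 S)\<^sup>T x))) y" by (simp add: bf_transpose)
      also have "\<dots> = bf (Bd0 S * Wd) x y"
        by (simp add: Wd_def bf_mv_left bf_mult mv_mult Gi(2))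
      finally show "bf Fm x y = bf (Bd0 S * Wd) x y" .
    qed simp_all
    have "noise_bound S Wd"
      unfolding noise_bound_iff[OF Wd]
    proof
      fix x
      let ?v = "mv (Bd0 S) (mv Gi x)"
      have "Fm\<^sup>T = Wd\<^sup>T * (Bd0 S)\<^sup>T"
        unfolding Fm by (intro bf_eqI) (simp_all add: bf_transpose bf_mult bf_mv_left)
      then have "mv Fm\<^sup>T ?v = mv Wd\<^sup>T x" using Gi(3) by (simp add: mv_mult)
      then show "0 \<le> bf (Phi S) (cat md x (mv Wd\<^sup>T x)) (cat md x (mv Wd\<^sup>T x))"
        using pos[rule_format, of ?v] unfolding qmi Gi(3) by simp
    qed
    moreover have "Ydat S = As * Xd S + Bu * Udat S + Bw * Wdat S + Bd0 S * Wd"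
      unfolding Fm[symmetric] Fm_def by (intro eq_matI) auto
    ultimately show "(As, Bu, Bw) \<in> consistent_set S"
      using c Wd unfolding consistent_set_def by blast
  qed
qed

end

section \<open>Closed loop and auxiliary matrices in reduced coordinates\<close>

lemma bf_minus_arg_right: "bf A x (u - v) = bf A x u - bf A x v"
  using bf_add_right[of A x u "- v"] by (simp add: bf_minus_right)

lemma mv_minus_arg: "mv A (u - v) = mv A u - mv A v"
  using mv_add[of A u "- v"] by (simp add: mv_minus)

lemma sh_sh [simp]: "sh a (sh b x) = sh (b + a) x"
  by (simp add: sh_def add.assoc)

lemma pos_def_2x2:
  assumes A: "A \<in> carrier_mat a a" "A\<^sup>T = A" and B: "B \<in> carrier_mat b a"
    and D: "D \<in> carrier_mat b b" "D\<^sup>T = D"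
  shows "pos_def (blocks [[A, B\<^sup>T], [B, D]]) \<longleftrightarrow>
    (\<forall>x y. nz a x \<or> nz b y \<longrightarrow> 0 < bf A x x + 2 * bf B y x + bf D y y)"
proof -
  note [simp] = carrier_matD[OF A(1)] carrier_matD[OF B] carrier_matD[OF D(1)]
  let ?T = "blocks [[A, B\<^sup>T], [B, D]]"
  have T: "?T \<in> carrier_mat (a + b) (a + b)" by (intro carrier_matI; simp add: blocks_def)
  have form: "bf ?T z z' = bf A z z' + bf B (sh a z') z + bf B (sh a z) z' + bf D (sh a z) (sh a z')" for z z'
    by (simp add: blocks_def bf_transpose)
  have sym: "?T\<^sup>T = ?T"
  proof -
    have "dim_row ?T = dim_col ?T" using T by simp
    then show ?thesis by (subst sym_iff_bf) (simp_all only: form bf_sym[OF A(2)] bf_sym[OF D(2)], simp add: algebra_simps bf_sym[OF A(2)] bf_sym[OF D(2)])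
  qed
  show ?thesis
    unfolding pos_def_iff[OF T] form nz_plus
  proof (intro iffI conjI sym allI impI)
    fix x y
    assume *: "?T\<^sup>T = ?T \<and> (\<forall>x. nz a x \<or> nz b (sh a x) \<longrightarrow>
      0 < bf A x x + bf B (sh a x) x + bf B (sh a x) x + bf D (sh a x) (sh a x))" and nz: "nz a x \<or> nz b y"
    from *[THEN conjunct2, rule_format, of "cat a x y"] nz
    show "0 < bf A x x + 2 * bf B y x + bf D y y" by simp
  next
    fix z
    assume *: "\<forall>x y. nz a x \<or> nz b y \<longrightarrow> 0 < bf A x x + 2 * bf B y x + bf D y y"
      and nz: "nz a z \<or> nz b (sh a z)"
    from *[rule_format, OF nz]
    show "0 < bf A z z + bf B (sh a z) z + bf B (sh a z) z + bf D (sh a z) (sh a z)" by simp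
  qed
qed

context data_driven
begin

lemma lag_pos: "1 \<le> lag S"
  using wf by (simp add: well_formed_def)

lemma p_le_dim_chi: "p \<le> dim_chi S"
  using lag_pos by (cases "lag S") (auto simp: dim_chi_def)

lemma dim_J [simp]:
  "dim_row (J_A S) = dim_chi S - p" "dim_col (J_A S) = dim_chi S"
  "dim_row (J_B S) = dim_chi S - p" "dim_col (J_B S) = m"
  "dim_row (J_B1 S) = dim_chi S - p" "dim_col (J_B1 S) = q"
proof -
  obtain l where l: "lag S = Suc l" using lag_pos by (cases "lag S") auto
  show "dim_row (J_A S) = dim_chi S - p" "dim_col (J_A S) = dim_chi S"
    "dim_row (J_B S) = dim_chi S - p" "dim_col (J_B S) = m"
    "dim_row (J_B1 S) = dim_chi S - p" "dim_col (J_B1 S) = q"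
    by (simp_all add: J_A_def J_B_def J_B1_def Let_def blocks_def dim_chi_def l algebra_simps)
qed

lemma dim_Xs1 [simp]: "dim_row (Xs1 S) = p" "dim_col (Xs1 S) = n"
  by (simp_all add: Xs1_def)

lemma mv_Xs1: "i < p \<Longrightarrow> mv (Xs1 S) x i = mv (svd_left S) x i"
  unfolding Xs1_def using mv_subblock_rows[of "svd_left S" n i p 0 x] p_le_dim_chi by simp

lemma Xs1_carrier: "Xs1 S \<in> carrier_mat p n" by (intro carrier_matI) simp_all

text \<open>The first rows of $X = X_s X_d$ are $X_{s1} X_d$, so a dependence among the rows of $X_{s1}$ would be one among the rows of $X$.\<close>

lemma Xs1_T_inj:
  assumes "nz p x"
  shows "nz n (mv (Xs1 S)\<^sup>T x)"
proof (rule ccontr)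
  assume not: "\<not> nz n (mv (Xs1 S)\<^sup>T x)"
  let ?R = "map (row (Xdat S)) [0..<p]"
  have indpt: "distinct ?R" "module.lin_indpt class_ring (module_vec TYPE(real) N) (set ?R)"
    using sa unfolding standing_assumptions_def Let_def by blast+
  define B where "B = mat_of_cols N ?R"
  have B: "B \<in> carrier_mat N p" unfolding B_def by (intro carrier_matI) simp_all
  have cols: "cols B = ?R"
    unfolding B_def by (rule cols_mat_of_cols) (auto intro!: carrier_vecI)
  have nzB: "nz N (mv B x)"
    by (rule indpt_cols_inj[OF B]) (simp_all only: cols indpt assms not_False_eq_True)
  have svd: "Xdat S = svd_left S * svd_vals S * (svd_right S)\<^sup>T"
    using wf unfolding well_formed_def compact_svd_def by blast
  have X: "bf (Xdat S) u v = bf (svd_left S) u (mv (Xd S) v)" for u v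
    unfolding svd by (simp add: bf_mult Xd_def mv_mult)
  have "bf (Xdat S) (cat p x 0) v = bf (Xs1 S) x (mv (Xd S) v)" for v
  proof -
    have d: "dim_chi S = p + (dim_chi S - p)" using p_le_dim_chi by simp
    have "bf (svd_left S) (cat p x 0) y = bf (Xs1 S) x y" for y
      using bf_row_split[of "svd_left S" p "dim_chi S - p" n "cat p x 0" y] d
      by (simp add: Xs1_def)
    then show ?thesis unfolding X .
  qed
  moreover have "bf (Xs1 S) x y = 0" for y
  proof -
    have "bf (Xs1 S) x y = bf (Xs1 S)\<^sup>T y x" by (simp add: bf_transpose)
    also have "\<dots> = 0" using not unfolding bf_eq_dot by (intro sum.neutral) (auto simp: nz_def)
    finally show ?thesis .
  qed
  ultimately have "bf (Xdat S) (cat p x 0) v = 0" for v by simp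
  moreover have "bf (Xdat S) (cat p x 0) v = bf B v x" for v
  proof -
    have "B = (subblock (Xdat S) 0 0 p N)\<^sup>T"
      using p_le_dim_chi by (intro eq_matI) (auto simp: B_def subblock_def mat_of_cols_index)
    moreover have "bf (Xdat S) (cat p x 0) v = bf (subblock (Xdat S) 0 0 p N) x v"
      using bf_row_split[of "Xdat S" p "dim_chi S - p" N "cat p x 0" v] p_le_dim_chi by simp
    ultimately show ?thesis by (simp add: bf_transpose)
  qed
  ultimately have "bf B (mv B x) x = 0" by metis
  moreover have "bf B (mv B x) x = bf (1\<^sub>m N) (mv B x) (mv B x)"
    using B by (intro bf_one_mv[symmetric]) auto
  ultimately show False using nzB bf_one_pos_iff[of N "mv B x"] by simp
qed

lemma p_le_n: "p \<le> n"
  using Xs1_T_inj Xs1_carrier by (intro inj_imp_le[of "(Xs1 S)\<^sup>T"]) auto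

abbreviation "Gram \<equiv> Xs1 S * (Xs1 S)\<^sup>T"

lemma Gram_inv: "minv Gram \<in> carrier_mat p p" "Gram * minv Gram = 1\<^sub>m p" "minv Gram * Gram = 1\<^sub>m p"
proof -
  have G: "Gram \<in> carrier_mat p p" by (intro carrier_matI) simp_all
  have "bf Gram x x = bf (1\<^sub>m n) (mv (Xs1 S)\<^sup>T x) (mv (Xs1 S)\<^sup>T x)" for x
    by (simp add: bf_mult bf_mv_left bf_one_mv)
  then have "nz p x \<Longrightarrow> nz p (mv Gram x)" for x
    using pd_inj[OF G, of x] Xs1_T_inj[of x] bf_one_pos_iff by metis
  then show "minv Gram \<in> carrier_mat p p" "Gram * minv Gram = 1\<^sub>m p" "minv Gram * Gram = 1\<^sub>m p"
    using minv_inverse[OF G] by blast+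
qed

lemma dim_Lmat [simp]: "dim_row (Lmat S L1) = n" "dim_col (Lmat S L1) = n"
  using p_le_n Gram_inv(1) by (simp_all add: Lmat_def)

lemma L1_kernel: "i < n - p \<Longrightarrow> Xs1 S *\<^sub>v row L1 i = 0\<^sub>v p"
proof -
  assume i: "i < n - p"
  interpret kernel p n "Xs1 S" by (unfold_locales) (rule Xs1_carrier)
  have "set (cols L1\<^sup>T) \<subseteq> mat_kernel (Xs1 S)"
    using kb unfolding kernel_basis_rows_def Ker.basis_def by blast
  moreover have "row L1 i \<in> set (cols L1\<^sup>T)"
    using i by (auto simp: rows_def)
  ultimately show ?thesis using mat_kernelD(2)[OF Xs1_carrier] by blast
qed

text \<open>$L$ is built such that $L X_{s1}^T = \mathrm{col}(0, I)$: the rows of $L_1$ span the kernel of $X_{s1}$, and $L_2$ is a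
left inverse of $X_{s1}^T$.\<close>

lemma Lmat_Xs1: "mv (Lmat S L1) (mv (Xs1 S)\<^sup>T x) = cat (n - p) 0 (mv (1\<^sub>m p) x)"
proof -
  have "L1 * (Xs1 S)\<^sup>T = 0\<^sub>m (n - p) p"
  proof (rule eq_matI)
    fix i j assume ij: "i < dim_row (0\<^sub>m (n - p) p)" "j < dim_col (0\<^sub>m (n - p) p)"
    then have "(L1 * (Xs1 S)\<^sup>T) $$ (i, j) = row (Xs1 S) j \<bullet> row L1 i"
      by (simp add: comm_scalar_prod[of _ n] row_def)
    also have "\<dots> = (Xs1 S *\<^sub>v row L1 i) $ j" using ij by simp
    finally show "(L1 * (Xs1 S)\<^sup>T) $$ (i, j) = 0\<^sub>m (n - p) p $$ (i, j)"
      using ij L1_kernel by simp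
  qed simp_all
  then have "mv L1 (mv (Xs1 S)\<^sup>T x) = 0"
    by (simp add: mv_mult[symmetric])
  moreover have "mv (minv Gram * Xs1 S) (mv (Xs1 S)\<^sup>T x) = mv (1\<^sub>m p) x"
    unfolding Gram_inv(3)[symmetric] using Gram_inv(1) by (simp add: mv_mult)
  ultimately show ?thesis using Gram_inv(1) by (simp add: Lmat_def)
qed

lemma Lmat_inj:
  assumes "nz n x"
  shows "nz n (mv (Lmat S L1) x)"
proof (rule ccontr)
  assume not: "\<not> nz n (mv (Lmat S L1) x)"
  have mvL: "mv (Lmat S L1) x = cat (n - p) (mv L1 x) (mv (minv Gram * Xs1 S) x)"
    using Gram_inv(1) by (simp add: Lmat_def)
  have "\<not> nz ((n - p) + p) (cat (n - p) (mv L1 x) (mv (minv Gram * Xs1 S) x))"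
    using not p_le_n unfolding mvL by simp
  then have z: "\<not> nz (n - p) (mv L1 x)" "\<not> nz p (mv (minv Gram * Xs1 S) x)"
    unfolding nz_plus nz_cat sh_cat by blast+
  have "mv (Xs1 S) x = mv (Gram * minv Gram) (mv (Xs1 S) x)"
    unfolding Gram_inv(2) by simp
  also have "\<dots> = mv Gram (mv (minv Gram * Xs1 S) x)"
    using Gram_inv(1) by (simp add: mv_mult)
  also have "\<dots> = 0" using z(2) by (intro not_nz_mv) simp
  finally have X0: "mv (Xs1 S) x = 0" .
  have "v \<bullet> vec n x = 0" if v: "v \<in> set (cols L1\<^sup>T)" for v
  proof -
    have "v \<in> row L1 ` {0..<n - p}" using v by (simp add: rows_def)
    then obtain i where i: "i < n - p" "v = row L1 i" by auto
    have "L1 *\<^sub>v vec n x = vec (n - p) (mv L1 x)" by (rule vec_mv[OF plant_carriers(17)])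
    then have "(L1 *\<^sub>v vec n x) $ i = mv L1 x i" using i by simp
    then have "row L1 i \<bullet> vec n x = mv L1 x i" using i by simp
    then show ?thesis using z(1) i by (auto simp: nz_def)
  qed
  then show False
    using kernel_basis_orthogonal[OF Xs1_carrier _ X0] kb assms unfolding kernel_basis_rows_def by blast
qed

text \<open>$(0\ M) = M (L X_{s1}^T)^T$, and the factor $L^T$ cancels.\<close>

lemma pad_L_eq:
  assumes M: "M \<in> carrier_mat r p"
  shows "pad_L S L1 M = M * Xs1 S"
proof -
  note [simp] = carrier_matD[OF M]
  have L: "Lmat S L1 \<in> carrier_mat n n" by (intro carrier_matI) simp_all
  have inv: "minv (Lmat S L1) \<in> carrier_mat n n" "minv (Lmat S L1) * Lmat S L1 = 1\<^sub>m n"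
    using minv_inverse[OF L] Lmat_inj by blast+
  note [simp] = carrier_matD[OF inv(1)]
  let ?Z = "hcat [0\<^sub>m r (n - p), M]"
  have Z: "?Z = M * Xs1 S * (Lmat S L1)\<^sup>T"
  proof (rule bf_eqI)
    fix x y
    have "bf (M * Xs1 S * (Lmat S L1)\<^sup>T) x y = bf (Lmat S L1) y (mv (Xs1 S)\<^sup>T (mv M\<^sup>T x))"
      using bf_chain[of M "Xs1 S" "(Lmat S L1)\<^sup>T" x y] by (simp add: bf_transpose)
    also have "\<dots> = bf (1\<^sub>m ((n - p) + p)) y (cat (n - p) 0 (mv (1\<^sub>m p) (mv M\<^sup>T x)))"
      unfolding Lmat_Xs1[symmetric] using p_le_n by (subst bf_one_mv) simp_all
    also have "\<dots> = bf (1\<^sub>m p) (sh (n - p) y) (mv M\<^sup>T x)"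
      unfolding bf_one sum_lessThan_add by (simp add: cat_def sh_def)
    also have "\<dots> = bf ?Z x y" by (simp add: bf_one_mv bf_transpose)
    finally show "bf ?Z x y = bf (M * Xs1 S * (Lmat S L1)\<^sup>T) x y" by simp
  qed (use p_le_n in simp_all)
  have "(Lmat S L1)\<^sup>T * (minv (Lmat S L1))\<^sup>T = 1\<^sub>m n"
    using transpose_mult[OF inv(1) L] inv(2) by simp
  then have "mv (Lmat S L1)\<^sup>T (mv (minv (Lmat S L1))\<^sup>T y) = mv (1\<^sub>m n) y" for y
    by (simp add: mv_mult[symmetric])
  then show ?thesis
    unfolding pad_L_def by (intro mv_eqI) (simp_all add: Z mv_mult del: mv_hcat)
qed

text \<open>The centre solves $K \check M^T = - H_{1\cdot}^T$, so the first block row is cancelled.\<close>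

lemma Hbar_zero: "Hbar_T S = 0\<^sub>m (n + (m + q)) p"
proof (rule bf_eqI)
  let ?A = "vcat [1\<^sub>m p, (As_check S)\<^sup>T, (Bu_check S)\<^sup>T, (Bw_check S)\<^sup>T]"
  have "(hcat [1\<^sub>m p, As_check S, Bu_check S, Bw_check S])\<^sup>T = ?A"
    by (rule bf_eqI) (simp_all add: bf_transpose bf_one_commute)
  have "vcat [(As_check S)\<^sup>T, (Bu_check S)\<^sup>T, (Bw_check S)\<^sup>T] = check_T S"
    unfolding Mcheck_T[symmetric] by (rule bf_eqI) (simp_all add: bf_transpose)
  then have A: "mv ?A y = cat p y (mv (check_T S) y)" for y by simp
  fix x y
  have "bf (Hbar_T S) x y = bf N12 x y + bf K x (mv (check_T S) y)"
    unfolding Hbar_T_def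
    by (simp add: blocks_def bf_mult A del: mv_vcat)
  also have "bf K x (mv (check_T S) y) = - bf N12 x y"
    unfolding bf_eq_dot K_check_T dim_K by (simp add: sum_negf)
  finally show "bf (Hbar_T S) x y = bf (0\<^sub>m (n + (m + q)) p) x y" by simp
qed (simp_all add: Hbar_T_def blocks_def)

lemma Hbar_blocks_zero:
  "Hbar12_T S = 0\<^sub>m n p" "Hbar13_T S = 0\<^sub>m m p" "Hbar14_T S = 0\<^sub>m q p"
  unfolding Hbar12_T_def Hbar13_T_def Hbar14_T_def Hbar_zero
  by (auto simp: subblock_def)

lemma pad_L_zero: "pad_L S L1 (- (al \<cdot>\<^sub>m 0\<^sub>m r p)) = 0\<^sub>m r n"
  by (subst pad_L_eq[of _ r]) (auto intro!: mv_eqI simp: mv_mult mv_uminus mv_smult smul_def fun_eq_iff)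

lemma pad_L_Xi: "pad_L S L1 (al \<cdot>\<^sub>m Xi\<^sup>T) = al \<cdot>\<^sub>m (Xi\<^sup>T * Xs1 S)"
  by (subst pad_L_eq[of _ pt]) (auto intro!: mv_eqI simp: mv_mult mv_smult)

lemma bf_reduced:
  assumes "dim_row T = p" "dim_row J = dim_chi S - p" "dim_col J = dim_col T"
  shows "bf ((svd_left S)\<^sup>T * vcat [T, J]) x y = bf (Xs1 S)\<^sup>T x (mv T y) + bf J (sh p (mv (svd_left S) x)) y"
proof -
  have "bf ((svd_left S)\<^sup>T * vcat [T, J]) x y = bf (svd_left S)\<^sup>T x (mv (vcat [T, J]) y)"
    using assms p_le_dim_chi by (intro bf_mult) simp
  also have "\<dots> = bf (vcat [T, J]) (mv (svd_left S) x) y"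
    using assms p_le_dim_chi by (intro bf_mv_left[symmetric]) simp
  also have "\<dots> = bf T (mv (svd_left S) x) y + bf J (sh p (mv (svd_left S) x)) y"
    using assms by simp
  also have "bf T (mv (svd_left S) x) y = bf T (mv (Xs1 S) x) y"
    by (rule bf_cong) (simp_all add: assms mv_Xs1)
  also have "\<dots> = bf (Xs1 S)\<^sup>T x (mv T y)" using assms by (intro bf_mv_left) simp
  finally show ?thesis .
qed

lemma dim_red [simp]:
  "dim_row (red_A S As) = n" "dim_row (red_B S Bu) = n" "dim_row (red_B1 S Bw) = n"
  "dim_col (red_A S As) = dim_col As" "dim_col (red_B S Bu) = dim_col Bu" "dim_col (red_B1 S Bw) = dim_col Bw"
  "dim_row (red_C S) = dim_yc S" "dim_col (red_C S) = n" "dim_row (red_C1 S) = dim_z S" "dim_col (red_C1 S) = n"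
  by (simp_all add: red_A_def red_B_def red_B1_def red_C_def red_C1_def)

lemma dim_check [simp]:
  "dim_row (A_check S) = n" "dim_col (A_check S) = n" "dim_row (B_check S) = n" "dim_col (B_check S) = m"
  "dim_row (B1_check S) = n" "dim_col (B1_check S) = q"
  by (simp_all add: A_check_def B_check_def B1_check_def)

lemma bf_red:
  "As \<in> carrier_mat p n \<Longrightarrow> bf (red_A S As) x y =
    bf (red_A S (As_check S)) x y + bf (Xs1 S)\<^sup>T x (mv As y) - bf (Xs1 S)\<^sup>T x (mv (As_check S) y)"
  "Bu \<in> carrier_mat p m \<Longrightarrow> bf (red_B S Bu) x y =
    bf (red_B S (Bu_check S)) x y + bf (Xs1 S)\<^sup>T x (mv Bu y) - bf (Xs1 S)\<^sup>T x (mv (Bu_check S) y)"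
  "Bw \<in> carrier_mat p q \<Longrightarrow> bf (red_B1 S Bw) x y =
    bf (red_B1 S (Bw_check S)) x y + bf (Xs1 S)\<^sup>T x (mv Bw y) - bf (Xs1 S)\<^sup>T x (mv (Bw_check S) y)"
  unfolding red_A_def red_B_def red_B1_def by (simp_all add: bf_reduced carrier_matD)

abbreviation "F0 \<equiv> vcat [(Xs1 S)\<^sup>T, 0\<^sub>m n p]"
abbreviation "G10 Cc Dc \<equiv> blocks [[1\<^sub>m n, 0\<^sub>m n n], [Dc * red_C S, Cc], [0\<^sub>m q n, 0\<^sub>m q n]]"
abbreviation "G20 \<equiv> vcat [0\<^sub>m n q, 0\<^sub>m m q, 1\<^sub>m q]"

text \<open>Only the first $p$ rows of the state equation are uncertain; in reduced coordinates they enter through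
$X_{s1}^T$, which is the factor \<open>F0\<close>.\<close>

lemma cl_uncertain:
  assumes c: "As \<in> carrier_mat p n" "Bu \<in> carrier_mat p m" "Bw \<in> carrier_mat p q"
    and ctrl: "Ac \<in> carrier_mat n n" "Bc \<in> carrier_mat n (dim_yc S)" "Cc \<in> carrier_mat m n"
      "Dc \<in> carrier_mat m (dim_yc S)"
  shows "cl_A S As Bu Ac Bc Cc Dc =
      cl_A S (As_check S) (Bu_check S) Ac Bc Cc Dc + F0 * (hcat [As, Bu, Bw] - Mcheck) * G10 Cc Dc"
    and "cl_B S Bw = cl_B S (Bw_check S) + F0 * (hcat [As, Bu, Bw] - Mcheck) * G20"
proof -
  note [simp] = carrier_matD[OF c(1)] carrier_matD[OF c(2)] carrier_matD[OF c(3)]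
    carrier_matD[OF ctrl(1)] carrier_matD[OF ctrl(2)] carrier_matD[OF ctrl(3)] carrier_matD[OF ctrl(4)]
  show "cl_A S As Bu Ac Bc Cc Dc =
      cl_A S (As_check S) (Bu_check S) Ac Bc Cc Dc + F0 * (hcat [As, Bu, Bw] - Mcheck) * G10 Cc Dc"
    by (rule bf_eqI)
       (simp_all add: cl_A_def blocks_def bf_mult bf_plus bf_red(1)[OF c(1)] bf_red(2)[OF c(2)]
         mv_mult mv_diff mv_add bf_add_right bf_minus_arg_right)
  show "cl_B S Bw = cl_B S (Bw_check S) + F0 * (hcat [As, Bu, Bw] - Mcheck) * G20"
    by (rule bf_eqI)
       (simp_all add: cl_B_def bf_mult bf_plus bf_red(3)[OF c(3)]
         mv_mult mv_diff mv_add bf_add_right bf_minus_arg_right)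
qed

end

section \<open>The Lyapunov matrix\<close>

lemma mv_outside: "dim_row A \<le> i \<Longrightarrow> mv A x i = 0"
  by (simp add: mv_def)

lemma mv_one_cat: "mv (1\<^sub>m (k + k')) x = cat k (mv (1\<^sub>m k) x) (mv (1\<^sub>m k') (sh k x))"
proof
  fix i show "mv (1\<^sub>m (k + k')) x i = cat k (mv (1\<^sub>m k) x) (mv (1\<^sub>m k') (sh k x)) i"
    by (cases "i < k + k'") (auto simp: cat_def mv_one sh_def mv_outside)
qed

lemma mv_four:
  assumes "dim_row A = r1 + r2" "dim_col A = c1 + c2"
  shows "mv A (cat c1 x y) = cat r1 (mv (subblock A 0 0 r1 c1) x + mv (subblock A 0 c1 r1 c2) y)
    (mv (subblock A r1 0 r2 c1) x + mv (subblock A r1 c1 r2 c2) y)"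
proof
  fix i
  have c: "(\<Sum>j<c1 + c2. A $$ (i, j) * cat c1 x y j) = (\<Sum>j<c1. A $$ (i, j) * x j) + (\<Sum>j<c2. A $$ (i, c1 + j) * y j)"
    unfolding sum_lessThan_add by (simp add: cat_def)
  show "mv A (cat c1 x y) i = cat r1 (mv (subblock A 0 0 r1 c1) x + mv (subblock A 0 c1 r1 c2) y)
    (mv (subblock A r1 0 r2 c1) x + mv (subblock A r1 c1 r2 c2) y) i"
    using c assms by (auto simp: mv_def cat_def[of r1] subblock_def)
qed

lemma cat_eq_iff:
  assumes "\<And>i. k \<le> i \<Longrightarrow> x i = 0" "\<And>i. k \<le> i \<Longrightarrow> x' i = 0"
  shows "cat k x y = cat k x' y' \<longleftrightarrow> x = x' \<and> y = y'"
proof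
  assume *: "cat k x y = cat k x' y'"
  have "x i = x' i" for i using fun_cong[OF *, of i] assms by (cases "i < k") (auto simp: cat_def)
  moreover have "y i = y' i" for i using fun_cong[OF *, of "k + i"] by (simp add: cat_def)
  ultimately show "x = x' \<and> y = y'" by auto
qed simp

text \<open>$X$ and $U$ are the first block row of $P^{-1}$. A vector in the kernel of $U^T$ would be mapped by $X$ into
the kernel of $V^T$, so $U$ is invertible together with $V$.\<close>

lemma lyapunov_partition:
  assumes P: "P \<in> carrier_mat (k + k) (k + k)" "P\<^sup>T = P" "\<And>x. nz (k + k) x \<Longrightarrow> 0 < bf P x x"
    and V_inj: "\<And>x. nz k x \<Longrightarrow> nz k (mv (subblock P 0 k k k)\<^sup>T x)"
  obtains X Y U Ui V where "X \<in> carrier_mat k k" "Y \<in> carrier_mat k k" "U \<in> carrier_mat k k"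
    "Ui \<in> carrier_mat k k" "V \<in> carrier_mat k k" "X\<^sup>T = X" "Y\<^sup>T = Y" "U * V\<^sup>T = 1\<^sub>m k - X * Y"
    "U\<^sup>T * Ui = 1\<^sub>m k" "Ui * U\<^sup>T = 1\<^sub>m k"
    "P * blocks [[X, 1\<^sub>m k], [U\<^sup>T, 0\<^sub>m k k]] = blocks [[1\<^sub>m k, Y], [0\<^sub>m k k, V\<^sup>T]]"
proof -
  have inv: "minv P \<in> carrier_mat (k + k) (k + k)" "P * minv P = 1\<^sub>m (k + k)" "minv P * P = 1\<^sub>m (k + k)"
    using minv_inverse[OF P(1)] pd_inj[OF P(1) P(3)] by blast+
  have Q_sym: "(minv P)\<^sup>T = minv P" using minv_pos_def(1)[OF P] .
  define Q where "Q = minv P"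
  note [simp] = carrier_matD[OF P(1)] carrier_matD[OF inv(1)[folded Q_def]]
  define X Y U V where "X = subblock Q 0 0 k k" "Y = subblock P 0 0 k k"
    "U = subblock Q 0 k k k" "V = subblock P 0 k k k"
  note defs = this
  have T: "subblock A k 0 k k = (subblock A 0 k k k)\<^sup>T" "(subblock A 0 0 k k)\<^sup>T = subblock A 0 0 k k"
    if "A\<^sup>T = A" "dim_row A = k + k" "dim_col A = k + k" for A
  proof -
    have "A $$ (i, j) = A $$ (j, i)" if "i < k + k" "j < k + k" for i j
      using \<open>A\<^sup>T = A\<close> \<open>dim_row A = k + k\<close> \<open>dim_col A = k + k\<close> that
      by (metis index_transpose_mat(1))
    then show "subblock A k 0 k k = (subblock A 0 k k k)\<^sup>T" "(subblock A 0 0 k k)\<^sup>T = subblock A 0 0 k k"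
      by (auto simp: subblock_def)
  qed
  have dims [simp]: "dim_row X = k" "dim_col X = k" "dim_row Y = k" "dim_col Y = k"
    "dim_row U = k" "dim_col U = k" "dim_row V = k" "dim_col V = k"
    by (simp_all add: defs)
  have Pmv: "mv P (cat k x 0) = cat k (mv Y x) (mv V\<^sup>T x)" for x
    using mv_four[of P k k k k x 0] T(1)[OF P(2)] by (simp add: defs)
  have Qmv: "mv Q (cat k x y) = cat k (mv X x + mv U y) (mv U\<^sup>T x + mv (subblock Q k k k k) y)" for x y
    using mv_four[of Q k k k k x y] T(1)[of Q] Q_sym by (simp add: defs Q_def[symmetric])
  have PQ: "mv P (mv Q x) = mv (1\<^sub>m (k + k)) x" for x
    using inv(2)[folded Q_def] by (simp add: mv_mult[symmetric])
  have QP: "mv Q (mv P x) = mv (1\<^sub>m (k + k)) x" for x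
    using inv(3)[folded Q_def] by (simp add: mv_mult[symmetric])
  have one: "mv (1\<^sub>m (k + k)) (cat k x 0) = cat k (mv (1\<^sub>m k) x) 0" for x
    unfolding mv_one_cat by simp
  have "mv X (mv Y x) + mv U (mv V\<^sup>T x) = mv (1\<^sub>m k) x" for x
    using QP[of "cat k x 0"] unfolding Pmv Qmv one
    by (subst (asm) cat_eq_iff) (auto simp: mv_outside)
  then have XYUV: "mv U (mv V\<^sup>T x) = mv (1\<^sub>m k) x - mv X (mv Y x)" for x
    by (metis add_diff_cancel_left')
  have UV: "U * V\<^sup>T = 1\<^sub>m k - X * Y"
    by (rule mv_eqI) (simp_all add: mv_mult mv_diff XYUV)
  have U_inj: "nz k (mv U\<^sup>T x)" if x: "nz k x" for x
  proof (rule ccontr)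
    assume "\<not> nz k (mv U\<^sup>T x)"
    then have "mv U\<^sup>T x = 0" by (intro mv_eq_0I) simp_all
    then have "mv P (cat k (mv X x) 0) = mv P (mv Q (cat k x 0))" unfolding Qmv by simp
    then have "cat k (mv Y (mv X x)) (mv V\<^sup>T (mv X x)) = cat k (mv (1\<^sub>m k) x) 0"
      unfolding Pmv PQ one .
    then have eq: "mv Y (mv X x) = mv (1\<^sub>m k) x" "mv V\<^sup>T (mv X x) = 0"
      by (subst (asm) cat_eq_iff; auto simp: mv_outside)+
    have "\<not> nz k (mv X x)"
      using V_inj[of "mv X x"] eq(2) unfolding defs(4)[symmetric] by (auto simp: nz_def)
    then have "mv Y (mv X x) = 0" by (intro not_nz_mv) simp
    then show False using eq(1) x mv_one[of _ k x] by (auto simp: nz_def fun_eq_iff)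
  qed
  have Uc: "U\<^sup>T \<in> carrier_mat k k" by (intro carrier_matI) simp_all
  have Ui: "minv U\<^sup>T \<in> carrier_mat k k" "U\<^sup>T * minv U\<^sup>T = 1\<^sub>m k" "minv U\<^sup>T * U\<^sup>T = 1\<^sub>m k"
    using minv_inverse[OF Uc] U_inj by blast+
  have PT: "P * blocks [[X, 1\<^sub>m k], [U\<^sup>T, 0\<^sub>m k k]] = blocks [[1\<^sub>m k, Y], [0\<^sub>m k k, V\<^sup>T]]"
  proof (rule mv_eqI)
    fix s
    have "mv (blocks [[X, 1\<^sub>m k], [U\<^sup>T, 0\<^sub>m k k]]) s = cat k (mv X s) (mv U\<^sup>T s) + cat k (mv (1\<^sub>m k) (sh k s)) 0"
      by (simp add: blocks_def) (auto simp: cat_def fun_eq_iff mv_one)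
    also have "cat k (mv X s) (mv U\<^sup>T s) = mv Q (cat k s 0)" unfolding Qmv by simp
    finally have T1: "mv (blocks [[X, 1\<^sub>m k], [U\<^sup>T, 0\<^sub>m k k]]) s =
        mv Q (cat k s 0) + cat k (mv (1\<^sub>m k) (sh k s)) 0" .
    have "mv (P * blocks [[X, 1\<^sub>m k], [U\<^sup>T, 0\<^sub>m k k]]) s = mv P (mv (blocks [[X, 1\<^sub>m k], [U\<^sup>T, 0\<^sub>m k k]]) s)"
      by (rule mv_mult) (simp add: blocks_def)
    also have "\<dots> = cat k (mv (1\<^sub>m k) s) 0 + cat k (mv Y (sh k s)) (mv V\<^sup>T (sh k s))"
      unfolding T1 mv_add PQ one Pmv by simp
    also have "\<dots> = mv (blocks [[1\<^sub>m k, Y], [0\<^sub>m k k, V\<^sup>T]]) s"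
      by (simp add: blocks_def) (auto simp: cat_def fun_eq_iff mv_one)
    finally show "mv (P * blocks [[X, 1\<^sub>m k], [U\<^sup>T, 0\<^sub>m k k]]) s = mv (blocks [[1\<^sub>m k, Y], [0\<^sub>m k k, V\<^sup>T]]) s" .
  qed (simp_all add: blocks_def)
  have c: "X \<in> carrier_mat k k" "Y \<in> carrier_mat k k" "U \<in> carrier_mat k k" "V \<in> carrier_mat k k"
    by (intro carrier_matI dims)+
  have "Q\<^sup>T = Q" unfolding Q_def by (rule Q_sym)
  then have "X\<^sup>T = X" unfolding defs by (rule T(2)) simp_all
  moreover have "Y\<^sup>T = Y" unfolding defs by (rule T(2)[OF P(2)]) simp_all
  ultimately show ?thesis
    using that c UV Ui PT by blast
qed

text \<open>$P = T_2 T_1^{-1}$. It is symmetric because $T_1^T T_2$ has the blocks $X, I, I, Y$.\<close>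

lemma lyapunov_construction:
  assumes c: "X \<in> carrier_mat k k" "Y \<in> carrier_mat k k" "U \<in> carrier_mat k k" "Ui \<in> carrier_mat k k" "V \<in> carrier_mat k k"
    and sym: "X\<^sup>T = X" "Y\<^sup>T = Y" and UV: "U * V\<^sup>T = 1\<^sub>m k - X * Y"
    and Ui: "U\<^sup>T * Ui = 1\<^sub>m k" "Ui * U\<^sup>T = 1\<^sub>m k"
  obtains P where "P \<in> carrier_mat (k + k) (k + k)" "P\<^sup>T = P"
    "P * blocks [[X, 1\<^sub>m k], [U\<^sup>T, 0\<^sub>m k k]] = blocks [[1\<^sub>m k, Y], [0\<^sub>m k k, V\<^sup>T]]"
proof -
  note [simp] = carrier_matD[OF c(1)] carrier_matD[OF c(2)] carrier_matD[OF c(3)] carrier_matD[OF c(4)]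
    carrier_matD[OF c(5)]
  define T1 where "T1 = blocks [[X, 1\<^sub>m k], [U\<^sup>T, 0\<^sub>m k k]]"
  define T2 where "T2 = blocks [[1\<^sub>m k, Y], [0\<^sub>m k k, V\<^sup>T]]"
  define Ti where "Ti = blocks [[0\<^sub>m k k, Ui], [1\<^sub>m k, - (X * Ui)]]"
  have [simp]: "dim_row T1 = k + k" "dim_col T1 = k + k" "dim_row T2 = k + k" "dim_col T2 = k + k"
    "dim_row Ti = k + k" "dim_col Ti = k + k"
    by (simp_all add: T1_def T2_def Ti_def blocks_def)
  have mvT1: "mv T1 s = cat k (mv X s + mv (1\<^sub>m k) (sh k s)) (mv U\<^sup>T s)" for s
    by (simp add: T1_def blocks_def)
  have mvT2: "mv T2 s = cat k (mv (1\<^sub>m k) s + mv Y (sh k s)) (mv V\<^sup>T (sh k s))" for s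
    by (simp add: T2_def blocks_def)
  have mvTi: "mv Ti s = cat k (mv Ui (sh k s)) (mv (1\<^sub>m k) s - mv X (mv Ui (sh k s)))" for s
    by (simp add: Ti_def blocks_def mv_uminus mv_mult)
  have UiU: "mv Ui (mv U\<^sup>T x) = mv (1\<^sub>m k) x" "mv U\<^sup>T (mv Ui x) = mv (1\<^sub>m k) x" for x
    using Ui by (simp_all add: mv_mult[symmetric])
  have TiT1: "mv Ti (mv T1 s) = mv (1\<^sub>m (k + k)) s" for s
    unfolding mvT1 mvTi sh_cat UiU mv_one_cat by (simp add: mv_add)
  have T1Ti: "mv T1 (mv Ti s) = mv (1\<^sub>m (k + k)) s" for s
    unfolding mvT1 mvTi sh_cat mv_one_cat by (simp add: mv_minus_arg UiU)
  let ?P = "T2 * Ti"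
  have "bf ?P x y = bf T2 x (mv Ti y)" for x y by (simp add: bf_mult)
  moreover have "bf T2 x z = bf T2 (mv T1 (mv Ti x)) z" for x z unfolding T1Ti by simp
  moreover have "bf T2 (mv T1 u) v = bf T1 (mv T2 v) u" for u v
    by (subst bf_mv_left) (simp_all only: bf_transpose, simp)
  moreover have "bf T1 (mv T2 v) u = bf X v u + bf (1\<^sub>m k) u (sh k v) + bf (1\<^sub>m k) v (sh k u) + bf Y (sh k v) (sh k u)" for u v
  proof -
    have "bf T1 (mv T2 v) u = bf X (mv (1\<^sub>m k) v + mv Y (sh k v)) u + bf (1\<^sub>m k) (mv (1\<^sub>m k) v + mv Y (sh k v)) (sh k u)
        + bf U\<^sup>T (mv V\<^sup>T (sh k v)) u"
      unfolding mvT2 by (simp add: T1_def blocks_def)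
    moreover have "bf U\<^sup>T (mv V\<^sup>T (sh k v)) u = bf (1\<^sub>m k) u (sh k v) - bf X u (mv Y (sh k v))"
    proof -
      have "bf U\<^sup>T (mv V\<^sup>T (sh k v)) u = bf (U * V\<^sup>T) u (sh k v)" by (simp add: bf_transpose bf_mult)
      then show ?thesis unfolding UV by (simp add: bf_diff bf_mult)
    qed
    moreover have "bf X (mv Y (sh k v)) u = bf X u (mv Y (sh k v))" by (rule bf_sym[OF sym(1)])
    ultimately show ?thesis
      by (simp add: bf_add_left) (simp add: bf_mv_left sym(2))
  qed
  ultimately have form: "bf ?P x y = bf X (mv Ti y) (mv Ti x) + bf (1\<^sub>m k) (mv Ti x) (sh k (mv Ti y))
      + bf (1\<^sub>m k) (mv Ti y) (sh k (mv Ti x)) + bf Y (sh k (mv Ti y)) (sh k (mv Ti x))" for x y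
    by simp
  have "?P\<^sup>T = ?P"
    by (subst sym_iff_bf) (simp_all add: form bf_sym[OF sym(1)] bf_sym[OF sym(2)])
  moreover have "?P * T1 = T2"
    by (rule mv_eqI) (simp_all add: mv_mult TiT1)
  moreover have "?P \<in> carrier_mat (k + k) (k + k)" by (intro carrier_matI) simp_all
  ultimately show ?thesis using that unfolding T1_def T2_def by blast
qed

lemma finite_singular_shifts:
  assumes A: "A \<in> carrier_mat k k"
  shows "finite {s. \<exists>x. nz k x \<and> \<not> nz k (mv (A + s \<cdot>\<^sub>m 1\<^sub>m k) x)}"
proof -
  note [simp] = carrier_matD[OF A]
  have "char_poly A \<noteq> 0" using degree_monic_char_poly[OF A] by auto
  then have fin: "finite {e. poly (char_poly A) e = 0}" by (rule poly_roots_finite)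
  have "eigenvalue A (- s)" if x: "nz k x" "\<not> nz k (mv (A + s \<cdot>\<^sub>m 1\<^sub>m k) x)" for s x
  proof -
    have "mv A x i = - s * x i" if "i < k" for i
      using x(2) that by (auto simp: nz_def mv_plus mv_smult smul_def mv_one)
    then have "A *\<^sub>v vec k x = - s \<cdot>\<^sub>v vec k x"
      unfolding vec_mv[OF A] by (intro eq_vecI) auto
    moreover have "vec k x \<noteq> 0\<^sub>v k" using x(1) nz_vec' by blast
    ultimately show ?thesis unfolding eigenvalue_def eigenvector_def by (intro exI[of _ "vec k x"]) auto
  qed
  then have "{s. \<exists>x. nz k x \<and> \<not> nz k (mv (A + s \<cdot>\<^sub>m 1\<^sub>m k) x)} \<subseteq> uminus ` {e. poly (char_poly A) e = 0}"
    using eigenvalue_root_char_poly[OF A] by (force simp: image_iff)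
  then show ?thesis using fin finite_surj by blast
qed

text \<open>The singular shifts are, up to sign, eigenvalues and therefore finitely many.\<close>

lemma regular_shift:
  assumes "A \<in> carrier_mat k k" "0 < t"
  obtains s where "0 < s" "s \<le> t" "\<And>x. nz k x \<Longrightarrow> nz k (mv (A + s \<cdot>\<^sub>m 1\<^sub>m k) x)"
proof -
  have "infinite {0<..t}" using assms(2) by simp
  then have "\<not> {0<..t} \<subseteq> {s. \<exists>x. nz k x \<and> \<not> nz k (mv (A + s \<cdot>\<^sub>m 1\<^sub>m k) x)}"
    using finite_singular_shifts[OF assms(1)] finite_subset by blast
  then obtain s where "s \<in> {0<..t}" "\<not> (\<exists>x. nz k x \<and> \<not> nz k (mv (A + s \<cdot>\<^sub>m 1\<^sub>m k) x))" by blast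
  then show ?thesis using that[of s] by auto
qed

section \<open>The synthesis inequalities as quadratic forms\<close>

context data_driven
begin

definition controller where
  "controller Ac Bc Cc Dc \<longleftrightarrow> Ac \<in> carrier_mat n n \<and> Bc \<in> carrier_mat n (dim_yc S) \<and>
     Cc \<in> carrier_mat m n \<and> Dc \<in> carrier_mat m (dim_yc S)"

lemma controllerD:
  assumes "controller Ac Bc Cc Dc"
  shows "dim_row Ac = n" "dim_col Ac = n" "dim_row Bc = n" "dim_col Bc = dim_yc S"
    "dim_row Cc = m" "dim_col Cc = n" "dim_row Dc = m" "dim_col Dc = dim_yc S"
  using assms unfolding controller_def by blast+

lemma dim_cl:
  assumes "controller Ac Bc Cc Dc" "dim_col As = n" "dim_col Bw = q"
  shows "dim_row (cl_A S As Bu Ac Bc Cc Dc) = n + n" "dim_col (cl_A S As Bu Ac Bc Cc Dc) = n + n"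
    "dim_row (cl_B S Bw) = n + n" "dim_col (cl_B S Bw) = q"
    "dim_row (cl_C S Cc Dc) = dim_z S" "dim_col (cl_C S Cc Dc) = n + n"
  using controllerD[OF assms(1)] assms(2,3) by (simp_all add: cl_A_def cl_B_def cl_C_def blocks_def)

lemma H2_ineqs_iff:
  assumes ctrl: "controller Ac Bc Cc Dc" and c: "As \<in> carrier_mat p n" "Bw \<in> carrier_mat p q"
    and P: "P \<in> carrier_mat (n + n) (n + n)" "P\<^sup>T = P" and Z: "Z \<in> carrier_mat (dim_z S) (dim_z S)" "Z\<^sup>T = Z"
  shows "H2_ineqs S mu As Bu Bw Ac Bc Cc Dc P Z \<longleftrightarrow> mtrace Z < mu\<^sup>2 \<and>
    (\<forall>b c. nz q b \<or> nz (n + n) c \<longrightarrow> 0 < bf (1\<^sub>m q) b b + 2 * bf (cl_B S Bw) c b + bf P c c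
       - bf P (mv (cl_A S As Bu Ac Bc Cc Dc)\<^sup>T c) (mv (cl_A S As Bu Ac Bc Cc Dc)\<^sup>T c)) \<and>
    (\<forall>z a. nz (dim_z S) z \<or> nz (n + n) a \<longrightarrow>
       0 < bf (Z - D1mat S * (D1mat S)\<^sup>T) z z + 2 * bf (cl_C S Cc Dc) z (mv P a) + bf P a a)"
proof -
  note [simp] = carrier_matD[OF P(1)] carrier_matD[OF Z(1)]
  let ?A = "cl_A S As Bu Ac Bc Cc Dc" and ?B = "cl_B S Bw" and ?C = "cl_C S Cc Dc" and ?D = "D1mat S"
  note [simp] = dim_cl[OF ctrl carrier_matD(2)[OF c(1)] carrier_matD(2)[OF c(2)]]
  have D: "bf (P - ?A * P * ?A\<^sup>T) x y = bf P x y - bf P (mv ?A\<^sup>T x) (mv ?A\<^sup>T y)" for x y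
    by (simp add: bf_diff bf_congruence)
  have 1: "pos_def (blocks [[1\<^sub>m q, ?B\<^sup>T], [?B, P - ?A * P * ?A\<^sup>T]]) \<longleftrightarrow>
    (\<forall>x y. nz q x \<or> nz (n + n) y \<longrightarrow> 0 < bf (1\<^sub>m q) x x + 2 * bf ?B y x + bf (P - ?A * P * ?A\<^sup>T) y y)"
  proof (rule pos_def_2x2)
    show "(P - ?A * P * ?A\<^sup>T)\<^sup>T = P - ?A * P * ?A\<^sup>T"
      by (subst sym_iff_bf) (simp_all add: D bf_sym[OF P(2)])
  qed (auto intro!: carrier_matI)
  have CP: "?C * P = (P * ?C\<^sup>T)\<^sup>T"
  proof (rule bf_eqI)
    fix x y
    have "bf (P * ?C\<^sup>T) y x = bf P (mv ?C\<^sup>T x) y" by (simp add: bf_mult bf_sym[OF P(2), of y])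
    then show "bf (?C * P) x y = bf (P * ?C\<^sup>T)\<^sup>T x y"
      by (simp add: bf_transpose bf_mult bf_mv_transpose_left)
  qed simp_all
  have PC: "bf (P * ?C\<^sup>T) a z = bf ?C z (mv P a)" for a z
  proof -
    have "bf (?C * P) z a = bf (P * ?C\<^sup>T) a z" unfolding CP by (rule bf_transpose)
    then show ?thesis by (simp add: bf_mult)
  qed
  have E: "bf (Z - ?D * ?D\<^sup>T) x y = bf Z x y - bf (1\<^sub>m q) (mv ?D\<^sup>T x) (mv ?D\<^sup>T y)" for x y
    by (simp add: bf_diff bf_mult bf_mv_left bf_one_mv)
  have 2: "pos_def (blocks [[Z - ?D * ?D\<^sup>T, (P * ?C\<^sup>T)\<^sup>T], [P * ?C\<^sup>T, P]]) \<longleftrightarrow>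
    (\<forall>x y. nz (dim_z S) x \<or> nz (n + n) y \<longrightarrow> 0 < bf (Z - ?D * ?D\<^sup>T) x x + 2 * bf (P * ?C\<^sup>T) y x + bf P y y)"
  proof (rule pos_def_2x2)
    show "(Z - ?D * ?D\<^sup>T)\<^sup>T = Z - ?D * ?D\<^sup>T"
      by (subst sym_iff_bf) (simp_all add: E bf_sym[OF Z(2)] bf_one_commute)
  qed (use P in \<open>auto intro!: carrier_matI\<close>)
  show ?thesis
    unfolding H2_ineqs_def Let_def cl_D_def CP 1 2 D PC by (simp add: algebra_simps)
qed

lemma uncertain:
  assumes ctrl: "controller Ac Bc Cc Dc"
  shows "uncertain_system (n + n) q p (n + (m + q)) (cl_A S (As_check S) (Bu_check S) Ac Bc Cc Dc)
    (cl_B S (Bw_check S)) F0 (G10 Cc Dc) G20 Rmat (- K)"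
proof
  note [simp] = controllerD[OF ctrl]
  note cl = dim_cl[OF ctrl dim_checks(2) dim_checks(6)]
  show "cl_A S (As_check S) (Bu_check S) Ac Bc Cc Dc \<in> carrier_mat (n + n) (n + n)"
    "cl_B S (Bw_check S) \<in> carrier_mat (n + n) q"
    by (intro carrier_matI cl)+
  show "F0 \<in> carrier_mat (n + n) p" "G10 Cc Dc \<in> carrier_mat (n + (m + q)) (n + n)"
    "G20 \<in> carrier_mat (n + (m + q)) q" "Rmat \<in> carrier_mat p p"
    by (intro carrier_matI; simp add: blocks_def)+
  show "- K \<in> carrier_mat (n + (m + q)) (n + (m + q))" using K_carrier by (rule uminus_carrier_mat)
  show "Rmat\<^sup>T = Rmat" by (subst sym_iff_bf) (simp, simp only: Rmat_form, metis Hmat_sym)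
  have Lam_psd: "0 \<le> bf Lam x x" for x
    using Lam_facts(2)[of x] not_nz_bf(1)[of Lam x x] by (cases "nz pt x") auto
  show "0 \<le> bf Rmat x x" for x using Lam_psd by (subst bf_congruence) simp_all
  show "(- K)\<^sup>T = - K"
    using bf_sym[OF K_sym] by (subst sym_iff_bf) (simp_all only: dim_K index_uminus_mat bf_uminus, simp)
  show "0 < bf (- K) w w" if "nz (n + (m + q)) w" for w
    using K_neg[OF that] by (simp only: bf_uminus)
qed

end

locale design = data_driven S pt Xi Lam L1 +
  feedback "ntil S" "dim_u S" "dim_w S" "dim_y S" pt "dim_yc S" "A_check S" "B_check S" "B1_check S"
    "red_C S" "Xs1 S" "blocks [[Hblk S 2 2, Hblk S 2 3, Hblk S 2 4],
                      [(Hblk S 2 3)\<^sup>T, Hblk S 3 3, Hblk S 3 4],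
                      [(Hblk S 2 4)\<^sup>T, (Hblk S 3 4)\<^sup>T, Hblk S 4 4]]"
    Xi Lam "minv Lam" X Y U Ui V P Ac Bc Cc Dc Atc Btc Ctc
  for S pt Xi Lam L1 X Y U Ui V P Ac Bc Cc Dc Atc Btc Ctc
begin

text \<open>The padded blocks built from $\bar H$ vanish, and the one built from $\Xi$ is $\alpha \Xi^T X_{s1}$.\<close>

lemma Pi22_eq:
  "Pi22 S pt Xi Lam L1 al X Y =
    (let G5 = al \<cdot>\<^sub>m (Xi\<^sup>T * Xs1 S); h = (\<lambda>i j. - (al \<cdot>\<^sub>m Hblk S i j)) in blocks
     [[Y, 1\<^sub>m n, (0\<^sub>m n n)\<^sup>T, (0\<^sub>m m n)\<^sup>T, (0\<^sub>m q n)\<^sup>T, G5\<^sup>T],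
      [1\<^sub>m n, X, (0\<^sub>m n n * X)\<^sup>T, (0\<^sub>m m n * X)\<^sup>T, (0\<^sub>m q n * X)\<^sup>T, (G5 * X)\<^sup>T],
      [0\<^sub>m n n, 0\<^sub>m n n * X, h 2 2, h 2 3, h 2 4, 0\<^sub>m n pt],
      [0\<^sub>m m n, 0\<^sub>m m n * X, (h 2 3)\<^sup>T, h 3 3, h 3 4, 0\<^sub>m m pt],
      [0\<^sub>m q n, 0\<^sub>m q n * X, (h 2 4)\<^sup>T, (h 3 4)\<^sup>T, h 4 4, 0\<^sub>m q pt],
      [G5, G5 * X, 0\<^sub>m pt n, 0\<^sub>m pt m, 0\<^sub>m pt q, al \<cdot>\<^sub>m minv Lam]])"
  unfolding Pi22_def Let_def Hbar_blocks_zero pad_L_zero pad_L_Xi ..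

lemma dim_Pi:
  "dim_row (Pi11 S X Y) = n + (n + q)" "dim_col (Pi11 S X Y) = n + (n + q)"
  "dim_row (Pi12_T S pt X Y Atc Btc Ctc Dc) = n + (n + (n + (m + (q + pt))))"
  "dim_col (Pi12_T S pt X Y Atc Btc Ctc Dc) = n + (n + q)"
  "dim_row (Pi22 S pt Xi Lam L1 al X Y) = n + (n + (n + (m + (q + pt))))"
  "dim_col (Pi22 S pt Xi Lam L1 al X Y) = n + (n + (n + (m + (q + pt))))"
  unfolding Pi22_eq by (simp_all add: Pi11_def Pi12_T_def Let_def blocks_def)

lemma Pi11_form:
  "bf (Pi11 S X Y) x x' = bf X x x' + bf (1\<^sub>m n) x (sh n x') + bf (1\<^sub>m n) (sh n x) x'
     + bf Y (sh n x) (sh n x') + bf (1\<^sub>m q) (sh n (sh n x)) (sh n (sh n x'))"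
  by (simp add: Pi11_def Let_def blocks_def)

lemma Pi12_form:
  "bf (Pi12_T S pt X Y Atc Btc Ctc Dc) y x =
     bf (A_check S + B_check S * Dc * red_C S) y x + bf (A_check S * Y + B_check S * Ctc) y (sh n x)
      + bf (B1_check S) y (sh n (sh n x)) + bf (X * A_check S + Btc * red_C S) (sh n y) x
      + bf Atc (sh n y) (sh n x) + bf (X * B1_check S) (sh n y) (sh n (sh n x))
      + (let w = sh n (sh n y) in bf (1\<^sub>m n) w x + bf Y w (sh n x) + bf (Dc * red_C S) (sh n w) x
        + bf Ctc (sh n w) (sh n x) + bf (1\<^sub>m q) (sh m (sh n w)) (sh n (sh n x)))"
  by (simp add: Pi12_T_def Let_def blocks_def add.assoc)

lemma Pi22_form:
  "bf (Pi22 S pt Xi Lam L1 al X Y) y y' =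
    (let w = sh n (sh n y); v = sh (n + (m + q)) w; w' = sh n (sh n y'); v' = sh (n + (m + q)) w' in
      bf Y y y' + bf (1\<^sub>m n) y (sh n y') + bf (1\<^sub>m n) (sh n y) y' + bf X (sh n y) (sh n y')
      + al * (bf (Xi\<^sup>T * Xs1 S) v y' + bf (Xi\<^sup>T * Xs1 S * X) v (sh n y'))
      + al * (bf (Xi\<^sup>T * Xs1 S) v' y + bf (Xi\<^sup>T * Xs1 S * X) v' (sh n y))
      - al * bf K w w' + al * bf (minv Lam) v v')"
  unfolding Pi22_eq Let_def
  by (simp add: blocks_def bf_transpose bf_uminus bf_smult bf_mult algebra_simps)

lemma Pi_pos_def_iff: "pos_def (Pi_mat S pt Xi Lam L1 al X Y Atc Btc Ctc Dc) \<longleftrightarrow> pi_pos al"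
proof -
  let ?Pi = "\<lambda>x y. bf (Pi11 S X Y) x x + 2 * bf (Pi12_T S pt X Y Atc Btc Ctc Dc) y x
    + bf (Pi22 S pt Xi Lam L1 al X Y) y y"
  have form: "?Pi x y = pi_form al x (sh n x) (sh n (sh n x)) y (sh n y) (sh n (sh n y))
      (sh (n + (m + q)) (sh n (sh n y)))" for x y
    unfolding Pi11_form Pi12_form Pi22_form pi_form_def Let_def
    by (simp add: bf_one_commute[of n "sh n x" x] bf_one_commute[of n "sh n y" y] del: sh_sh)
  have nz: "nz (n + (n + q)) x \<or> nz (n + (n + (n + (m + (q + pt))))) y \<longleftrightarrow>
      nz n x \<or> nz n (sh n x) \<or> nz q (sh n (sh n x)) \<or> nz n y \<or> nz n (sh n y) \<or>
      nz (n + (m + q)) (sh n (sh n y)) \<or> nz pt (sh (n + (m + q)) (sh n (sh n y)))" for x y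
    by (simp add: nz_plus add.assoc)
  have "pos_def (Pi_mat S pt Xi Lam L1 al X Y Atc Btc Ctc Dc) \<longleftrightarrow>
    (\<forall>x y. nz (n + (n + q)) x \<or> nz (n + (n + (n + (m + (q + pt))))) y \<longrightarrow> 0 < ?Pi x y)"
    unfolding Pi_mat_def
  proof (rule pos_def_2x2)
    show "(Pi11 S X Y)\<^sup>T = Pi11 S X Y"
      by (subst sym_iff_bf)
         (simp_all add: dim_Pi Pi11_form bf_sym[OF X_sym] bf_sym[OF Y_sym] bf_one_commute)
    have "bf K w w' = bf K w' w" for w w' by (rule bf_sym[OF K_sym])
    then show "(Pi22 S pt Xi Lam L1 al X Y)\<^sup>T = Pi22 S pt Xi Lam L1 al X Y"
      by (subst sym_iff_bf)
         (simp_all add: dim_Pi Pi22_form Let_def bf_sym[OF X_sym] bf_sym[OF Y_sym] bf_sym[OF Li_sym] bf_one_commute)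
  qed (auto intro!: carrier_matI simp: dim_Pi)
  also have "\<dots> \<longleftrightarrow> pi_pos al"
    unfolding form nz pi_pos_def
  proof (intro iffI allI impI)
    fix x1 x2 b y1 y2 w v
    assume *: "\<forall>x y. nz n x \<or> nz n (sh n x) \<or> nz q (sh n (sh n x)) \<or> nz n y \<or> nz n (sh n y) \<or>
      nz (n + (m + q)) (sh n (sh n y)) \<or> nz pt (sh (n + (m + q)) (sh n (sh n y))) \<longrightarrow>
      0 < pi_form al x (sh n x) (sh n (sh n x)) y (sh n y) (sh n (sh n y)) (sh (n + (m + q)) (sh n (sh n y)))"
    assume nz: "nz n x1 \<or> nz n x2 \<or> nz q b \<or> nz n y1 \<or> nz n y2 \<or> nz (n + (m + q)) w \<or> nz pt v"
    let ?x = "cat n x1 (cat n x2 b)" and ?y = "cat n y1 (cat n y2 (cat (n + (m + q)) w v))"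
    have "0 < pi_form al ?x (sh n ?x) (sh n (sh n ?x)) ?y (sh n ?y) (sh n (sh n ?y)) (sh (n + (m + q)) (sh n (sh n ?y)))"
      using nz by (intro *[rule_format]) (simp only: sh_cat nz_cat)
    then show "0 < pi_form al x1 x2 b y1 y2 w v"
      unfolding sh_cat pi_form_def by simp
  qed blast
  finally show ?thesis .
qed

lemma Delta_pos_def_iff:
  assumes Z: "Z \<in> sym_mats (dim_z S)"
  shows "pos_def (Delta_mat S Z X Y Ctc Dc) \<longleftrightarrow>
    (\<forall>b z x1 x2. nz q b \<or> nz (dim_z S) z \<or> nz n x1 \<or> nz n x2 \<longrightarrow>
       0 < delta_form (red_C1 S) (Emat S) (D1mat S) Z b z x1 x2)"
proof -
  have Zc: "Z \<in> carrier_mat (dim_z S) (dim_z S)" and Zs: "Z\<^sup>T = Z" using Z by (simp_all add: sym_mats_def)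
  note [simp] = carrier_matD[OF Zc]
  let ?T = "Delta_mat S Z X Y Ctc Dc" and ?F = "red_C1 S + Emat S * Dc * red_C S" and ?G = "red_C1 S * Y + Emat S * Ctc"
  have dim: "dim_row ?T = q + (dim_z S + (n + n))" "dim_col ?T = q + (dim_z S + (n + n))"
    by (simp_all add: Delta_mat_def Let_def blocks_def)
  have form: "bf ?T u u' = (let z = sh q u; x1 = sh (dim_z S) z; x2 = sh n x1;
      z' = sh q u'; x1' = sh (dim_z S) z'; x2' = sh n x1' in
      bf (1\<^sub>m q) u u' + bf (D1mat S) z u' + bf (D1mat S) z' u + bf Z z z' + bf ?F z x1' + bf ?F z' x1
      + bf ?G z x2' + bf ?G z' x2 + bf X x1 x1' + bf (1\<^sub>m n) x1 x2' + bf (1\<^sub>m n) x2 x1' + bf Y x2 x2')" for u u'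
    by (simp add: Delta_mat_def Let_def blocks_def bf_transpose add.assoc)
  have sym: "?T\<^sup>T = ?T"
    by (subst sym_iff_bf) (simp_all only: dim form Let_def,
        simp add: bf_sym[OF X_sym] bf_sym[OF Y_sym] bf_sym[OF Zs] bf_one_commute algebra_simps)
  have delta: "bf ?T u u = delta_form (red_C1 S) (Emat S) (D1mat S) Z u (sh q u) (sh (dim_z S) (sh q u))
      (sh n (sh (dim_z S) (sh q u)))" for u
    unfolding form Let_def delta_form_def
    by (simp add: bf_one_commute[of n "sh n (sh (dim_z S) (sh q u))"] del: sh_sh)
  have "?T \<in> carrier_mat (q + (dim_z S + (n + n))) (q + (dim_z S + (n + n)))" by (intro carrier_matI dim)
  from pos_def_iff[OF this]
  have "pos_def ?T \<longleftrightarrow> (\<forall>u. nz (q + (dim_z S + (n + n))) u \<longrightarrow> 0 < bf ?T u u)" using sym by simp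
  also have "\<dots> \<longleftrightarrow> (\<forall>b z x1 x2. nz q b \<or> nz (dim_z S) z \<or> nz n x1 \<or> nz n x2 \<longrightarrow>
       0 < delta_form (red_C1 S) (Emat S) (D1mat S) Z b z x1 x2)"
    unfolding delta nz_plus
  proof (intro iffI allI impI)
    fix b z x1 x2
    assume *: "\<forall>u. nz q u \<or> nz (dim_z S) (sh q u) \<or> nz n (sh (dim_z S) (sh q u)) \<or> nz n (sh n (sh (dim_z S) (sh q u))) \<longrightarrow>
      0 < delta_form (red_C1 S) (Emat S) (D1mat S) Z u (sh q u) (sh (dim_z S) (sh q u)) (sh n (sh (dim_z S) (sh q u)))"
      and nz: "nz q b \<or> nz (dim_z S) z \<or> nz n x1 \<or> nz n x2"
    let ?u = "cat q b (cat (dim_z S) z (cat n x1 x2))"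
    have "0 < delta_form (red_C1 S) (Emat S) (D1mat S) Z ?u (sh q ?u) (sh (dim_z S) (sh q ?u)) (sh n (sh (dim_z S) (sh q ?u)))"
      using nz by (intro *[rule_format]) (simp only: sh_cat nz_cat)
    then show "0 < delta_form (red_C1 S) (Emat S) (D1mat S) Z b z x1 x2"
      unfolding sh_cat delta_form_def by simp
  qed blast
  finally show ?thesis .
qed

end

section \<open>Necessity, sufficiency and reconstruction\<close>

context data_driven
begin

lemma designI:
  assumes ctrl: "controller Ac Bc Cc Dc"
    and c: "X \<in> carrier_mat n n" "Y \<in> carrier_mat n n" "U \<in> carrier_mat n n" "Ui \<in> carrier_mat n n"
      "V \<in> carrier_mat n n" "P \<in> carrier_mat (n + n) (n + n)"
      "Atc \<in> carrier_mat n n" "Btc \<in> carrier_mat n (dim_yc S)" "Ctc \<in> carrier_mat m n"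
    and sym: "X\<^sup>T = X" "Y\<^sup>T = Y" "P\<^sup>T = P" and UV: "U * V\<^sup>T = 1\<^sub>m n - X * Y"
    and Ui: "U\<^sup>T * Ui = 1\<^sub>m n" "Ui * U\<^sup>T = 1\<^sub>m n"
    and PT: "P * blocks [[X, 1\<^sub>m n], [U\<^sup>T, 0\<^sub>m n n]] = blocks [[1\<^sub>m n, Y], [0\<^sub>m n n, V\<^sup>T]]"
    and vars: "Btc = X * B_check S * Dc + U * Bc" "Ctc = Dc * red_C S * Y + Cc * V\<^sup>T"
      "Atc = X * (A_check S * Y + B_check S * Ctc) + U * Bc * red_C S * Y + U * Ac * V\<^sup>T"
  shows "design S pt Xi Lam L1 X Y U Ui V P Ac Bc Cc Dc Atc Btc Ctc"
proof (intro design.intro data_driven_axioms feedback.intro)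
  show "A_check S \<in> carrier_mat n n" "B_check S \<in> carrier_mat n m" "B1_check S \<in> carrier_mat n q"
    "red_C S \<in> carrier_mat (dim_yc S) n"
    by (intro carrier_matI; simp)+
  show "Ac \<in> carrier_mat n n" "Bc \<in> carrier_mat n (dim_yc S)" "Cc \<in> carrier_mat m n" "Dc \<in> carrier_mat m (dim_yc S)"
    using ctrl unfolding controller_def by blast+
  have Lam: "minv Lam \<in> carrier_mat pt pt" "minv Lam * Lam = 1\<^sub>m pt"
    using minv_inverse[OF plant_carriers(16)] pd_inj[OF plant_carriers(16) Lam_facts(2)] by blast+
  then show "minv Lam \<in> carrier_mat pt pt" "minv Lam * Lam = 1\<^sub>m pt" .
  show "(minv Lam)\<^sup>T = minv Lam"
    by (rule minv_pos_def(1)[OF plant_carriers(16) Lam_facts])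
  show "0 < bf (minv Lam) x x" if "nz pt x" for x
    by (rule minv_pos_def(2)[OF plant_carriers(16) Lam_facts that])
  show "0 \<le> bf Lam x x" for x
    using Lam_facts(2)[of x] not_nz_bf(1)[of Lam x x] by (cases "nz pt x") auto
qed (fact Xs1_carrier K_carrier plant_carriers c K_sym K_neg Lam_facts sym UV Ui PT vars)+

lemma consistent_uncertainty:
  assumes "(As, Bu, Bw) \<in> consistent_set S"
  shows "As \<in> carrier_mat p n" "Bu \<in> carrier_mat p m" "Bw \<in> carrier_mat p q"
    "hcat [As, Bu, Bw] - Mcheck \<in> carrier_mat p (n + (m + q))"
    "bf ((hcat [As, Bu, Bw] - Mcheck) * (- K) * (hcat [As, Bu, Bw] - Mcheck)\<^sup>T) x x \<le> bf Rmat x x"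
proof -
  show c: "As \<in> carrier_mat p n" "Bu \<in> carrier_mat p m" "Bw \<in> carrier_mat p q"
    using assms unfolding consistent_set_def by blast+
  note [simp] = carrier_matD[OF c(1)] carrier_matD[OF c(2)] carrier_matD[OF c(3)]
  have M: "hcat [As, Bu, Bw] \<in> carrier_mat p (n + (m + q))" by (intro carrier_matI) simp_all
  show "hcat [As, Bu, Bw] - Mcheck \<in> carrier_mat p (n + (m + q))" by (intro carrier_matI) simp_all
  have "0 \<le> qmi (hcat [As, Bu, Bw]) x" using assms consistent_iff_qmi[OF c] by blast
  then show "bf ((hcat [As, Bu, Bw] - Mcheck) * (- K) * (hcat [As, Bu, Bw] - Mcheck)\<^sup>T) x x \<le> bf Rmat x x"
    unfolding qmi_eq[OF M] by linarith
qed

lemma uncertainty_consistent: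
  assumes D: "D \<in> carrier_mat p (n + (m + q))" and le: "\<And>x. bf (D * (- K) * D\<^sup>T) x x \<le> bf Rmat x x"
  obtains As Bu Bw where "(As, Bu, Bw) \<in> consistent_set S" "hcat [As, Bu, Bw] - Mcheck = D"
proof -
  note [simp] = carrier_matD[OF D]
  define M where "M = Mcheck + D"
  have M: "M \<in> carrier_mat p (n + (m + q))" by (intro carrier_matI) (simp_all add: M_def)
  note [simp] = carrier_matD[OF M]
  let ?As = "subblock M 0 0 p n" and ?Bu = "subblock M 0 n p m" and ?Bw = "subblock M 0 (n + m) p q"
  have H: "hcat [?As, ?Bu, ?Bw] = M"
    by (rule bf_eqI) (simp_all, simp add: bf_def subblock_def sum_lessThan_add sum.distrib sh_def add.assoc)
  have MD: "M - Mcheck = D" unfolding M_def by (rule bf_eqI) (simp_all add: bf_diff bf_plus del: bf_hcat)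
  have "\<forall>x. 0 \<le> qmi M x" unfolding qmi_eq[OF M] MD using le by simp
  moreover have "?As \<in> carrier_mat p n" "?Bu \<in> carrier_mat p m" "?Bw \<in> carrier_mat p q"
    by (intro carrier_matI; simp)+
  ultimately have "(?As, ?Bu, ?Bw) \<in> consistent_set S" using consistent_iff_qmi H by metis
  then show ?thesis using that H MD by metis
qed

end

context design
begin

lemma A_nom_eq: "A_nom = cl_A S (As_check S) (Bu_check S) Ac Bc Cc Dc"
  by (simp add: cl_A_def A_check_def B_check_def)

lemma B_nom_eq: "B_nom = cl_B S (Bw_check S)"
  by (simp add: cl_B_def B1_check_def)

lemma controller: "controller Ac Bc Cc Dc"
  using var_carrier unfolding controller_def by blast

lemma red_carriers: "red_C1 S \<in> carrier_mat (dim_z S) n"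
  by (intro carrier_matI) simp_all

lemmas delta_output = delta_pos_iff[OF red_carriers plant_carriers(3,4) _ cl_C_def]

lemma synthesis_imp_robust:
  assumes syn: "synthesis_ineqs S mu pt Xi Lam L1 al Z X Y Atc Btc Ctc Dc"
  shows "robust_H2 S mu Ac Bc Cc Dc P Z"
proof -
  have Z: "Z \<in> sym_mats (dim_z S)" and mu: "mtrace Z < mu\<^sup>2"
    and Pi: "pos_def (Pi_mat S pt Xi Lam L1 al X Y Atc Btc Ctc Dc)"
    and Delta: "pos_def (Delta_mat S Z X Y Ctc Dc)"
    using syn unfolding synthesis_ineqs_def by blast+
  have Zc: "Z \<in> carrier_mat (dim_z S) (dim_z S)" "Z\<^sup>T = Z" using Z by (simp_all add: sym_mats_def)
  have "pi_pos al" using Pi Pi_pos_def_iff by blast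
  then have "lmi al P" by (rule pi_pos_imp_lmi)
  then have rob: "robust P"
    using p_le_n by (intro lmi_imp_robust[OF var_carrier(6) P_sym]) auto
  have out: "\<forall>z a. nz (dim_z S) z \<or> nz (n + n) a \<longrightarrow> 0 < output_form (D1mat S) Z (cl_C S Cc Dc) z a"
    using Delta unfolding Delta_pos_def_iff[OF Z] delta_output[OF Zc(1)] .
  have "H2_ineqs S mu As Bu Bw Ac Bc Cc Dc P Z" if cons: "(As, Bu, Bw) \<in> consistent_set S" for As Bu Bw
  proof -
    note c = consistent_uncertainty[OF cons]
    let ?D = "hcat [As, Bu, Bw] - Mcheck"
    have "admissible ?D" unfolding admissible_def using c(4,5) by blast
    then have "\<forall>b cc. nz q b \<or> nz (n + n) cc \<longrightarrow>
        0 < gram_form (A_nom + F_unc * ?D * G1_unc) (B_nom + F_unc * ?D * G2_unc) P b cc"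
      using rob unfolding robust_def by blast
    moreover have "A_nom + F_unc * ?D * G1_unc = cl_A S As Bu Ac Bc Cc Dc"
      "B_nom + F_unc * ?D * G2_unc = cl_B S Bw"
      unfolding A_nom_eq B_nom_eq
      using cl_uncertain[OF c(1-3)] controller[unfolded controller_def] by metis+
    ultimately show ?thesis
      using out mu unfolding H2_ineqs_iff[OF controller c(1,3) var_carrier(6) P_sym Zc]
        gram_form_def output_form_def by metis
  qed
  then show ?thesis
    unfolding robust_H2_def using controller var_carrier(6) P_sym Z
    by (auto simp: controller_def sym_mats_def mult_2)
qed

lemma lmi_imp_synthesis:
  assumes al: "0 < al" and lmi: "lmi al P" and Z: "Z \<in> sym_mats (dim_z S)" and mu: "mtrace Z < mu\<^sup>2"
    and out: "\<And>z a. nz (dim_z S) z \<or> nz (n + n) a \<Longrightarrow>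
       0 < bf (Z - D1mat S * (D1mat S)\<^sup>T) z z + 2 * bf (cl_C S Cc Dc) z (mv P a) + bf P a a"
  shows "synthesis_ineqs S mu pt Xi Lam L1 al Z X Y Atc Btc Ctc Dc"
proof -
  have Zc: "Z \<in> carrier_mat (dim_z S) (dim_z S)" using Z by (simp add: sym_mats_def)
  have "pos_def (Pi_mat S pt Xi Lam L1 al X Y Atc Btc Ctc Dc)"
    unfolding Pi_pos_def_iff by (rule lmi_imp_pi_pos[OF al lmi])
  moreover have "pos_def (Delta_mat S Z X Y Ctc Dc)"
    unfolding Delta_pos_def_iff[OF Z] delta_output[OF Zc] output_form_def using out by blast
  ultimately show ?thesis
    unfolding synthesis_ineqs_def sym_mats_def[of n] using Z mu var_carrier X_sym Y_sym by blast
qed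

end

context data_driven
begin

text \<open>Since $\Sigma$ is nonempty, the second closed-loop inequality gives $P \succ 0$, and robustness yields a strict
multiplier inequality. The off-diagonal block of $P$ may be singular, in which case there is no invertible $T_1$; strictness
permits adding a small multiple of the identity to this block.\<close>

lemma robust_imp_synthesis:
  assumes "robust_H2 S mu Ac Bc Cc Dc P Z"
  shows "\<exists>al X Y Atc Btc Ctc. synthesis_ineqs S mu pt Xi Lam L1 al Z X Y Atc Btc Ctc Dc"
proof -
  have ctrl: "controller Ac Bc Cc Dc" and P: "P \<in> carrier_mat (n + n) (n + n)" "P\<^sup>T = P"
    and Z: "Z \<in> sym_mats (dim_z S)"
    and H2: "\<And>As Bu Bw. (As, Bu, Bw) \<in> consistent_set S \<Longrightarrow> H2_ineqs S mu As Bu Bw Ac Bc Cc Dc P Z"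
    using assms unfolding robust_H2_def controller_def by (auto simp: sym_mats_def mult_2)
  have Zc: "Z \<in> carrier_mat (dim_z S) (dim_z S)" "Z\<^sup>T = Z" using Z by (simp_all add: sym_mats_def)
  note [simp] = controllerD[OF ctrl] carrier_matD[OF P(1)] carrier_matD[OF Zc(1)]
  let ?A = "cl_A S (As_check S) (Bu_check S) Ac Bc Cc Dc" and ?B = "cl_B S (Bw_check S)"
  let ?C = "cl_C S Cc Dc" and ?ZD = "Z - D1mat S * (D1mat S)\<^sup>T"
  note [simp] = dim_cl(5,6)[OF ctrl dim_checks(2) dim_checks(6)]
  interpret u: uncertain_system "n + n" q p "n + (m + q)" ?A ?B F0 "G10 Cc Dc" G20 Rmat "- K"
    by (rule uncertain[OF ctrl])
  note iff = H2_ineqs_iff[OF ctrl _ _ P Zc]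
  obtain As0 Bu0 Bw0 where c0: "(As0, Bu0, Bw0) \<in> consistent_set S"
    using sa unfolding standing_assumptions_def by auto
  note H20 = H2[OF c0, unfolded iff[OF consistent_uncertainty(1,3)[OF c0]]]
  have mu: "mtrace Z < mu\<^sup>2"
    and out: "\<And>z a. nz (dim_z S) z \<or> nz (n + n) a \<Longrightarrow> 0 < bf ?ZD z z + 2 * bf ?C z (mv P a) + bf P a a"
    using H20 by blast+
  have pd: "0 < bf P a a" if "nz (n + n) a" for a
    using out[of 0 a] that by simp
  have "u.robust P" unfolding u.robust_def
  proof (intro allI impI)
    fix D b c assume D: "u.admissible D" and nz: "nz q b \<or> nz (n + n) c"
    have "D \<in> carrier_mat p (n + (m + q))" "\<And>x. bf (D * (- K) * D\<^sup>T) x x \<le> bf Rmat x x"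
      using D unfolding u.admissible_def by blast+
    then obtain As Bu Bw where cons: "(As, Bu, Bw) \<in> consistent_set S" and "hcat [As, Bu, Bw] - Mcheck = D"
      using uncertainty_consistent by blast
    note c = consistent_uncertainty(1-3)[OF cons]
    have "?A + F0 * D * G10 Cc Dc = cl_A S As Bu Ac Bc Cc Dc" "?B + F0 * D * G20 = cl_B S Bw"
      using cl_uncertain[OF c] ctrl[unfolded controller_def] \<open>hcat [As, Bu, Bw] - Mcheck = D\<close> by metis+
    then show "0 < u.gram_form (?A + F0 * D * G10 Cc Dc) (?B + F0 * D * G20) P b c"
      using H2[OF cons, unfolded iff[OF c(1,3)]] nz unfolding u.gram_form_def by metis
  qed
  then obtain al where al: "0 < al" "u.lmi al P"
    using u.robust_imp_lmi[OF P pd] by blast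
  let ?M = "blocks [[0\<^sub>m n n, 1\<^sub>m n], [1\<^sub>m n, 0\<^sub>m n n]]"
  have M: "?M \<in> carrier_mat (n + n) (n + n)" by (intro carrier_matI; simp add: blocks_def)
  note Md [simp] = carrier_matD[OF M]
  obtain t1 where t1: "0 < t1" "\<And>s. 0 \<le> s \<Longrightarrow> s \<le> t1 \<Longrightarrow> u.lmi al (P + s \<cdot>\<^sub>m ?M)"
    using u.lmi_perturb[OF P(1) M al(2)] by blast
  \<comment> \<open>The doubled upper block replaces the symmetric pair of off-diagonal blocks; the quadratic form is the same.\<close>
  let ?T = "\<lambda>ZD P. blocks [[ZD, 2 \<cdot>\<^sub>m (?C * P)], [0\<^sub>m (n + n) (dim_z S), P]]"
  have T: "?T ?ZD P \<in> carrier_mat (dim_z S + (n + n)) (dim_z S + (n + n))"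
    "?T (0\<^sub>m (dim_z S) (dim_z S)) ?M \<in> carrier_mat (dim_z S + (n + n)) (dim_z S + (n + n))"
    by (intro carrier_matI; simp add: blocks_def)+
  have bfT: "bf (?T ZD Q) x x = bf ZD x x + 2 * bf ?C x (mv Q (sh (dim_z S) x)) + bf Q (sh (dim_z S) x) (sh (dim_z S) x)"
    if "dim_row ZD = dim_z S" "dim_col ZD = dim_z S" "dim_row Q = n + n" "dim_col Q = n + n" for ZD Q x
    using that by (simp add: blocks_def bf_smult bf_mult)
  have T_pos: "0 < bf (?T ?ZD P) x x" if "nz (dim_z S + (n + n)) x" for x
    using out[of x "sh (dim_z S) x"] that by (subst bfT) (simp_all add: nz_plus)
  obtain t2 where t2: "0 < t2" "\<And>s x. 0 \<le> s \<Longrightarrow> s \<le> t2 \<Longrightarrow> nz (dim_z S + (n + n)) x \<Longrightarrow>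
      0 < bf (?T ?ZD P) x x + s * bf (?T (0\<^sub>m (dim_z S) (dim_z S)) ?M) x x"
    using pos_form_perturb[OF T T_pos] by blast
  let ?V0 = "(subblock P 0 n n n)\<^sup>T"
  have V0: "?V0 \<in> carrier_mat n n" by (intro carrier_matI) simp_all
  obtain s where s: "0 < s" "s \<le> min t1 t2" "\<And>x. nz n x \<Longrightarrow> nz n (mv (?V0 + s \<cdot>\<^sub>m 1\<^sub>m n) x)"
    using regular_shift[OF V0, of "min t1 t2"] t1(1) t2(1) by auto
  define P' where "P' = P + s \<cdot>\<^sub>m ?M"
  have P'_form: "bf P' x y = bf P x y + s * bf ?M x y" "mv P' x = mv P x + smul s (mv ?M x)" for x y
    unfolding P'_def by (simp_all only: bf_plus mv_plus bf_smult mv_smult index_smult_mat Md carrier_matD[OF P(1)])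
  have P'_dim [simp]: "dim_row P' = n + n" "dim_col P' = n + n" using M by (simp_all add: P'_def)
  have P'c: "P' \<in> carrier_mat (n + n) (n + n)" by (intro carrier_matI) simp_all
  have "bf ?M x y = bf ?M y x" for x y
    by (simp add: blocks_def bf_one_commute)
  then have P's: "P'\<^sup>T = P'"
    by (subst sym_iff_bf) (simp_all only: P'_dim P'_form bf_sym[OF P(2)], metis bf_sym[OF P(2)])
  have lmi': "u.lmi al P'" unfolding P'_def using s by (intro t1(2)) auto
  have out': "0 < bf ?ZD z z + 2 * bf ?C z (mv P' a) + bf P' a a" if nz: "nz (dim_z S) z \<or> nz (n + n) a" for z a
  proof -
    have "nz (dim_z S + (n + n)) (cat (dim_z S) z a)" using nz by (simp add: nz_plus)
    from t2(2)[OF _ _ this, of s] s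
    have "0 < bf (?T ?ZD P) (cat (dim_z S) z a) (cat (dim_z S) z a)
        + s * bf (?T (0\<^sub>m (dim_z S) (dim_z S)) ?M) (cat (dim_z S) z a) (cat (dim_z S) z a)" by simp
    also have "bf (?T ?ZD P) (cat (dim_z S) z a) (cat (dim_z S) z a) = bf ?ZD z z + 2 * bf ?C z (mv P a) + bf P a a"
      by (subst bfT) simp_all
    also have "bf (?T (0\<^sub>m (dim_z S) (dim_z S)) ?M) (cat (dim_z S) z a) (cat (dim_z S) z a) =
        2 * bf ?C z (mv ?M a) + bf ?M a a"
    proof -
      have "bf (?T (0\<^sub>m (dim_z S) (dim_z S)) ?M) x x = bf (0\<^sub>m (dim_z S) (dim_z S)) x x
          + 2 * bf ?C x (mv ?M (sh (dim_z S) x)) + bf ?M (sh (dim_z S) x) (sh (dim_z S) x)" for x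
        by (rule bfT) (simp_all only: index_zero_mat Md)
      then show ?thesis by simp
    qed
    finally show ?thesis
      unfolding P'_form by (simp add: bf_add_right bf_smul_right algebra_simps)
  qed
  have pd': "0 < bf P' a a" if "nz (n + n) a" for a
    using out'[of 0 a] that by simp
  have "(subblock P' 0 n n n)\<^sup>T = ?V0 + s \<cdot>\<^sub>m 1\<^sub>m n"
  proof (rule eq_matI)
    fix i j assume ij: "i < dim_row (?V0 + s \<cdot>\<^sub>m 1\<^sub>m n)" "j < dim_col (?V0 + s \<cdot>\<^sub>m 1\<^sub>m n)"
    have "?M $$ (j, n + i) = (1\<^sub>m n :: real mat) $$ (j, i)" 
      using ij by (simp add: blocks_def hcat.simps vcat.simps append_rows_def)
    then show "(subblock P' 0 n n n)\<^sup>T $$ (i, j) = (?V0 + s \<cdot>\<^sub>m 1\<^sub>m n) $$ (i, j)"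
      using ij M by (simp add: subblock_def P'_def)
  qed simp_all
  then have V_inj: "nz n x \<Longrightarrow> nz n (mv (subblock P' 0 n n n)\<^sup>T x)" for x
    using s(3) by simp
  obtain X Y U Ui V where XY: "X \<in> carrier_mat n n" "Y \<in> carrier_mat n n" "U \<in> carrier_mat n n"
    "Ui \<in> carrier_mat n n" "V \<in> carrier_mat n n" "X\<^sup>T = X" "Y\<^sup>T = Y" "U * V\<^sup>T = 1\<^sub>m n - X * Y"
    "U\<^sup>T * Ui = 1\<^sub>m n" "Ui * U\<^sup>T = 1\<^sub>m n"
    "P' * blocks [[X, 1\<^sub>m n], [U\<^sup>T, 0\<^sub>m n n]] = blocks [[1\<^sub>m n, Y], [0\<^sub>m n n, V\<^sup>T]]"
    using lyapunov_partition[OF P'c P's pd' V_inj] by blast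
  note [simp] = carrier_matD[OF XY(1)] carrier_matD[OF XY(2)] carrier_matD[OF XY(3)] carrier_matD[OF XY(5)]
  define Btc where "Btc = X * B_check S * Dc + U * Bc"
  define Ctc where "Ctc = Dc * red_C S * Y + Cc * V\<^sup>T"
  define Atc where "Atc = X * (A_check S * Y + B_check S * Ctc) + U * Bc * red_C S * Y + U * Ac * V\<^sup>T"
  have tc: "Atc \<in> carrier_mat n n" "Btc \<in> carrier_mat n (dim_yc S)" "Ctc \<in> carrier_mat m n"
    by (intro carrier_matI; simp add: Atc_def Btc_def Ctc_def)+
  interpret d: design S pt Xi Lam L1 X Y U Ui V P' Ac Bc Cc Dc Atc Btc Ctc
    by (rule designI[OF ctrl XY(1-5) P'c tc XY(6,7) P's XY(8-11) Btc_def Ctc_def Atc_def])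
  have "d.lmi al P'" using lmi' unfolding d.A_nom_eq d.B_nom_eq .
  then show ?thesis using d.lmi_imp_synthesis[OF al(1) _ Z mu out'] by blast
qed

lemma Delta_pos_def_block:
  assumes Delta: "pos_def (Delta_mat S Z X Y Ctc Dc)" and x: "nz n x1 \<or> nz n x2"
    and c: "Z \<in> carrier_mat (dim_z S) (dim_z S)" "X \<in> carrier_mat n n" "Y \<in> carrier_mat n n"
      "Ctc \<in> carrier_mat m n" "Dc \<in> carrier_mat m (dim_yc S)"
  shows "0 < bf X x1 x1 + 2 * bf (1\<^sub>m n) x1 x2 + bf Y x2 x2"
proof -
  note [simp] = carrier_matD[OF c(1)] carrier_matD[OF c(2)] carrier_matD[OF c(3)] carrier_matD[OF c(4)] carrier_matD[OF c(5)]
  let ?T = "Delta_mat S Z X Y Ctc Dc" and ?u = "cat q 0 (cat (dim_z S) 0 (cat n x1 x2))"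
  have "?T \<in> carrier_mat (q + (dim_z S + (n + n))) (q + (dim_z S + (n + n)))"
    by (intro carrier_matI; simp add: Delta_mat_def Let_def blocks_def)
  from pos_def_iff[OF this] Delta
  have "\<And>u. nz (q + (dim_z S + (n + n))) u \<Longrightarrow> 0 < bf ?T u u" by blast
  moreover have "nz (q + (dim_z S + (n + n))) ?u" using x by (simp add: nz_plus)
  ultimately have "0 < bf ?T ?u ?u" by blast
  also have "bf ?T ?u ?u = bf X x1 x1 + 2 * bf (1\<^sub>m n) x1 x2 + bf Y x2 x2"
    by (simp add: Delta_mat_def Let_def blocks_def bf_transpose bf_one_commute[of n x2])
  finally show ?thesis .
qed

text \<open>The formulas for $U$, $A_c$, $B_c$, $C_c$ solve the equations of the change of variables. They are meaningful because
$\Delta \succ 0$ contains the block $(X\ I; I\ Y) \succ 0$: were $X Y x = x$ with $x \ne 0$, its form would vanish at $(-Yx, x)$.\<close>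

lemma reconstruction:
  assumes syn: "synthesis_ineqs S mu pt Xi Lam L1 al Z X Y Atc Btc Ctc Dc"
    and V: "V \<in> carrier_mat n n" "vec_space.rank n V = n"
  defines "W \<equiv> (minv V)\<^sup>T"
  defines "U \<equiv> (1\<^sub>m n - X * Y) * W"
  defines "Bc \<equiv> minv U * (Btc - X * B_check S * Dc)"
  defines "Cc \<equiv> (Ctc - Dc * red_C S * Y) * W"
  defines "Ac \<equiv> minv U * (Atc - X * (A_check S * Y + B_check S * Ctc) - U * Bc * red_C S * Y) * W"
  shows "invertible_mat U" "\<exists>P. robust_H2 S mu Ac Bc Cc Dc P Z"
proof -
  have Z: "Z \<in> carrier_mat (dim_z S) (dim_z S)"
    and XY: "X \<in> carrier_mat n n" "X\<^sup>T = X" "Y \<in> carrier_mat n n" "Y\<^sup>T = Y"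
    and tc: "Atc \<in> carrier_mat n n" "Btc \<in> carrier_mat n (dim_yc S)" "Ctc \<in> carrier_mat m n"
      "Dc \<in> carrier_mat m (dim_yc S)"
    and Delta: "pos_def (Delta_mat S Z X Y Ctc Dc)"
    using syn unfolding synthesis_ineqs_def sym_mats_def by blast+
  note [simp] = carrier_matD[OF XY(1)] carrier_matD[OF XY(3)] carrier_matD[OF tc(1)] carrier_matD[OF tc(2)]
    carrier_matD[OF tc(3)] carrier_matD[OF tc(4)] carrier_matD[OF V(1)]
  have "det V \<noteq> 0" using full_rank_det[OF V(1)] V(2) by blast
  then have Vinv: "minv V \<in> carrier_mat n n" "V * minv V = 1\<^sub>m n" "minv V * V = 1\<^sub>m n"
    using minv_inverse[OF V(1)] det_nz_iff_inj[OF V(1)] by blast+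
  have W: "W \<in> carrier_mat n n" using Vinv(1) by (simp add: W_def)
  note [simp] = carrier_matD[OF W]
  have WV: "W * V\<^sup>T = 1\<^sub>m n" "V\<^sup>T * W = 1\<^sub>m n"
    unfolding W_def transpose_mult[OF V(1) Vinv(1), symmetric] transpose_mult[OF Vinv(1) V(1), symmetric] Vinv
    by simp_all
  have mvWV: "mv W (mv V\<^sup>T x) = mv (1\<^sub>m n) x" for x
    using WV(1) by (simp add: mv_mult[symmetric])
  have U: "U \<in> carrier_mat n n" by (intro carrier_matI) (simp_all add: U_def)
  note [simp] = carrier_matD[OF U]
  have XY_inj: "nz n (mv (1\<^sub>m n - X * Y) x)" if x: "nz n x" for x
  proof (rule ccontr)
    assume "\<not> ?thesis"
    then have "mv (1\<^sub>m n - X * Y) x = 0" by (intro mv_eq_0I) simp_all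
    then have eq: "mv X (mv Y x) = mv (1\<^sub>m n) x" by (simp add: mv_diff mv_mult)
    have "bf X (mv Y x) (mv Y x) = bf (1\<^sub>m n) (mv Y x) (mv X (mv Y x))" by (simp add: bf_one_mv)
    also have "\<dots> = bf Y x x" unfolding eq by (simp add: bf_mv_left XY(4))
    finally have "bf X (mv Y x) (mv Y x) = bf Y x x" .
    moreover have "bf (1\<^sub>m n) (mv Y x) x = bf Y x x" by (simp add: bf_mv_left XY(4))
    ultimately show False
      using Delta_pos_def_block[OF Delta disjI2[OF x] Z XY(1,3) tc(3,4), of "- mv Y x"]
      by (simp add: bf_minus_left bf_minus_right)
  qed
  have U_inj: "nz n (mv U x)" if "nz n x" for x
  proof -
    have "nz n (mv W x)" by (rule left_inverse_inj[OF WV(2) W _ that]) (use V in simp)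
    then show ?thesis unfolding U_def using XY_inj by (simp add: mv_mult)
  qed
  have Uinv: "minv U \<in> carrier_mat n n" "U * minv U = 1\<^sub>m n" "minv U * U = 1\<^sub>m n"
    using minv_inverse[OF U] U_inj by blast+
  note [simp] = carrier_matD[OF Uinv(1)]
  have mvU: "mv U (mv (minv U) x) = mv (1\<^sub>m n) x" for x
    using Uinv(2) by (simp add: mv_mult[symmetric])
  show "invertible_mat U"
    unfolding invertible_mat_def inverts_mat_def square_mat.simps using Uinv U by (intro conjI exI[of _ "minv U"]) simp_all
  have dims [simp]: "dim_row Bc = n" "dim_col Bc = dim_yc S" "dim_row Cc = m" "dim_col Cc = n"
    "dim_row Ac = n" "dim_col Ac = n"
    by (simp_all add: Bc_def Cc_def Ac_def)
  have ctrl: "controller Ac Bc Cc Dc"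
    unfolding controller_def using tc by (auto intro!: carrier_matI)
  have UV: "U * V\<^sup>T = 1\<^sub>m n - X * Y"
    by (rule mv_eqI) (simp_all add: U_def mv_mult mvWV)
  have Bt: "Btc = X * B_check S * Dc + U * Bc"
    by (rule mv_eqI) (simp_all add: Bc_def mv_mult mv_plus mvU mv_diff mv_minus_arg)
  have Ct: "Ctc = Dc * red_C S * Y + Cc * V\<^sup>T"
    by (rule mv_eqI) (simp_all add: Cc_def mv_mult mv_plus mvWV mv_diff)
  have At: "Atc = X * (A_check S * Y + B_check S * Ctc) + U * Bc * red_C S * Y + U * Ac * V\<^sup>T"
  proof (rule mv_eqI)
    fix x
    let ?E = "Atc - X * (A_check S * Y + B_check S * Ctc) - U * Bc * red_C S * Y"
    have "mv (U * Ac * V\<^sup>T) x = mv ?E x"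
      unfolding Ac_def by (simp add: mv_mult mvWV mvU)
    then show "mv Atc x = mv (X * (A_check S * Y + B_check S * Ctc) + U * Bc * red_C S * Y + U * Ac * V\<^sup>T) x"
      by (simp add: mv_plus mv_diff del: mv_mult)
  qed simp_all
  have Ui: "(minv U)\<^sup>T \<in> carrier_mat n n" "U\<^sup>T * (minv U)\<^sup>T = 1\<^sub>m n" "(minv U)\<^sup>T * U\<^sup>T = 1\<^sub>m n"
    unfolding transpose_mult[OF U Uinv(1), symmetric] transpose_mult[OF Uinv(1) U, symmetric] Uinv
    using Uinv(1) by simp_all
  obtain P where P: "P \<in> carrier_mat (n + n) (n + n)" "P\<^sup>T = P"
    "P * blocks [[X, 1\<^sub>m n], [U\<^sup>T, 0\<^sub>m n n]] = blocks [[1\<^sub>m n, Y], [0\<^sub>m n n, V\<^sup>T]]"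
    using lyapunov_construction[OF XY(1,3) U Ui(1) V(1) XY(2,4) UV Ui(2,3)] by blast
  interpret d: design S pt Xi Lam L1 X Y U "(minv U)\<^sup>T" V P Ac Bc Cc Dc Atc Btc Ctc
    by (rule designI[OF ctrl XY(1,3) U Ui(1) V(1) P(1) tc(1-3) XY(2,4) P(2) UV Ui(2,3) P(3) Bt Ct At])
  show "\<exists>P. robust_H2 S mu Ac Bc Cc Dc P Z" using d.synthesis_imp_robust[OF syn] by blast
qed

end

theorem mainTheorem2:
  fixes S :: plant_data and mu :: real and pt :: nat and Xi Lam L1 :: "real mat"
  assumes "well_formed S"
    and "standing_assumptions S"
    and "Xi_Lambda_factorization S pt Xi Lam"
    and "kernel_basis_rows S L1"
  shows "((\<exists>Ac Bc Cc Dc P Z. robust_H2 S mu Ac Bc Cc Dc P Z) \<longleftrightarrow>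
          (\<exists>al Z X Y Atc Btc Ctc Dc. synthesis_ineqs S mu pt Xi Lam L1 al Z X Y Atc Btc Ctc Dc)) \<and>
         (\<forall>al Z X Y Atc Btc Ctc Dc V.
            synthesis_ineqs S mu pt Xi Lam L1 al Z X Y Atc Btc Ctc Dc \<longrightarrow>
            V \<in> carrier_mat (ntil S) (ntil S) \<longrightarrow> vec_space.rank (ntil S) V = ntil S \<longrightarrow>
            (let VinvT = (minv V)\<^sup>T;
                 Ub = (1\<^sub>m (ntil S) - X * Y) * VinvT;
                 Bc = minv Ub * (Btc - X * B_check S * Dc);
                 Cc = (Ctc - Dc * red_C S * Y) * VinvT;
                 Ac = minv Ub * (Atc - X * (A_check S * Y + B_check S * Ctc)
                                     - Ub * Bc * red_C S * Y) * VinvT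
             in invertible_mat Ub \<and> (\<exists>P Z'. robust_H2 S mu Ac Bc Cc Dc P Z')))"
proof -
  interpret data_driven S pt Xi Lam L1 by (rule data_driven.intro[OF assms])
  have "vec_space.rank (ntil S) (1\<^sub>m (ntil S) :: real mat) = ntil S"
    by (subst full_rank_det) simp_all
  then have "\<exists>Ac Bc Cc Dc P Z. robust_H2 S mu Ac Bc Cc Dc P Z"
    if "synthesis_ineqs S mu pt Xi Lam L1 al Z X Y Atc Btc Ctc Dc" for al Z X Y Atc Btc Ctc Dc
    using reconstruction(2)[OF that one_carrier_mat] by blast
  then have "(\<exists>Ac Bc Cc Dc P Z. robust_H2 S mu Ac Bc Cc Dc P Z) \<longleftrightarrow>
      (\<exists>al Z X Y Atc Btc Ctc Dc. synthesis_ineqs S mu pt Xi Lam L1 al Z X Y Atc Btc Ctc Dc)"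
    by (iprover dest: robust_imp_synthesis)
  then show ?thesis
  proof (intro conjI allI impI)
    fix al Z X Y Atc Btc Ctc Dc and V :: "real mat"
    assume "synthesis_ineqs S mu pt Xi Lam L1 al Z X Y Atc Btc Ctc Dc"
      and "V \<in> carrier_mat n n" and "vec_space.rank n V = n"
    note reconstruction[OF this]
    then show "let VinvT = (minv V)\<^sup>T;
                 Ub = (1\<^sub>m n - X * Y) * VinvT;
                 Bc = minv Ub * (Btc - X * B_check S * Dc);
                 Cc = (Ctc - Dc * red_C S * Y) * VinvT;
                 Ac = minv Ub * (Atc - X * (A_check S * Y + B_check S * Ctc)
                                     - Ub * Bc * red_C S * Y) * VinvT
             in invertible_mat Ub \<and> (\<exists>P Z'. robust_H2 S mu Ac Bc Cc Dc P Z')"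
      unfolding Let_def by blast
  qed
qed

end
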